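(* Let $S$ be a simple closed symmetric operator with equal (finite or infinite) defect numbers $(n,n)$ in a Pontryagin space $\Pi$, let $A$ be a self-adjoint extension of $S$ in $\Pi$ with defect family $\gamma(\lambda)$, and let $m$ be a $Q$-function of $(S,A,\gamma)$, with values in $\mathcal B(\mathcal G)$. Let $\tau\in\mathcal N(\mathcal G)$ be such that $m+\tau$ is regular. Let $\widetilde A$ be a $\Pi$-minimal self-adjoint extension of $S$ in a Pontryagin space $\widetilde\Pi$ containing $\Pi$, such that $$P_\Pi(\widetilde A-\lambda)^{-1}|_\Pi=(A-\lambda)^{-1}-\gamma(\lambda)(m(\lambda)+\tau(\lambda))^{-1}\gamma(\overline\lambda)^+$$ holds for all $\lambda\in\rho(A)\cap\mathfrak h((m+\tau)^{-1})$, where $P_\Pi$ is the orthogonal projection of $\widetilde\Pi$ onto $\Pi$. Then a point $\alpha\in\mathbb R$ is an eigenvalue of $\widetilde A$ if and only if there exist vectors $x_0,y_0\in\mathcal G$ with $(x_0;y_0)\ne(0;0)$ such that $$(x_0;y_0)\in m(\alpha)\quad\text{and}\quad(x_0;-y_0)\in\tau(\alpha).\qquad( * )$$ Furthermore, there exists a linear bijection between $\ker(\widetilde A-\alpha)$ and the space of all $(x_0;y_0)\in\mathcal G\oplus\mathcal G$ satisfying $( * )$.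
   Context: Generalised Nevanlinna functions: let $\mathcal G$ be a Hilbert space. A $\mathcal B(\mathcal G)$-valued function $Q$, meromorphic on $\mathbb C\setminus\mathbb R$ with $Q(\lambda)^*=Q(\overline\lambda)$ at all points of holomorphy, belongs to $\mathcal N_\kappa(\mathcal G)$ if the kernel $K_Q(\lambda,\mu)=\frac{Q(\lambda)-Q(\mu)^*}{\lambda-\overline\mu}$ has $\kappa$ negative squares, i.e. for any $m\in\mathbb N$, points of holomorphy $\lambda_1,\dots,\lambda_m\in\mathbb C^+$ and $\xi_1,\dots,\xi_m\in\mathcal G$ the matrix $\big((K_Q(\lambda_i,\lambda_j)\xi_i,\xi_j)\big)_{i,j=1}^m$ has at most $\kappa$ negative eigenvalues and $\kappa$ is minimal with this property. $\mathcal N(\mathcal G)=\bigcup_{\kappa\ge0}\mathcal N_\kappa(\mathcal G)$. $\mathfrak h(Q)$ consists of all points of $\mathbb C\setminus\mathbb R$ where $Q$ is holomorphic and all $\mu\in\mathbb R$ such that $Q$ has a holomorphic continuation to a neighbourhood of $\mu$. $Q$ is regular if $Q(\mu_0)$ is boundedly invertible for some $\mu_0\in\mathfrak h(Q)$. Linear relations are linear subspaces of products of spaces, with elements written $(x;y)$; operators are identified with their graphs, and inverses, sums and products are in the sense of relations. Self-adjoint extensions may be relations; $\alpha$ is an eigenvalue of a relation $B$ if $\ker(B-\alpha)=\{v:(v;\alpha v)\in B\}\neq\{0\}$. Setting: $S^+$ and $\gamma^+$ denote adjoints with respect to the Pontryagin space inner product. Fix $\lambda_0\in\rho(A)\cap\mathbb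 C^+$, a Hilbert space $\mathcal G$ with $\dim\mathcal G=n$, and a linear bijection $\gamma\in\mathcal B(\mathcal G,\ker(S^+-\lambda_0))$. The defect family is $\gamma(\lambda)=(I+(\lambda-\lambda_0)(A-\lambda)^{-1})\gamma$, $\lambda\in\rho(A)$. $S$ is simple: $\Pi=\overline{\mathrm{span}}\{\ker(S^+-\lambda):\lambda\in\rho(A)\}=\overline{\mathrm{span}}\{\gamma(\lambda)x:\lambda\in\rho(A),x\in\mathcal G\}$. A $Q$-function of $(S,A,\gamma)$ is a function $m\in\mathcal N(\mathcal G)$ with $\frac{m(\lambda)-m(\mu)^*}{\lambda-\overline\mu}=\gamma(\mu)^+\gamma(\lambda)$ for $\lambda,\mu\in\rho(A)$; it is unique up to a self-adjoint additive constant in $\mathcal B(\mathcal G)$. $\Pi$-minimality of $\widetilde A$: $\widetilde\Pi=\overline{\mathrm{span}}\{(I+(\lambda-\lambda_0)(\widetilde A-\lambda)^{-1})\gamma x:\lambda\in\rho(\widetilde A),\ x\in\mathcal G\}$. Generalised value: a minimal realisation of $Q\in\mathcal N(\mathcal G)$ is a triple $(\Pi',A',\gamma')$ with $\Pi'$ a Pontryagin space, $A'$ a self-adjoint relation in $\Pi'$, $\gamma':\mathcal G\to\Pi'$ bounded linear, such that for some $\lambda_0\in\mathfrak h(Q)\cap\rho(A')\cap\mathbb C^+$ one has $Q(\lambda)=Q(\lambda_0)^*+(\lambda-\overline{\lambda_0})\gamma'^+(I+(\lambda-\lambda_0)(A'-\lambda)^{-1})\gamma'$ for $\lambda\in\mathfrak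 h(Q)\cap\rho(A')$ and $\Pi'=\overline{\mathrm{span}}\{(I+(\lambda-\lambda_0)(A'-\lambda)^{-1})\gamma'x:\lambda\in\rho(A'),x\in\mathcal G\}$; it always exists. For $\alpha\in\mathbb R$, $Q(\alpha)$ is the linear relation $Q(\alpha)=Q(\lambda_0)^*+(\alpha-\overline{\lambda_0})\gamma'^+(I+(\alpha-\lambda_0)(A'-\alpha)^{-1})\gamma'$ in $\mathcal G\times\mathcal G$, with $(A'-\alpha)^{-1}$ understood as a relation; it does not depend on the chosen minimal realisation. *)

theory Defs
  imports
    "HOL-Analysis.Analysis"
    "HOL-Library.Equipollence"
    "Jordan_Normal_Form.Char_Poly"
begin

section \<open>Complex vector spaces and complex Hilbert spaces\<close>

class complex_vector = ab_group_add +
  fixes scaleC :: "complex \<Rightarrow> 'a \<Rightarrow> 'a"  (infixr \<open>*\<^sub>C\<close> 75)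
  assumes scaleC_add_right: "a *\<^sub>C (x + y) = a *\<^sub>C x + a *\<^sub>C y"
    and scaleC_add_left: "(a + b) *\<^sub>C x = a *\<^sub>C x + b *\<^sub>C x"
    and scaleC_scaleC: "a *\<^sub>C b *\<^sub>C x = (a * b) *\<^sub>C x"
    and scaleC_one: "1 *\<^sub>C x = x"

global_interpretation complex_vector:
  vector_space "scaleC :: complex \<Rightarrow> 'a \<Rightarrow> 'a::complex_vector"
  by unfold_locales (rule scaleC_add_right scaleC_add_left scaleC_scaleC scaleC_one)+

abbreviation csubspace :: "'a::complex_vector set \<Rightarrow> bool" where
  "csubspace \<equiv> complex_vector.subspace"

abbreviation cspan :: "'a::complex_vector set \<Rightarrow> 'a set" where
  "cspan \<equiv> complex_vector.span"

instantiation prod :: (complex_vector, complex_vector) complex_vector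
begin

definition scaleC_prod :: "complex \<Rightarrow> 'a \<times> 'b \<Rightarrow> 'a \<times> 'b" where
  "scaleC_prod c p = (c *\<^sub>C fst p, c *\<^sub>C snd p)"

instance
  by standard
    (auto simp: scaleC_prod_def plus_prod_def scaleC_add_right scaleC_add_left
       scaleC_scaleC scaleC_one)

end

text \<open>The underlying real Hilbert space structure (norm, topology, completeness) is that of
  the library; the complex inner product is linear in its first argument.\<close>

class complex_hilbert_space = complex_vector + real_inner + complete_space +
  fixes cinner :: "'a \<Rightarrow> 'a \<Rightarrow> complex"
  assumes scaleR_eq_scaleC: "r *\<^sub>R x = complex_of_real r *\<^sub>C x"
    and cinner_add_left: "cinner (x + y) z = cinner x z + cinner y z"
    and cinner_scaleC_left: "cinner (c *\<^sub>C x) y = c * cinner x y"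
    and cinner_commute: "cinner y x = cnj (cinner x y)"
    and Re_cinner: "Re (cinner x y) = inner x y"

instantiation complex :: complex_hilbert_space
begin

definition scaleC_complex :: "complex \<Rightarrow> complex \<Rightarrow> complex" where
  "scaleC_complex c x = c * x"

definition cinner_complex :: "complex \<Rightarrow> complex \<Rightarrow> complex" where
  "cinner_complex x y = x * cnj y"

instance
  by standard
    (auto simp: scaleC_complex_def cinner_complex_def algebra_simps inner_complex_def
       scaleR_conv_of_real)

end

lemma cinner_self: "cinner x x = complex_of_real ((norm (x::'a::complex_hilbert_space))\<^sup>2)"
proof (rule complex_eqI)
  show "Im (cinner x x) = Im (complex_of_real ((norm x)\<^sup>2))"
    using arg_cong[OF cinner_commute[of x x], of Im] by simp
qed (simp add: Re_cinner power2_norm_eq_inner)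

lemma norm_scaleC: "norm (c *\<^sub>C x) = cmod c * norm (x::'a::complex_hilbert_space)"
proof -
  have "cinner (c *\<^sub>C x) (c *\<^sub>C x) = c * cnj c * cinner x x"
    by (metis cinner_commute cinner_scaleC_left complex_cnj_mult mult.assoc mult.left_commute)
  then have "complex_of_real ((norm (c *\<^sub>C x))\<^sup>2) = complex_of_real ((cmod c * norm x)\<^sup>2)"
    by (simp add: cinner_self power_mult_distrib flip: complex_norm_square)
  then have "(norm (c *\<^sub>C x))\<^sup>2 = (cmod c * norm x)\<^sup>2"
    using of_real_eq_iff by blast
  then show ?thesis
    by (simp add: power2_eq_iff_nonneg)
qed

lemma bounded_linear_scaleC: "bounded_linear (\<lambda>x::'a::complex_hilbert_space. c *\<^sub>C x)"
  by (rule bounded_linear_intro[where K = "cmod c"])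
    (simp_all add: scaleC_add_right scaleR_eq_scaleC scaleC_scaleC norm_scaleC mult.commute)

definition clinear_on :: "'a::complex_vector set \<Rightarrow> ('a \<Rightarrow> 'b::complex_vector) \<Rightarrow> bool" where
  "clinear_on V f \<longleftrightarrow>
     (\<forall>x\<in>V. \<forall>y\<in>V. f (x + y) = f x + f y) \<and> (\<forall>c. \<forall>x\<in>V. f (c *\<^sub>C x) = c *\<^sub>C f x)"


section \<open>Pontryagin spaces\<close>

text \<open>A space is a pair of a carrier set and a form, so that one form serves a space
  and its subspaces.  Forms are linear in the first argument.\<close>

type_synonym 'v form = "'v \<Rightarrow> 'v \<Rightarrow> complex"

definition hermitian_form_on :: "'v::complex_vector set \<Rightarrow> 'v form \<Rightarrow> bool" where
  "hermitian_form_on V ip \<longleftrightarrow>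
     (\<forall>x\<in>V. \<forall>y\<in>V. \<forall>z\<in>V. ip (x + y) z = ip x z + ip y z) \<and>
     (\<forall>c. \<forall>x\<in>V. \<forall>y\<in>V. ip (c *\<^sub>C x) y = c * ip x y) \<and>
     (\<forall>x\<in>V. \<forall>y\<in>V. ip y x = cnj (ip x y))"

definition form_norm :: "'v form \<Rightarrow> 'v \<Rightarrow> real" where
  "form_norm h x = sqrt (Re (h x x))"

definition hilbert_on :: "'v::complex_vector set \<Rightarrow> 'v form \<Rightarrow> bool" where
  "hilbert_on P h \<longleftrightarrow>
     csubspace P \<and> hermitian_form_on P h \<and> (\<forall>x\<in>P. x \<noteq> 0 \<longrightarrow> 0 < Re (h x x)) \<and>
     (\<forall>X::nat \<Rightarrow> 'v. range X \<subseteq> P \<and>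
        (\<forall>e>0. \<exists>M. \<forall>i\<ge>M. \<forall>j\<ge>M. form_norm h (X i - X j) < e) \<longrightarrow>
        (\<exists>l\<in>P. (\<lambda>i. form_norm h (X i - l)) \<longlonglongrightarrow> 0))"

definition fundamental_decomposition ::
    "'v::complex_vector set \<Rightarrow> 'v form \<Rightarrow> 'v set \<Rightarrow> 'v set \<Rightarrow> bool" where
  "fundamental_decomposition V ip P N \<longleftrightarrow>
     V = {p + n |p n. p \<in> P \<and> n \<in> N} \<and> (\<forall>p\<in>P. \<forall>n\<in>N. ip p n = 0) \<and>
     hilbert_on P ip \<and>
     csubspace N \<and> (\<forall>n\<in>N. n \<noteq> 0 \<longrightarrow> Re (ip n n) < 0) \<and> (\<exists>B. finite B \<and> N = cspan B)"

text \<open>Convention: the negative index is the finite one.\<close>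

definition pontryagin_space :: "'v::complex_vector set \<Rightarrow> 'v form \<Rightarrow> bool" where
  "pontryagin_space V ip \<longleftrightarrow>
     csubspace V \<and> hermitian_form_on V ip \<and> (\<exists>P N. fundamental_decomposition V ip P N)"

text \<open>The Hilbert space inner product of one chosen fundamental decomposition.  All
  fundamental decompositions give equivalent norms, and only the topology, boundedness and
  Hilbert dimensions are used below.\<close>

definition majorant :: "'v::complex_vector set \<Rightarrow> 'v form \<Rightarrow> 'v form" where
  "majorant V ip =
     (let (P, N) = (SOME (P, N). fundamental_decomposition V ip P N);
          pos = (\<lambda>x. THE p. p \<in> P \<and> x - p \<in> N)
      in (\<lambda>x y. ip (pos x) (pos y) - ip (x - pos x) (y - pos y)))"

definition pnorm :: "'v::complex_vector set \<Rightarrow> 'v form \<Rightarrow> 'v \<Rightarrow> real" where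
  "pnorm V ip = form_norm (majorant V ip)"

definition pclosure :: "'v::complex_vector set \<Rightarrow> 'v form \<Rightarrow> 'v set \<Rightarrow> 'v set" where
  "pclosure V ip W = {v \<in> V. \<forall>e>0. \<exists>w\<in>W. pnorm V ip (v - w) < e}"

definition bounded_op_on :: "'v::complex_vector set \<Rightarrow> 'v form \<Rightarrow> ('v \<Rightarrow> 'v) \<Rightarrow> bool" where
  "bounded_op_on V ip R \<longleftrightarrow>
     clinear_on V R \<and> R ` V \<subseteq> V \<and> (\<exists>C. \<forall>x\<in>V. pnorm V ip (R x) \<le> C * pnorm V ip x)"

definition bounded_map_into ::
    "'v::complex_vector set \<Rightarrow> 'v form \<Rightarrow> ('g::complex_hilbert_space \<Rightarrow> 'v) \<Rightarrow> bool" where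
  "bounded_map_into V ip g \<longleftrightarrow>
     clinear_on UNIV g \<and> range g \<subseteq> V \<and> (\<exists>C. \<forall>x. pnorm V ip (g x) \<le> C * norm x)"

text \<open>Adjoint of a bounded map from a Hilbert space into a Pontryagin space.\<close>

definition padj :: "'v form \<Rightarrow> ('g::complex_hilbert_space \<Rightarrow> 'v) \<Rightarrow> 'v \<Rightarrow> 'g" where
  "padj ip g v = (THE y. \<forall>x. cinner y x = ip v (g x))"

text \<open>An intrinsically complete nondegenerate subspace of a Pontryagin space need not be
  closed in it, so the existence of the orthogonal projection is part of the definition.\<close>

definition pontryagin_subspace ::
    "'v::complex_vector set \<Rightarrow> 'v set \<Rightarrow> 'v form \<Rightarrow> bool" where
  "pontryagin_subspace V W ip \<longleftrightarrow>
     V \<subseteq> W \<and> pontryagin_space V ip \<and> (\<forall>v\<in>W. \<exists>p\<in>V. \<forall>u\<in>V. ip (v - p) u = 0)"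

definition orth_proj :: "'v::complex_vector set \<Rightarrow> 'v form \<Rightarrow> 'v \<Rightarrow> 'v" where
  "orth_proj V ip v = (THE p. p \<in> V \<and> (\<forall>u\<in>V. ip (v - p) u = 0))"

text \<open>\<open>n\<close> is a set representing the cardinal number \<open>card_of n\<close>.\<close>

definition has_hilbert_dim :: "'v::complex_vector set \<Rightarrow> 'v form \<Rightarrow> 'n set \<Rightarrow> bool" where
  "has_hilbert_dim L h n \<longleftrightarrow>
     (\<exists>B\<subseteq>L. (\<forall>x\<in>B. \<forall>y\<in>B. h x y = (if x = y then 1 else 0)) \<and>
        (\<forall>v\<in>L. \<forall>e>0. \<exists>w\<in>cspan B. form_norm h (v - w) < e) \<and> B \<approx> n)"


section \<open>Linear relations\<close>

definition rel_graph :: "'a set \<Rightarrow> ('a \<Rightarrow> 'b) \<Rightarrow> ('a \<times> 'b) set" where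
  "rel_graph V f = {(x, f x) |x. x \<in> V}"

definition rel_add :: "('a \<times> 'b::plus) set \<Rightarrow> ('a \<times> 'b) set \<Rightarrow> ('a \<times> 'b) set" where
  "rel_add R T = {(x, y + z) |x y z. (x, y) \<in> R \<and> (x, z) \<in> T}"

definition rel_scale :: "complex \<Rightarrow> ('a \<times> 'b::complex_vector) set \<Rightarrow> ('a \<times> 'b) set" where
  "rel_scale c R = {(x, c *\<^sub>C y) |x y. (x, y) \<in> R}"

definition rel_shift ::
    "('v::complex_vector \<times> 'v) set \<Rightarrow> complex \<Rightarrow> ('v \<times> 'v) set" where
  "rel_shift B \<zeta> = {(x, y - \<zeta> *\<^sub>C x) |x y. (x, y) \<in> B}"

definition rel_ker :: "('v::complex_vector \<times> 'v) set \<Rightarrow> complex \<Rightarrow> 'v set" where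
  "rel_ker B \<zeta> = {v. (v, \<zeta> *\<^sub>C v) \<in> B}"

definition is_eigenvalue :: "('v::complex_vector \<times> 'v) set \<Rightarrow> complex \<Rightarrow> bool" where
  "is_eigenvalue B \<zeta> \<longleftrightarrow> rel_ker B \<zeta> \<noteq> {0}"

definition rel_adj ::
    "'v::complex_vector set \<Rightarrow> 'v form \<Rightarrow> ('v \<times> 'v) set \<Rightarrow> ('v \<times> 'v) set" where
  "rel_adj V ip B = {(u, v). u \<in> V \<and> v \<in> V \<and> (\<forall>(x, y)\<in>B. ip y u = ip x v)}"

definition selfadjoint_relation ::
    "'v::complex_vector set \<Rightarrow> 'v form \<Rightarrow> ('v \<times> 'v) set \<Rightarrow> bool" where
  "selfadjoint_relation V ip A \<longleftrightarrow> csubspace A \<and> A \<subseteq> V \<times> V \<and> A = rel_adj V ip A"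

text \<open>The operator is identified with its graph; it need not be densely defined.\<close>

definition closed_symmetric_operator ::
    "'v::complex_vector set \<Rightarrow> 'v form \<Rightarrow> ('v \<times> 'v) set \<Rightarrow> bool" where
  "closed_symmetric_operator V ip S \<longleftrightarrow>
     csubspace S \<and> S \<subseteq> V \<times> V \<and> (\<forall>y. (0, y) \<in> S \<longrightarrow> y = 0) \<and> S \<subseteq> rel_adj V ip S \<and>
     (\<forall>x\<in>V. \<forall>y\<in>V.
        (\<forall>e>0. \<exists>(x', y')\<in>S. pnorm V ip (x - x') < e \<and> pnorm V ip (y - y') < e) \<longrightarrow>
        (x, y) \<in> S)"

text \<open>In a Pontryagin space the dimension of the defect space is constant on the upper and
  on the lower half-plane only up to finitely many exceptional points.\<close>

definition has_defect_numbers ::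
    "'v::complex_vector set \<Rightarrow> 'v form \<Rightarrow> ('v \<times> 'v) set \<Rightarrow> 'm set \<Rightarrow> 'n set \<Rightarrow> bool" where
  "has_defect_numbers V ip S np nm \<longleftrightarrow>
     finite {\<zeta>. Im \<zeta> > 0 \<and> \<not> has_hilbert_dim (rel_ker (rel_adj V ip S) \<zeta>) (majorant V ip) np} \<and>
     finite {\<zeta>. Im \<zeta> < 0 \<and> \<not> has_hilbert_dim (rel_ker (rel_adj V ip S) \<zeta>) (majorant V ip) nm}"

definition resolvent_rel ::
    "('v::complex_vector \<times> 'v) set \<Rightarrow> complex \<Rightarrow> ('v \<times> 'v) set" where
  "resolvent_rel A \<zeta> = (rel_shift A \<zeta>)\<inverse>"

definition resolvent_set ::
    "'v::complex_vector set \<Rightarrow> 'v form \<Rightarrow> ('v \<times> 'v) set \<Rightarrow> complex set" where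
  "resolvent_set V ip A = {\<zeta>. \<exists>R. bounded_op_on V ip R \<and> resolvent_rel A \<zeta> = rel_graph V R}"

definition resolvent_op ::
    "('v::complex_vector \<times> 'v) set \<Rightarrow> complex \<Rightarrow> 'v \<Rightarrow> 'v" where
  "resolvent_op A \<zeta> x = (THE y. (x, y) \<in> resolvent_rel A \<zeta>)"

definition defect_family ::
    "('v::complex_vector \<times> 'v) set \<Rightarrow> complex \<Rightarrow> ('g \<Rightarrow> 'v) \<Rightarrow> complex \<Rightarrow> 'g \<Rightarrow> 'v" where
  "defect_family A \<zeta>\<^sub>0 g \<zeta> x = g x + (\<zeta> - \<zeta>\<^sub>0) *\<^sub>C resolvent_op A \<zeta> (g x)"

definition minimal_relation ::
    "'v::complex_vector set \<Rightarrow> 'v form \<Rightarrow> ('v \<times> 'v) set \<Rightarrow> complex \<Rightarrow> ('g \<Rightarrow> 'v) \<Rightarrow> bool" where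
  "minimal_relation V ip A \<zeta>\<^sub>0 g \<longleftrightarrow>
     V = pclosure V ip
           (cspan {defect_family A \<zeta>\<^sub>0 g \<zeta> x |\<zeta> x. \<zeta> \<in> resolvent_set V ip A})"

definition simple_symmetric ::
    "'v::complex_vector set \<Rightarrow> 'v form \<Rightarrow> ('v \<times> 'v) set \<Rightarrow> ('v \<times> 'v) set \<Rightarrow> bool" where
  "simple_symmetric V ip S A \<longleftrightarrow>
     V = pclosure V ip
           (cspan (\<Union>\<zeta>\<in>resolvent_set V ip A. rel_ker (rel_adj V ip S) \<zeta>))"


section \<open>Operator-valued meromorphic functions\<close>

definition scale_op :: "complex \<Rightarrow> 'g::complex_hilbert_space \<Rightarrow>\<^sub>L 'g" where
  "scale_op c = Blinfun (\<lambda>x. c *\<^sub>C x)"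

text \<open>Bounded operators are bounded real-linear functions that are in addition complex-linear.\<close>

definition clinear_op :: "('g::complex_hilbert_space \<Rightarrow>\<^sub>L 'g) \<Rightarrow> bool" where
  "clinear_op T \<longleftrightarrow> clinear_on UNIV (blinfun_apply T)"

definition op_adj :: "('g::complex_hilbert_space \<Rightarrow>\<^sub>L 'g) \<Rightarrow> 'g \<Rightarrow>\<^sub>L 'g" where
  "op_adj T = (THE T'. \<forall>x y. cinner (blinfun_apply T x) y = cinner x (blinfun_apply T' y))"

definition op_invertible :: "('g::complex_hilbert_space \<Rightarrow>\<^sub>L 'g) \<Rightarrow> bool" where
  "op_invertible T \<longleftrightarrow> (\<exists>R. R o\<^sub>L T = id_blinfun \<and> T o\<^sub>L R = id_blinfun)"

definition op_inv :: "('g::complex_hilbert_space \<Rightarrow>\<^sub>L 'g) \<Rightarrow> 'g \<Rightarrow>\<^sub>L 'g" where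
  "op_inv T = (THE R. R o\<^sub>L T = id_blinfun \<and> T o\<^sub>L R = id_blinfun)"

text \<open>A function that is meromorphic on \<open>\<complex> - \<real>\<close> is represented by a total function.  Its
  values on \<open>\<real>\<close> and at isolated points are irrelevant: the set \<open>\<hh>(Q)\<close> and the value of \<open>Q\<close>
  at a point of \<open>\<hh>(Q)\<close> only depend on the values of \<open>Q\<close> at nearby nonreal points.\<close>

type_synonym 'g opfun = "complex \<Rightarrow> 'g \<Rightarrow>\<^sub>L 'g"

definition hdom :: "('g::complex_hilbert_space) opfun \<Rightarrow> complex set" where
  "hdom Q = {z. \<exists>F r. r > 0 \<and>
     (\<forall>w\<in>ball z r. \<exists>D. (F has_derivative (\<lambda>h. scale_op h o\<^sub>L D)) (at w)) \<and>
     (\<forall>w\<in>ball z r. w \<notin> \<real> \<and> w \<noteq> z \<longrightarrow> F w = Q w)}"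

definition hval :: "('g::complex_hilbert_space) opfun \<Rightarrow> 'g opfun" where
  "hval Q z = Lim (at z within - \<real>) Q"

definition meromorphic_nonreal :: "('g::complex_hilbert_space) opfun \<Rightarrow> bool" where
  "meromorphic_nonreal Q \<longleftrightarrow>
     (\<forall>z. z \<notin> \<real> \<longrightarrow> (\<exists>k::nat. z \<in> hdom (\<lambda>w. scale_op ((w - z) ^ k) o\<^sub>L Q w)))"

definition regular_opfun :: "('g::complex_hilbert_space) opfun \<Rightarrow> bool" where
  "regular_opfun Q \<longleftrightarrow> (\<exists>\<mu>\<^sub>0\<in>hdom Q. op_invertible (hval Q \<mu>\<^sub>0))"


section \<open>Generalised Nevanlinna functions\<close>

text \<open>Eigenvalues are counted with (algebraic) multiplicity.\<close>

definition num_neg_eigenvalues :: "complex mat \<Rightarrow> nat" where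
  "num_neg_eigenvalues M =
     (\<Sum>a \<in> {a. eigenvalue M a \<and> a \<in> \<real> \<and> Re a < 0}. order a (char_poly M))"

definition nev_kernel ::
    "('g::complex_hilbert_space) opfun \<Rightarrow> complex \<Rightarrow> complex \<Rightarrow> 'g \<Rightarrow>\<^sub>L 'g" where
  "nev_kernel Q \<zeta> \<mu> = scale_op (1 / (\<zeta> - cnj \<mu>)) o\<^sub>L (hval Q \<zeta> - op_adj (hval Q \<mu>))"

definition at_most_neg_squares :: "nat \<Rightarrow> ('g::complex_hilbert_space) opfun \<Rightarrow> bool" where
  "at_most_neg_squares \<kappa> Q \<longleftrightarrow>
     (\<forall>(m::nat) (\<zeta>::nat \<Rightarrow> complex) (\<xi>::nat \<Rightarrow> 'g).
        (\<forall>i<m. \<zeta> i \<in> hdom Q \<and> Im (\<zeta> i) > 0) \<longrightarrow>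
        num_neg_eigenvalues
          (mat m m (\<lambda>(i, j). cinner (blinfun_apply (nev_kernel Q (\<zeta> i) (\<zeta> j)) (\<xi> i)) (\<xi> j))) \<le> \<kappa>)"

definition gen_nevanlinna_class :: "nat \<Rightarrow> ('g::complex_hilbert_space) opfun set" where
  "gen_nevanlinna_class \<kappa> =
     {Q. meromorphic_nonreal Q \<and>
         (\<forall>z\<in>hdom Q. clinear_op (hval Q z)) \<and>
         (\<forall>z\<in>hdom Q - \<real>. op_adj (hval Q z) = hval Q (cnj z)) \<and>
         at_most_neg_squares \<kappa> Q \<and> (\<forall>k<\<kappa>. \<not> at_most_neg_squares k Q)}"

definition gen_nevanlinna :: "('g::complex_hilbert_space) opfun set" where
  "gen_nevanlinna = (\<Union>\<kappa>. gen_nevanlinna_class \<kappa>)"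

text \<open>The inclusion of the resolvent set in \<open>\<hh>(m)\<close> makes \<open>m(\<zeta>)\<close> meaningful; it also
  follows from the identity and the meromorphy of \<open>m\<close>.\<close>

definition is_Q_function ::
    "'v::complex_vector set \<Rightarrow> 'v form \<Rightarrow> ('v \<times> 'v) set \<Rightarrow> complex \<Rightarrow>
     ('g::complex_hilbert_space \<Rightarrow> 'v) \<Rightarrow> 'g opfun \<Rightarrow> bool" where
  "is_Q_function V ip A \<zeta>\<^sub>0 g m \<longleftrightarrow>
     m \<in> gen_nevanlinna \<and> resolvent_set V ip A \<subseteq> hdom m \<and>
     (\<forall>\<zeta>\<in>resolvent_set V ip A. \<forall>\<mu>\<in>resolvent_set V ip A. \<zeta> \<noteq> cnj \<mu> \<longrightarrow>
        (\<forall>x. blinfun_apply (nev_kernel m \<zeta> \<mu>) x =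
             padj ip (defect_family A \<zeta>\<^sub>0 g \<mu>) (defect_family A \<zeta>\<^sub>0 g \<zeta> x)))"

definition minimal_realisation ::
    "('g::complex_hilbert_space) opfun \<Rightarrow> 'v::complex_vector set \<Rightarrow> 'v form \<Rightarrow> ('v \<times> 'v) set \<Rightarrow>
     complex \<Rightarrow> ('g \<Rightarrow> 'v) \<Rightarrow> bool" where
  "minimal_realisation Q V ip A \<zeta>\<^sub>0 g \<longleftrightarrow>
     pontryagin_space V ip \<and> selfadjoint_relation V ip A \<and> bounded_map_into V ip g \<and>
     \<zeta>\<^sub>0 \<in> hdom Q \<inter> resolvent_set V ip A \<and> Im \<zeta>\<^sub>0 > 0 \<and>
     (\<forall>\<zeta> \<in> hdom Q \<inter> resolvent_set V ip A. \<forall>x.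
        blinfun_apply (hval Q \<zeta>) x =
          blinfun_apply (op_adj (hval Q \<zeta>\<^sub>0)) x
          + (\<zeta> - cnj \<zeta>\<^sub>0) *\<^sub>C padj ip g (defect_family A \<zeta>\<^sub>0 g \<zeta> x)) \<and>
     minimal_relation V ip A \<zeta>\<^sub>0 g"

text \<open>The generalised value \<open>Q(\<alpha>)\<close>, as a linear relation, computed from a minimal realisation
  of \<open>Q\<close>.  Minimal realisations always exist (in a suitable ambient type) and the value does
  not depend on their choice, so that statements about \<open>Q(\<alpha>)\<close> are to be made for an arbitrary
  minimal realisation.  Note that \<open>O\<close> composes from left to right.\<close>

definition generalised_value ::
    "('g::complex_hilbert_space) opfun \<Rightarrow> 'v::complex_vector set \<Rightarrow> 'v form \<Rightarrow> ('v \<times> 'v) set \<Rightarrow>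
     complex \<Rightarrow> ('g \<Rightarrow> 'v) \<Rightarrow> real \<Rightarrow> ('g \<times> 'g) set" where
  "generalised_value Q V ip A \<zeta>\<^sub>0 g \<alpha> =
     rel_add (rel_graph UNIV (blinfun_apply (op_adj (hval Q \<zeta>\<^sub>0))))
       (rel_scale (of_real \<alpha> - cnj \<zeta>\<^sub>0)
          (rel_graph UNIV g
           O rel_add (Id_on V) (rel_scale (of_real \<alpha> - \<zeta>\<^sub>0) (resolvent_rel A (of_real \<alpha>)))
           O rel_graph V (padj ip g)))"

text \<open>Krein's formula, as an equality of relations in \<open>V\<close>: on the left-hand side the resolvent
  of \<open>At\<close> is a relation, compressed to \<open>V\<close>.\<close>

definition krein_formula ::
    "'v::complex_vector set \<Rightarrow> 'v form \<Rightarrow> ('v \<times> 'v) set \<Rightarrow> complex \<Rightarrow>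
     ('g::complex_hilbert_space \<Rightarrow> 'v) \<Rightarrow> 'g opfun \<Rightarrow> 'g opfun \<Rightarrow> ('v \<times> 'v) set \<Rightarrow> bool" where
  "krein_formula V ip A \<zeta>\<^sub>0 g m \<tau> At \<longleftrightarrow>
     (let W = (\<lambda>z. op_inv (m z + \<tau> z)) in
      \<forall>\<zeta> \<in> resolvent_set V ip A \<inter> hdom W.
        Id_on V O resolvent_rel At \<zeta> O rel_graph UNIV (orth_proj V ip) =
        rel_graph V (\<lambda>v. resolvent_op A \<zeta> v -
          defect_family A \<zeta>\<^sub>0 g \<zeta>
            (blinfun_apply (hval W \<zeta>) (padj ip (defect_family A \<zeta>\<^sub>0 g (cnj \<zeta>)) v))))"

end

theory Submission
  imports Defs "HOL-Complex_Analysis.Conformal_Mappings"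
begin

text \<open>A pair \<open>(x, y)\<close> belongs to the generalised value \<open>Q(\<alpha>)\<close> iff some vector \<open>f\<close> of the model
  space satisfies \<open>(\<alpha> - \<mu>) [\<gamma>(\<mu>)u, f] = (u, y) - (Q(\<mu>)u, x)\<close> for all \<open>u\<close> and all \<open>\<mu>\<close> in a small
  set meeting both half-planes; this condition only involves pairings with the defect vectors,
  whose Gram matrix is the Nevanlinna kernel of \<open>Q\<close>.  Krein's formula says that the vectors \<open>h\<close>
  and \<open>(At - \<mu>)\<^sup>-\<^sup>1 h\<close>, \<open>h\<close> in \<open>V\<close>, have the same Gram matrix as explicit vectors in the orthogonal
  sum of \<open>V\<close> and the model space of \<open>\<tau>\<close>.  Total families with equal Gram matrices in two
  Pontryagin spaces give a unitary map, and under it an eigenvector of \<open>At\<close> at \<open>\<alpha>\<close> becomes a pair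
  \<open>(f, k)\<close> in which \<open>f\<close> and \<open>k\<close> have boundary values \<open>(x, y)\<close> and \<open>(x, - y)\<close>.\<close>

section \<open>Hermitian forms and Hilbert spaces on a carrier set\<close>

text \<open>The generalised values may come from realisations on spaces unrelated to
  \<open>V\<close>, and \<open>At\<close> acts in a larger space, so everything is compared through
  inner products. Two obstacles shape the proof. First, an isometry for an indefinite form need not
  be continuous. In a Pontryagin space it is, because the definite norm is controlled by the form
  and finitely many functionals, and these can be taken from a dense subspace. Second, the
  identities are available only near one point of regularity, and dividing by \<zeta> - cnj \<mu>
  forbids conjugate points. Hence one open set in each half-plane is used, without conjugate pairs,
  and identities spread from there to the whole resolvent set: the nonreal spectrum of a
  self-adjoint relation with nonempty resolvent set is finite, so each half-plane stays connected
  after its removal. Both half-planes must be met because the real axis may consist of spectrum, and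
  then nothing continues across it.\<close>

locale hermitian_form =
  fixes V :: "'v::complex_vector set" and ip :: "'v form"
  assumes subspace: "csubspace V" and hermitian: "hermitian_form_on V ip"
begin

lemma zero_mem [simp]: "0 \<in> V"
  by (rule complex_vector.subspace_0[OF subspace])

lemma add_mem [simp]: "x \<in> V \<Longrightarrow> y \<in> V \<Longrightarrow> x + y \<in> V"
  by (rule complex_vector.subspace_add[OF subspace])

lemma diff_mem [simp]: "x \<in> V \<Longrightarrow> y \<in> V \<Longrightarrow> x - y \<in> V"
  by (rule complex_vector.subspace_diff[OF subspace])

lemma minus_mem [simp]: "x \<in> V \<Longrightarrow> - x \<in> V"
  by (rule complex_vector.subspace_neg[OF subspace])

lemma scale_mem [simp]: "x \<in> V \<Longrightarrow> c *\<^sub>C x \<in> V"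
  by (rule complex_vector.subspace_scale[OF subspace])

lemma sum_mem [simp]: "(\<And>i. i \<in> I \<Longrightarrow> f i \<in> V) \<Longrightarrow> sum f I \<in> V"
  by (rule complex_vector.subspace_sum[OF subspace])

lemma add_left [simp]: "x \<in> V \<Longrightarrow> y \<in> V \<Longrightarrow> z \<in> V \<Longrightarrow> ip (x + y) z = ip x z + ip y z"
  and scale_left [simp]: "x \<in> V \<Longrightarrow> y \<in> V \<Longrightarrow> ip (c *\<^sub>C x) y = c * ip x y"
  and commute: "x \<in> V \<Longrightarrow> y \<in> V \<Longrightarrow> ip y x = cnj (ip x y)"
  using hermitian unfolding hermitian_form_on_def by blast+

lemma add_right [simp]: "x \<in> V \<Longrightarrow> y \<in> V \<Longrightarrow> z \<in> V \<Longrightarrow> ip z (x + y) = ip z x + ip z y"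
  by (simp add: commute[of _ z])

lemma scale_right [simp]: "x \<in> V \<Longrightarrow> y \<in> V \<Longrightarrow> ip y (c *\<^sub>C x) = cnj c * ip y x"
  by (simp add: commute[of _ y])

lemma zero_left [simp]: "x \<in> V \<Longrightarrow> ip 0 x = 0"
  using scale_left[of x x 0] by simp

lemma zero_right [simp]: "x \<in> V \<Longrightarrow> ip x 0 = 0"
  using scale_right[of x x 0] by simp

lemma minus_left [simp]: "x \<in> V \<Longrightarrow> y \<in> V \<Longrightarrow> ip (- x) y = - ip x y"
  using scale_left[of x y "-1"] by simp

lemma minus_right [simp]: "x \<in> V \<Longrightarrow> y \<in> V \<Longrightarrow> ip y (- x) = - ip y x"
  using scale_right[of x y "-1"] by simp

lemma diff_left [simp]: "x \<in> V \<Longrightarrow> y \<in> V \<Longrightarrow> z \<in> V \<Longrightarrow> ip (x - y) z = ip x z - ip y z"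
  using add_left[of x "- y" z] by simp

lemma diff_right [simp]: "x \<in> V \<Longrightarrow> y \<in> V \<Longrightarrow> z \<in> V \<Longrightarrow> ip z (x - y) = ip z x - ip z y"
  using add_right[of x "- y" z] by simp

lemma sum_left: "(\<And>i. i \<in> I \<Longrightarrow> f i \<in> V) \<Longrightarrow> x \<in> V \<Longrightarrow> ip (sum f I) x = (\<Sum>i\<in>I. ip (f i) x)"
  by (induction I rule: infinite_finite_induct) auto

lemma Im_self: "x \<in> V \<Longrightarrow> Im (ip x x) = 0"
  using arg_cong[OF commute[of x x], of Im] by simp

lemma self_eq_Re: "x \<in> V \<Longrightarrow> ip x x = complex_of_real (Re (ip x x))"
  by (simp add: Im_self complex_eq_iff)

lemma Re_self_add:
  assumes "x \<in> V" "y \<in> V"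
  shows "Re (ip (x + y) (x + y)) = Re (ip x x) + 2 * Re (ip x y) + Re (ip y y)"
  using assms commute[of x y] by simp

lemma cspan_subset: "D \<subseteq> V \<Longrightarrow> cspan D \<subseteq> V"
  by (rule complex_vector.span_minimal[OF _ subspace])

lemma orthogonal_cspan:
  assumes "D \<subseteq> V" "v \<in> V" "\<And>d. d \<in> D \<Longrightarrow> ip d v = 0" "d \<in> cspan D"
  shows "ip d v = 0"
proof -
  have "csubspace {d \<in> V. ip d v = 0}"
    using assms(2) by (auto simp: complex_vector.subspace_def)
  moreover have "D \<subseteq> {d \<in> V. ip d v = 0}"
    using assms by auto
  ultimately show ?thesis
    using complex_vector.span_minimal assms(4) by blast
qed

end

section \<open>Definite forms: Cauchy-Schwarz, triangle inequality and orthonormal bases\<close>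

locale prehilbert_carrier = hermitian_form V h for V :: "'v::complex_vector set" and h +
  assumes Re_self_pos: "x \<in> V \<Longrightarrow> x \<noteq> 0 \<Longrightarrow> 0 < Re (h x x)"
begin

abbreviation nrm :: "'v \<Rightarrow> real" where "nrm \<equiv> form_norm h"

lemma Re_self_nonneg: "x \<in> V \<Longrightarrow> 0 \<le> Re (h x x)"
  using Re_self_pos[of x] by (cases "x = 0") auto

lemma nrm_sq: "x \<in> V \<Longrightarrow> (nrm x)\<^sup>2 = Re (h x x)"
  by (simp add: form_norm_def Re_self_nonneg)

lemma nrm_nonneg [simp]: "x \<in> V \<Longrightarrow> 0 \<le> nrm x"
  by (simp add: form_norm_def Re_self_nonneg)

lemma nrm_eq_0_iff: "x \<in> V \<Longrightarrow> nrm x = 0 \<longleftrightarrow> x = 0"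
  using Re_self_pos[of x] by (cases "x = 0") (auto simp: form_norm_def)

lemma nrm_0 [simp]: "nrm 0 = 0"
  by (simp add: form_norm_def)

lemma self_eq_nrm: "x \<in> V \<Longrightarrow> h x x = complex_of_real ((nrm x)\<^sup>2)"
  using self_eq_Re[of x] nrm_sq[of x] by simp

lemma Cauchy_Schwarz:
  assumes x: "x \<in> V" and y: "y \<in> V"
  shows "cmod (h x y) \<le> nrm x * nrm y"
proof (cases "y = 0")
  case False
  define a where "a = Re (h y y)"
  have a: "a > 0" and hyy: "h y y = of_real a"
    using False y Re_self_pos self_eq_Re by (auto simp: a_def)
  define c where "c = h x y / a"
  have "0 \<le> Re (h (x - c *\<^sub>C y) (x - c *\<^sub>C y))"
    using x y by (intro Re_self_nonneg) auto
  also have "h (x - c *\<^sub>C y) (x - c *\<^sub>C y) = h x x - (h x y * cnj (h x y)) / a"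
    using x y a by (simp add: commute[of x y] hyy c_def field_simps)
  also have "Re \<dots> = (nrm x)\<^sup>2 - (cmod (h x y))\<^sup>2 / a"
    by (simp add: nrm_sq[OF x] complex_mult_cnj cmod_power2 del: Re_divide_of_real flip: of_real_power of_real_add of_real_divide)
  finally have "(cmod (h x y))\<^sup>2 \<le> (nrm x)\<^sup>2 * (nrm y)\<^sup>2"
    using a by (simp add: field_simps nrm_sq[OF y] a_def)
  then show ?thesis
    using x y by (metis nrm_nonneg mult_nonneg_nonneg power2_le_imp_le power_mult_distrib)
qed (use x in auto)

lemma nrm_scale [simp]: "x \<in> V \<Longrightarrow> nrm (c *\<^sub>C x) = cmod c * nrm x"
proof -
  assume x: "x \<in> V"
  have "(nrm (c *\<^sub>C x))\<^sup>2 = Re (c * cnj c * h x x)"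
    using x by (simp add: nrm_sq algebra_simps)
  also have "\<dots> = (cmod c * nrm x)\<^sup>2"
    by (simp add: self_eq_nrm[OF x] complex_mult_cnj cmod_power2 power_mult_distrib)
  finally show ?thesis
    using x by (simp add: power2_eq_iff_nonneg)
qed

lemma nrm_minus [simp]: "x \<in> V \<Longrightarrow> nrm (- x) = nrm x"
  using nrm_scale[of x "-1"] by simp

lemma nrm_triangle: "x \<in> V \<Longrightarrow> y \<in> V \<Longrightarrow> nrm (x + y) \<le> nrm x + nrm y"
proof -
  assume x: "x \<in> V" and y: "y \<in> V"
  have "Re (h x y) \<le> nrm x * nrm y"
    using Cauchy_Schwarz[OF x y] complex_Re_le_cmod order_trans by blast
  then have "(nrm (x + y))\<^sup>2 \<le> (nrm x + nrm y)\<^sup>2"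
    using x y by (simp add: nrm_sq[of "x + y"] Re_self_add power2_sum nrm_sq[of x, symmetric]
        nrm_sq[of y, symmetric] del: add_left add_right)
  then show ?thesis
    using x y by (intro power2_le_imp_le[of "nrm (x + y)"]) auto
qed

lemma nrm_diff_commute: "x \<in> V \<Longrightarrow> y \<in> V \<Longrightarrow> nrm (x - y) = nrm (y - x)"
  using nrm_minus[of "x - y"] by simp

lemma nrm_diff_triangle: "x \<in> V \<Longrightarrow> y \<in> V \<Longrightarrow> z \<in> V \<Longrightarrow> nrm (x - z) \<le> nrm (x - y) + nrm (y - z)"
  using nrm_triangle[of "x - y" "y - z"] by simp

lemma nrm_triangle_diff: "x \<in> V \<Longrightarrow> y \<in> V \<Longrightarrow> nrm (x - y) \<le> nrm x + nrm y"
  using nrm_triangle[of x "- y"] by simp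

text \<open>Gram-Schmidt by induction: a new vector already in the span is dropped, otherwise its
  component orthogonal to \<open>E\<close> is normalised.\<close>

lemma orthonormalization:
  assumes "finite B" "B \<subseteq> V"
  shows "\<exists>E. finite E \<and> E \<subseteq> V \<and> (\<forall>x\<in>E. \<forall>y\<in>E. h x y = (if x = y then 1 else 0)) \<and> cspan E = cspan B"
  using assms
proof (induction B rule: finite_induct)
  case (insert b B)
  then have "\<exists>E. finite E \<and> E \<subseteq> V \<and> (\<forall>x\<in>E. \<forall>y\<in>E. h x y = (if x = y then 1 else 0)) \<and> cspan E = cspan B"
    by simp
  then obtain E where E: "finite E" "E \<subseteq> V" "\<And>x y. x \<in> E \<Longrightarrow> y \<in> E \<Longrightarrow> h x y = (if x = y then 1 else 0)"
    "cspan E = cspan B" by metis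
  have b: "b \<in> V" using insert by simp
  have span: "cspan (insert b B) = cspan (insert b E)"
    using E(4) by (simp add: complex_vector.span_insert)
  show ?case
  proof (cases "b \<in> cspan E")
    case True
    then show ?thesis
      using E span complex_vector.span_redundant[OF True] by (intro exI[of _ E]) auto
  next
    case False
    define w where "w = b - (\<Sum>e\<in>E. h b e *\<^sub>C e)"
    have s: "(\<Sum>e\<in>E. h b e *\<^sub>C e) \<in> cspan E"
      by (intro complex_vector.span_sum complex_vector.span_scale complex_vector.span_base)
    have w: "w \<in> V" "w \<noteq> 0"
      using b subsetD[OF E(2)] s False by (auto simp: w_def)
    have orth: "h w e = 0" if "e \<in> E" for e
    proof -
      have "h (\<Sum>e\<in>E. h b e *\<^sub>C e) e = (\<Sum>e'\<in>E. h b e' * h e' e)"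
        using subsetD[OF E(2)] that by (subst sum_left) (auto intro!: sum.cong)
      also have "\<dots> = (\<Sum>e'\<in>E. if e' = e then h b e else 0)"
        using E(3) that by (intro sum.cong) auto
      also have "\<dots> = h b e"
        using E(1) that by simp
      finally show ?thesis
        using b subsetD[OF E(2)] that by (auto simp: w_def)
    qed
    define e0 where "e0 = complex_of_real (1 / nrm w) *\<^sub>C w"
    have n: "nrm w > 0"
      using w nrm_eq_0_iff[of w] nrm_nonneg[of w] by linarith
    have e0: "e0 \<in> V" "h e0 e0 = 1"
      using w n by (simp_all add: e0_def self_eq_nrm[OF w(1)] power2_eq_square)
    have orth0: "h e0 e = 0" "h e e0 = 0" if "e \<in> E" for e
    proof -
      show "h e0 e = 0"
        using that orth w E(2) by (auto simp: e0_def)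
      then show "h e e0 = 0"
        using commute[of e0 e] e0 that E(2) by auto
    qed
    have be: "b = complex_of_real (nrm w) *\<^sub>C e0 + (\<Sum>e\<in>E. h b e *\<^sub>C e)"
      using n by (simp add: e0_def w_def scaleC_scaleC scaleC_one flip: of_real_mult)
    have "cspan (insert b E) = cspan (insert e0 E)"
    proof (rule antisym)
      have sub: "cspan E \<subseteq> cspan (insert e0 E)" "cspan E \<subseteq> cspan (insert b E)"
        by (auto intro!: complex_vector.span_mono)
      have "b \<in> cspan (insert e0 E)"
        using s sub
        by (subst be, intro complex_vector.span_add complex_vector.span_scale)
           (auto intro: complex_vector.span_base)
      then show "cspan (insert b E) \<subseteq> cspan (insert e0 E)"
        by (intro complex_vector.span_minimal) (auto intro: complex_vector.span_base)
      have "e0 \<in> cspan (insert b E)"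
        unfolding e0_def w_def using s sub
        by (intro complex_vector.span_diff complex_vector.span_scale)
           (auto intro: complex_vector.span_base)
      then show "cspan (insert e0 E) \<subseteq> cspan (insert b E)"
        by (intro complex_vector.span_minimal) (auto intro: complex_vector.span_base)
    qed
    moreover have "e0 \<notin> E"
      using orth0(1)[of e0] e0(2) by auto
    ultimately show ?thesis
      using E e0 orth0 span by (intro exI[of _ "insert e0 E"]) auto
  qed
qed (auto intro!: exI[of _ "{}"])

text \<open>Expansion and Parseval's identity, used twice: for the completeness of
  finite-dimensional spaces and for the Garding inequality of a fundamental decomposition.\<close>

lemma finite_span_orthonormal_basis:
  assumes "finite B" "V = cspan B"
  obtains E where "finite E" "E \<subseteq> V" "\<And>x. x \<in> V \<Longrightarrow> x = (\<Sum>e\<in>E. h x e *\<^sub>C e)"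
    "\<And>x. x \<in> V \<Longrightarrow> Re (h x x) = (\<Sum>e\<in>E. (cmod (h x e))\<^sup>2)" "\<And>e. e \<in> E \<Longrightarrow> nrm e = 1"
proof -
  obtain E where E: "finite E" "E \<subseteq> V" "\<And>x y. x \<in> E \<Longrightarrow> y \<in> E \<Longrightarrow> h x y = (if x = y then 1 else 0)"
    "cspan E = V"
    using orthonormalization[OF assms(1)] assms(2) complex_vector.span_superset[of B] by metis
  have exp: "x = (\<Sum>e\<in>E. h x e *\<^sub>C e)" if x: "x \<in> V" for x
  proof -
    obtain u where u: "x = (\<Sum>e\<in>E. u e *\<^sub>C e)"
      using x unfolding E(4)[symmetric] complex_vector.span_finite[OF E(1)] by auto
    have "h x e = u e" if e: "e \<in> E" for e
    proof -
      have "h x e = (\<Sum>e'\<in>E. u e' * h e' e)"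
        unfolding u using subsetD[OF E(2)] e by (subst sum_left) (auto intro!: sum.cong)
      also have "\<dots> = (\<Sum>e'\<in>E. if e' = e then u e else 0)"
        using E(3) e by (intro sum.cong) auto
      finally show ?thesis
        using E(1) e by simp
    qed
    then show ?thesis
      using u by simp
  qed
  have "Re (h x x) = (\<Sum>e\<in>E. (cmod (h x e))\<^sup>2)" if x: "x \<in> V" for x
  proof -
    have "h x x = h (\<Sum>e\<in>E. h x e *\<^sub>C e) x"
      using exp[OF x] by simp
    also have "\<dots> = (\<Sum>e\<in>E. h x e * h e x)"
      using subsetD[OF E(2)] x by (subst sum_left) (auto intro!: sum.cong)
    also have "\<dots> = (\<Sum>e\<in>E. complex_of_real ((cmod (h x e))\<^sup>2))"
    proof (rule sum.cong[OF refl])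
      fix e assume "e \<in> E"
      then show "h x e * h e x = complex_of_real ((cmod (h x e))\<^sup>2)"
        using commute[of x e] x subsetD[OF E(2)]
        by (simp add: complex_norm_square[symmetric] del: of_real_power)
    qed
    finally show ?thesis
      by simp
  qed
  moreover have "nrm e = 1" if "e \<in> E" for e
    using E(3)[OF that that] by (simp add: form_norm_def)
  ultimately show thesis
    using that E exp by blast
qed

text \<open>A fundamental decomposition only says that its negative part is finitely spanned; the
  completeness of that part is obtained here. By Cauchy-Schwarz the coordinates of a Cauchy sequence
  in an orthonormal basis are Cauchy sequences of complex numbers.\<close>

lemma complete_if_finite_span:
  assumes "finite B" "V = cspan B"
  shows "hilbert_on V h"
  unfolding hilbert_on_def
proof (intro conjI allI impI)
  obtain E where E: "finite E" "E \<subseteq> V" "\<And>x. x \<in> V \<Longrightarrow> x = (\<Sum>e\<in>E. h x e *\<^sub>C e)"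
    "\<And>x. x \<in> V \<Longrightarrow> Re (h x x) = (\<Sum>e\<in>E. (cmod (h x e))\<^sup>2)" "\<And>e. e \<in> E \<Longrightarrow> nrm e = 1"
    by (rule finite_span_orthonormal_basis[OF assms]) blast
  fix X :: "nat \<Rightarrow> 'v"
  assume X: "range X \<subseteq> V \<and> (\<forall>e>0. \<exists>M. \<forall>i\<ge>M. \<forall>j\<ge>M. nrm (X i - X j) < e)"
  then have mem: "X i \<in> V" for i by auto
  have "convergent (\<lambda>i. h (X i) e)" if e: "e \<in> E" for e
  proof (rule Cauchy_convergent, rule metric_CauchyI)
    fix r :: real assume "r > 0"
    then obtain M where M: "\<And>i j. i \<ge> M \<Longrightarrow> j \<ge> M \<Longrightarrow> nrm (X i - X j) < r"
      using X by meson
    have "dist (h (X i) e) (h (X j) e) < r" if "i \<ge> M" "j \<ge> M" for i j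
      using Cauchy_Schwarz[of "X i - X j" e] M[OF that] mem e E(2,5) by (auto simp: dist_norm)
    then show "\<exists>M. \<forall>m\<ge>M. \<forall>n\<ge>M. dist (h (X m) e) (h (X n) e) < r"
      by blast
  qed
  then obtain c where c: "\<And>e. e \<in> E \<Longrightarrow> (\<lambda>i. h (X i) e) \<longlonglongrightarrow> c e"
    unfolding convergent_def by metis
  define l where "l = (\<Sum>e\<in>E. c e *\<^sub>C e)"
  have l: "l \<in> V"
    unfolding l_def using subsetD[OF E(2)] by simp
  have nsum: "nrm (\<Sum>e\<in>F. u e *\<^sub>C e) \<le> (\<Sum>e\<in>F. cmod (u e))" if "F \<subseteq> E" for F u
    using finite_subset[OF that E(1)] that
  proof (induction F rule: finite_induct)
    case (insert e F)
    have "F \<subseteq> V"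
      using insert E(2) by auto
    then have "nrm (u e *\<^sub>C e + (\<Sum>e\<in>F. u e *\<^sub>C e)) \<le> nrm (u e *\<^sub>C e) + nrm (\<Sum>e\<in>F. u e *\<^sub>C e)"
      using insert E(2) by (intro nrm_triangle sum_mem scale_mem) auto
    moreover have "nrm (u e *\<^sub>C e) = cmod (u e)"
      using insert E(2,5) by (subst nrm_scale) auto
    ultimately show ?case
      using insert by simp
  qed simp
  have "nrm (X i - l) \<le> (\<Sum>e\<in>E. cmod (h (X i) e - c e))" for i
  proof -
    have "X i - l = (\<Sum>e\<in>E. (h (X i) e - c e) *\<^sub>C e)"
      using E(3)[OF mem[of i]] by (simp add: l_def complex_vector.scale_left_diff_distrib sum_subtractf)
    then show ?thesis
      using nsum[of E "\<lambda>e. h (X i) e - c e"] by simp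
  qed
  moreover have "(\<lambda>i. \<Sum>e\<in>E. cmod (h (X i) e - c e)) \<longlonglongrightarrow> 0"
    by (intro tendsto_null_sum tendsto_norm_zero LIM_zero c)
  ultimately have "(\<lambda>i. nrm (X i - l)) \<longlonglongrightarrow> 0"
    using mem l by (intro Lim_null_comparison[of "\<lambda>i. nrm (X i - l)"]) auto
  then show "\<exists>l\<in>V. (\<lambda>i. nrm (X i - l)) \<longlonglongrightarrow> 0"
    using l by blast
qed (use subspace hermitian Re_self_pos in auto)

end

section \<open>Complete spaces: closest points and the Riesz representation\<close>

locale hilbert_carrier =
  fixes V :: "'v::complex_vector set" and h :: "'v form"
  assumes hilbert: "hilbert_on V h"
begin

sublocale prehilbert_carrier V h
  using hilbert by unfold_locales (auto simp: hilbert_on_def)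

text \<open>Convergence is spelled out because the type carries no topology; membership in the
  carrier is included because \<open>nrm\<close> is a norm only on \<open>V\<close>.\<close>

definition lim_to :: "(nat \<Rightarrow> 'v) \<Rightarrow> 'v \<Rightarrow> bool" where
  "lim_to X l \<longleftrightarrow> range X \<subseteq> V \<and> l \<in> V \<and> (\<lambda>i. nrm (X i - l)) \<longlonglongrightarrow> 0"

lemma Cauchy_lim_to:
  assumes "range X \<subseteq> V" and "\<And>e. e > 0 \<Longrightarrow> \<exists>M. \<forall>i\<ge>M. \<forall>j\<ge>M. nrm (X i - X j) < e"
  obtains l where "lim_to X l"
  using hilbert assms unfolding hilbert_on_def lim_to_def by meson

lemma lim_to_Cauchy:
  assumes "lim_to X l" "e > 0"
  shows "\<exists>M. \<forall>i\<ge>M. \<forall>j\<ge>M. nrm (X i - X j) < e"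
proof -
  have mem: "X i \<in> V" "l \<in> V" for i
    using assms by (auto simp: lim_to_def)
  have "\<forall>\<^sub>F i in sequentially. nrm (X i - l) < e / 2"
    using assms unfolding lim_to_def by (intro order_tendstoD[where y = 0]) auto
  then obtain M where M: "nrm (X i - l) < e / 2" if "i \<ge> M" for i
    unfolding eventually_sequentially by blast
  have "nrm (X i - X j) < e" if "i \<ge> M" "j \<ge> M" for i j
    using nrm_diff_triangle[OF mem(1) mem(2) mem(1), of i j] M[OF that(1)] M[OF that(2)]
      nrm_diff_commute[OF mem(1) mem(2), of j] by simp
  then show ?thesis by blast
qed

lemma lim_to_bounded_functional:
  assumes "lim_to X l" and f: "\<And>x y. x \<in> V \<Longrightarrow> y \<in> V \<Longrightarrow> cmod (f x - f y) \<le> C * nrm (x - y)"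
  shows "(\<lambda>i. f (X i)) \<longlonglongrightarrow> f l"
proof (rule LIM_zero_cancel, rule Lim_null_comparison)
  have mem: "X i \<in> V" "l \<in> V" for i
    using assms by (auto simp: lim_to_def)
  show "\<forall>\<^sub>F i in sequentially. cmod (f (X i) - f l) \<le> C * nrm (X i - l)"
    using mem f by simp
  show "(\<lambda>i. C * nrm (X i - l)) \<longlonglongrightarrow> 0"
    using assms(1) tendsto_mult_right_zero unfolding lim_to_def by blast
qed

lemma lim_to_nrm:
  assumes "lim_to X l"
  shows "(\<lambda>i. nrm (X i)) \<longlonglongrightarrow> nrm l"
proof (rule LIM_zero_cancel, rule Lim_null_comparison)
  have mem: "X i \<in> V" "l \<in> V" for i
    using assms by (auto simp: lim_to_def)
  show "\<forall>\<^sub>F i in sequentially. norm (nrm (X i) - nrm l) \<le> nrm (X i - l)"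
  proof (rule always_eventually, rule allI)
    fix i
    show "norm (nrm (X i) - nrm l) \<le> nrm (X i - l)"
      using nrm_triangle[of "X i - l" l] nrm_triangle[of "l - X i" "X i"] mem(1)[of i] mem(2)
        nrm_diff_commute[of "X i" l] by simp
  qed
  show "(\<lambda>i. nrm (X i - l)) \<longlonglongrightarrow> 0"
    using assms unfolding lim_to_def by blast
qed

lemma lim_to_diff_const: "lim_to X l \<Longrightarrow> v \<in> V \<Longrightarrow> lim_to (\<lambda>i. v - X i) (v - l)"
  unfolding lim_to_def
  using nrm_diff_commute[of "X _" l] by (auto simp: image_subset_iff)

lemma approx_lim_to:
  assumes "D \<subseteq> V" "v \<in> V" "\<And>e. e > 0 \<Longrightarrow> \<exists>d\<in>D. nrm (v - d) < e"
  obtains X where "lim_to X v" "range X \<subseteq> D"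
proof -
  have "\<exists>d\<in>D. nrm (v - d) < 1 / Suc i" for i
    using assms(3)[of "1 / Suc i"] by simp
  then obtain X where X: "\<And>i. X i \<in> D" "\<And>i. nrm (v - X i) < 1 / Suc i"
    by metis
  then have mem: "X i \<in> V" for i
    using assms(1) by auto
  have "(\<lambda>i. nrm (X i - v)) \<longlonglongrightarrow> 0"
  proof (rule Lim_null_comparison)
    show "\<forall>\<^sub>F i in sequentially. norm (nrm (X i - v)) \<le> 1 / Suc i"
      using X(2) nrm_diff_commute[OF mem assms(2)] mem assms(2) by (simp add: less_imp_le)
    show "(\<lambda>i. 1 / real (Suc i)) \<longlonglongrightarrow> 0"
      by (rule LIMSEQ_Suc[OF lim_1_over_n])
  qed
  then show ?thesis
    using that X(1) mem assms(2) by (auto simp: lim_to_def)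
qed

text \<open>Subtracting from \<open>z\<close> its projection on \<open>d\<close> lowers the squared
  norm by |h z d|^2 / h d d, so minimality forces this quotient to vanish.\<close>

lemma orthogonal_if_closest:
  assumes z: "z \<in> V" and d: "d \<in> V" and min: "\<And>c. nrm z \<le> nrm (z - c *\<^sub>C d)"
  shows "h d z = 0"
proof (cases "d = 0")
  case False
  define a where "a = Re (h d d)"
  have a: "a > 0" and hdd: "h d d = of_real a"
    using False d Re_self_pos self_eq_Re by (auto simp: a_def)
  define c where "c = h z d / a"
  have "(nrm z)\<^sup>2 \<le> (nrm (z - c *\<^sub>C d))\<^sup>2"
    using min[of c] z by (simp add: power_mono)
  also have "\<dots> = Re (h (z - c *\<^sub>C d) (z - c *\<^sub>C d))"
    using z d by (simp add: nrm_sq del: diff_left diff_right)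
  also have "h (z - c *\<^sub>C d) (z - c *\<^sub>C d) = h z z - (h z d * cnj (h z d)) / a"
    using z d a by (simp add: commute[of z d] hdd c_def field_simps)
  also have "Re \<dots> = (nrm z)\<^sup>2 - (cmod (h z d))\<^sup>2 / a"
    by (simp add: nrm_sq[OF z] complex_mult_cnj cmod_power2 del: Re_divide_of_real flip: of_real_power of_real_add of_real_divide)
  finally have "(cmod (h z d))\<^sup>2 / a \<le> 0"
    by simp
  then have "h z d = 0"
    using a by (simp add: divide_le_0_iff)
  then show ?thesis
    using commute[OF z d] by simp
qed (use z in auto)

lemma parallelogram:
  assumes "x \<in> V" "y \<in> V"
  shows "(nrm (x + y))\<^sup>2 + (nrm (x - y))\<^sup>2 = 2 * (nrm x)\<^sup>2 + 2 * (nrm y)\<^sup>2"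
  using assms by (simp add: nrm_sq)

text \<open>By the parallelogram law a minimising sequence is Cauchy. \<open>D\<close> is not
  assumed closed, so the closest point \<open>l\<close> is delivered as a limit of points of
  \<open>D\<close>.\<close>

lemma closest_point:
  assumes D: "csubspace D" "D \<subseteq> V" and v: "v \<in> V"
  obtains l X where "lim_to X l" "range X \<subseteq> D" "\<And>d. d \<in> D \<Longrightarrow> h d (v - l) = 0"
proof -
  define \<delta> where "\<delta> = Inf ((\<lambda>d. (nrm (v - d))\<^sup>2) ` D)"
  have 0: "0 \<in> D"
    by (rule complex_vector.subspace_0[OF D(1)])
  have bdd: "bdd_below ((\<lambda>d. (nrm (v - d))\<^sup>2) ` D)"
    by (rule bdd_belowI[of _ 0]) auto
  have low: "\<delta> \<le> (nrm (v - d))\<^sup>2" if "d \<in> D" for d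
    unfolding \<delta>_def using that bdd by (intro cInf_lower) auto
  have "\<exists>d\<in>D. (nrm (v - d))\<^sup>2 < \<delta> + 1 / Suc i" for i
    using cInf_lessD[of "(\<lambda>d. (nrm (v - d))\<^sup>2) ` D" "\<delta> + 1 / Suc i"] 0 by (auto simp: \<delta>_def)
  then obtain X where X: "\<And>i. X i \<in> D" "\<And>i. (nrm (v - X i))\<^sup>2 < \<delta> + 1 / Suc i"
    by metis
  have mem: "X i \<in> V" for i
    using X(1) D(2) by auto
  have est: "(nrm (X i - X j))\<^sup>2 \<le> 2 / Suc i + 2 / Suc j" for i j
  proof -
    define w where "w = (1/2) *\<^sub>C (X i + X j)"
    have w: "w \<in> D"
      unfolding w_def using X D by (intro complex_vector.subspace_scale complex_vector.subspace_add)
    have two: "(v - X i) + (v - X j) = 2 *\<^sub>C (v - w)"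
    proof -
      have "2 *\<^sub>C v = v + v"
        using scaleC_add_left[of 1 1 v] by (simp add: scaleC_one)
      then show ?thesis
        by (simp add: w_def complex_vector.scale_right_diff_distrib scaleC_scaleC scaleC_one)
    qed
    have "(nrm ((v - X i) + (v - X j)))\<^sup>2 = 4 * (nrm (v - w))\<^sup>2"
      unfolding two using v w D by (subst nrm_scale) (auto simp: power_mult_distrib)
    then have "(nrm ((v - X i) - (v - X j)))\<^sup>2 = 2 * (nrm (v - X i))\<^sup>2 + 2 * (nrm (v - X j))\<^sup>2 - 4 * (nrm (v - w))\<^sup>2"
      using parallelogram[of "v - X i" "v - X j"] v mem by simp
    also have "(v - X i) - (v - X j) = X j - X i"
      by simp
    finally show ?thesis
      using nrm_diff_commute[OF mem[of i] mem[of j]] X(2)[of i] X(2)[of j] low[OF w] by simp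
  qed
  obtain l where l: "lim_to X l"
  proof (rule Cauchy_lim_to)
    show "range X \<subseteq> V"
      using mem by auto
    fix e :: real assume e: "e > 0"
    \<comment> \<open>Beyond \<open>M\<close> the bound \<open>est\<close> is at most 4 / Suc M,
      whence the divisor 4.\<close>
    obtain M where M: "1 / Suc M < e\<^sup>2 / 4"
      using e by (meson nat_approx_posE zero_less_divide_iff zero_less_numeral zero_less_power)
    have "nrm (X i - X j) < e" if "i \<ge> M" "j \<ge> M" for i j
    proof -
      have "1 / Suc i \<le> 1 / Suc M" "1 / Suc j \<le> 1 / Suc M"
        using that by (auto simp: frac_le)
      then have "(nrm (X i - X j))\<^sup>2 < e\<^sup>2"
        using est[of i j] M by simp
      then show ?thesis
        using e by (intro power2_less_imp_less[of "nrm (X i - X j)"]) auto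
    qed
    then show "\<exists>M. \<forall>i\<ge>M. \<forall>j\<ge>M. nrm (X i - X j) < e"
      by blast
  qed
  have lV: "l \<in> V"
    using l by (simp add: lim_to_def)
  have "(\<lambda>i. (nrm (v - X i))\<^sup>2) \<longlonglongrightarrow> (nrm (v - l))\<^sup>2"
    using lim_to_nrm[OF lim_to_diff_const[OF l v]] by (rule tendsto_power)
  then have le: "(nrm (v - l))\<^sup>2 \<le> \<delta>"
  proof (rule LIMSEQ_le)
    show "(\<lambda>i. \<delta> + 1 / Suc i) \<longlonglongrightarrow> \<delta>"
      using tendsto_add[OF tendsto_const[of \<delta>] LIMSEQ_Suc[OF lim_1_over_n]] by simp
    show "\<exists>N. \<forall>n\<ge>N. (nrm (v - X n))\<^sup>2 \<le> \<delta> + 1 / Suc n"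
      using X(2) by (auto intro: less_imp_le)
  qed
  have "h d (v - l) = 0" if d: "d \<in> D" for d
  proof (rule orthogonal_if_closest)
    fix c
    have "nrm (v - l) \<le> nrm (v - (X i + c *\<^sub>C d))" for i
    proof (rule power2_le_imp_le)
      have "X i + c *\<^sub>C d \<in> D"
        using X(1) d D(1) by (intro complex_vector.subspace_add complex_vector.subspace_scale)
      then show "(nrm (v - l))\<^sup>2 \<le> (nrm (v - (X i + c *\<^sub>C d)))\<^sup>2"
        using le low by force
    qed (use mem v d D in auto)
    then have *: "nrm (v - l) \<le> nrm ((v - c *\<^sub>C d) - X i)" for i
      by (simp add: algebra_simps)
    have "lim_to (\<lambda>i. (v - c *\<^sub>C d) - X i) ((v - c *\<^sub>C d) - l)"
      using l v d D by (intro lim_to_diff_const) auto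
    then have "(\<lambda>i. nrm ((v - c *\<^sub>C d) - X i)) \<longlonglongrightarrow> nrm ((v - c *\<^sub>C d) - l)"
      by (rule lim_to_nrm)
    then have "nrm (v - l) \<le> nrm ((v - c *\<^sub>C d) - l)"
      by (rule LIMSEQ_le_const) (use * in auto)
    then show "nrm (v - l) \<le> nrm (v - l - c *\<^sub>C d)"
      by (simp add: algebra_simps)
  qed (use v lV d D in auto)
  then show thesis
    using that l X(1) by blast
qed

lemma dense_if_orthogonal_trivial:
  assumes D: "csubspace D" "D \<subseteq> V"
    and triv: "\<And>z. z \<in> V \<Longrightarrow> (\<And>d. d \<in> D \<Longrightarrow> h d z = 0) \<Longrightarrow> z = 0"
    and v: "v \<in> V"
  obtains X where "lim_to X v" "range X \<subseteq> D"
proof -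
  obtain l X where l: "lim_to X l" "range X \<subseteq> D" "\<And>d. d \<in> D \<Longrightarrow> h d (v - l) = 0"
    by (rule closest_point[OF D v]) blast
  then have "v - l = 0"
    using v by (intro triv) (auto simp: lim_to_def)
  then show thesis
    using that l by simp
qed

text \<open>Some nonzero vector is orthogonal to the kernel \<open>D\<close> of \<phi>: otherwise
  \<open>D\<close> would be dense and continuity would give \<phi> = 0. Every vector differs from a
  multiple of it by an element of \<open>D\<close>, which determines the representing
  vector.\<close>

lemma Riesz:
  assumes add: "\<And>x y. x \<in> V \<Longrightarrow> y \<in> V \<Longrightarrow> \<phi> (x + y) = \<phi> x + \<phi> y"
    and scale: "\<And>c x. x \<in> V \<Longrightarrow> \<phi> (c *\<^sub>C x) = c * \<phi> x"
    and bound: "\<And>x. x \<in> V \<Longrightarrow> cmod (\<phi> x) \<le> C * nrm x"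
  obtains y where "y \<in> V" "\<And>x. x \<in> V \<Longrightarrow> \<phi> x = h x y"
proof (cases "\<forall>x\<in>V. \<phi> x = 0")
  case True
  then show ?thesis
    using that[of 0] by simp
next
  case False
  have diff: "\<phi> (x - y) = \<phi> x - \<phi> y" if "x \<in> V" "y \<in> V" for x y
    using add[of "x - y" y] that by simp
  define D where "D = {x \<in> V. \<phi> x = 0}"
  have D: "csubspace D" "D \<subseteq> V"
    using add scale[of 0 0] scale by (auto simp: D_def complex_vector.subspace_def)
  obtain z where z: "z \<in> V" "z \<noteq> 0" "\<And>d. d \<in> D \<Longrightarrow> h d z = 0"
  proof (rule ccontr)
    assume "\<not> thesis"
    then have triv: "z = 0" if "z \<in> V" "\<And>d. d \<in> D \<Longrightarrow> h d z = 0" for z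
      using \<open>\<And>z. z \<in> V \<Longrightarrow> z \<noteq> 0 \<Longrightarrow> (\<And>d. d \<in> D \<Longrightarrow> h d z = 0) \<Longrightarrow> thesis\<close> that by blast
    have "\<phi> x = 0" if x: "x \<in> V" for x
    proof -
      obtain X where X: "lim_to X x" "range X \<subseteq> D"
        by (rule dense_if_orthogonal_trivial[OF D triv x])
      have "(\<lambda>i. \<phi> (X i)) \<longlonglongrightarrow> \<phi> x"
        using X(1) by (rule lim_to_bounded_functional[of _ _ _ C]) (metis diff bound diff_mem)
      moreover have "\<phi> (X i) = 0" for i
        using X(2) by (auto simp: D_def)
      ultimately show ?thesis
        by (simp add: LIMSEQ_const_iff)
    qed
    then show False
      using False by blast
  qed
  define a where "a = Re (h z z)"
  have a: "a > 0" and hzz: "h z z = of_real a"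
    using z Re_self_pos self_eq_Re by (auto simp: a_def)
  show ?thesis
  proof (rule that)
    show "cnj (\<phi> z / a) *\<^sub>C z \<in> V"
      using z by simp
    fix x assume x: "x \<in> V"
    have "\<phi> z \<noteq> 0"
      using z a hzz by (auto simp: D_def)
    then have "x - (\<phi> x / \<phi> z) *\<^sub>C z \<in> D"
      using x z by (simp add: D_def diff scale)
    then have "h (x - (\<phi> x / \<phi> z) *\<^sub>C z) z = 0"
      by (rule z(3))
    then have "h x z = \<phi> x / \<phi> z * a"
      using x z by (simp add: hzz)
    then show "\<phi> x = h x (cnj (\<phi> z / a) *\<^sub>C z)"
      using x z a \<open>\<phi> z \<noteq> 0\<close> by simp
  qed
qed

end

section \<open>Pontryagin spaces\<close>

text \<open>The last condition, a Garding inequality, expresses that the negative index is finite.\<close>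

locale pontryagin_carrier = H: hilbert_carrier V h
  for V :: "'v::complex_vector set" and ip :: "'v form" and h :: "'v form" +
  assumes ip_hermitian: "hermitian_form_on V ip"
    and ip_bounded: "x \<in> V \<Longrightarrow> y \<in> V \<Longrightarrow> cmod (ip x y) \<le> form_norm h x * form_norm h y"
    and h_via_ip: "y \<in> V \<Longrightarrow> \<exists>y'\<in>V. \<forall>x\<in>V. h x y = ip x y'"
    and garding: "\<exists>E. finite E \<and> E \<subseteq> V \<and>
      (\<forall>x\<in>V. (form_norm h x)\<^sup>2 \<le> Re (ip x x) + 2 * (\<Sum>e\<in>E. (cmod (ip x e))\<^sup>2))"
begin

sublocale hermitian_form V ip
  using H.subspace ip_hermitian by unfold_locales

abbreviation nrm :: "'v \<Rightarrow> real" where "nrm \<equiv> form_norm h"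

lemma nondegenerate:
  assumes "v \<in> V" "\<And>x. x \<in> V \<Longrightarrow> ip x v = 0"
  shows "v = 0"
proof -
  obtain v' where v': "v' \<in> V" "\<forall>x\<in>V. h x v = ip x v'"
    using h_via_ip assms(1) by blast
  then have "h v v = cnj (ip v' v)"
    using assms commute[of v' v] by simp
  then have "h v v = 0"
    using assms(2)[OF v'(1)] by simp
  then show ?thesis
    using assms(1) H.Re_self_pos[of v] by auto
qed

lemma lim_to_ip_left:
  assumes "H.lim_to X l" "v \<in> V"
  shows "(\<lambda>i. ip (X i) v) \<longlonglongrightarrow> ip l v"
proof (rule H.lim_to_bounded_functional[OF assms(1)])
  fix x y assume "x \<in> V" "y \<in> V"
  then show "cmod (ip x v - ip y v) \<le> nrm v * nrm (x - y)"
    using ip_bounded[of "x - y" v] assms(2) by (simp add: mult.commute)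
qed

text \<open>\<open>h_via_ip\<close> turns \<open>h\<close>-orthogonality to \<open>z\<close> into
  \<open>ip\<close>-orthogonality to some \<open>z'\<close>, so the density criterion of the Hilbert
  space carries over to the indefinite form.\<close>

lemma dense_if_total:
  assumes D: "csubspace D" "D \<subseteq> V"
    and triv: "\<And>z. z \<in> V \<Longrightarrow> (\<And>d. d \<in> D \<Longrightarrow> ip d z = 0) \<Longrightarrow> z = 0"
    and v: "v \<in> V"
  obtains X where "H.lim_to X v" "range X \<subseteq> D"
proof (rule H.dense_if_orthogonal_trivial[OF D _ v])
  fix z assume z: "z \<in> V" "\<And>d. d \<in> D \<Longrightarrow> h d z = 0"
  obtain z' where z': "z' \<in> V" "\<forall>x\<in>V. h x z = ip x z'"
    using h_via_ip z(1) by blast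
  then have "z' = 0"
    using triv z D(2) by (metis subsetD)
  then have "h z z = 0"
    using z' z(1) by simp
  then show "z = 0"
    using z(1) H.Re_self_pos[of z] by auto
qed (rule that)

lemma total_if_dense:
  assumes "D \<subseteq> V" "\<And>v e. v \<in> V \<Longrightarrow> e > 0 \<Longrightarrow> \<exists>d\<in>D. nrm (v - d) < e"
    and "z \<in> V" "\<And>d. d \<in> D \<Longrightarrow> ip d z = 0"
  shows "z = 0"
proof (rule nondegenerate[OF assms(3)])
  fix x assume x: "x \<in> V"
  obtain X where X: "H.lim_to X x" "range X \<subseteq> D"
    by (rule H.approx_lim_to[OF assms(1) x assms(2)[OF x]])
  have "(\<lambda>i. ip (X i) z) \<longlonglongrightarrow> ip x z"
    by (rule lim_to_ip_left[OF X(1) assms(3)])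
  moreover have "ip (X i) z = 0" for i
    using X(2) assms(4) by auto
  ultimately show "ip x z = 0"
    by (simp add: LIMSEQ_const_iff)
qed

text \<open>The test vectors of the Garding inequality are moved into a given dense set at the price
  of larger constants: each is replaced by a nearby vector, and the error is absorbed by the
  left-hand side. An isometry defined on a dense set controls only pairings with such
  vectors.\<close>

lemma garding_dense:
  assumes D: "D \<subseteq> V" and dense: "\<And>v e. v \<in> V \<Longrightarrow> e > 0 \<Longrightarrow> \<exists>d\<in>D. nrm (v - d) < e"
  obtains F and K :: real where "finite F" "F \<subseteq> D"
    "\<And>x. x \<in> V \<Longrightarrow> (nrm x)\<^sup>2 \<le> 2 * Re (ip x x) + (\<Sum>d\<in>F. (cmod (ip x d))\<^sup>2) * K"
    "K \<ge> 0"
proof -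
  obtain E where E: "finite E" "E \<subseteq> V"
    and gard: "\<And>x. x \<in> V \<Longrightarrow> (nrm x)\<^sup>2 \<le> Re (ip x x) + 2 * (\<Sum>e\<in>E. (cmod (ip x e))\<^sup>2)"
    using garding by blast
  define k where "k = real (card E)"
  \<comment> \<open>Chosen so that 4 * k * \<epsilon>^2 is at most 1 / 2, which lets half of the
    squared norm absorb the error; \<open>k + 1\<close> keeps \<epsilon> positive for empty
    \<open>E\<close>.\<close>
  define \<epsilon> where "\<epsilon> = sqrt (1 / (8 * (k + 1)))"
  have k: "k \<ge> 0"
    by (simp add: k_def)
  have \<epsilon>: "\<epsilon> > 0" "\<epsilon>\<^sup>2 = 1 / (8 * (k + 1))"
    using k by (simp_all add: \<epsilon>_def)
  have "\<forall>e\<in>E. \<exists>d\<in>D. nrm (e - d) < \<epsilon>"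
    using dense E(2) \<epsilon>(1) by blast
  then obtain d where d: "\<And>e. e \<in> E \<Longrightarrow> d e \<in> D" "\<And>e. e \<in> E \<Longrightarrow> nrm (e - d e) < \<epsilon>"
    by metis
  have est: "(nrm x)\<^sup>2 \<le> 2 * Re (ip x x) + (\<Sum>d\<in>d ` E. (cmod (ip x d))\<^sup>2) * (8 * k)" if x: "x \<in> V" for x
  proof -
    define S where "S = (\<Sum>d\<in>d ` E. (cmod (ip x d))\<^sup>2)"
    have "(\<Sum>e\<in>E. (cmod (ip x e))\<^sup>2) \<le> (\<Sum>e\<in>E. 2 * S + 2 * \<epsilon>\<^sup>2 * (nrm x)\<^sup>2)"
    proof (rule sum_mono)
      fix e assume e: "e \<in> E"
      have mem: "e \<in> V" "d e \<in> V"
        using e d(1) E(2) D by auto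
      have "cmod (ip x (e - d e)) \<le> \<epsilon> * nrm x"
        using ip_bounded[of x "e - d e"] d(2)[OF e] mem x
        by (smt (verit) H.nrm_nonneg diff_mem mult.commute mult_right_mono)
      then have "cmod (ip x e) \<le> cmod (ip x (d e)) + \<epsilon> * nrm x"
        using mem x norm_triangle_ineq[of "ip x (d e)" "ip x (e - d e)"] by simp
      then have "(cmod (ip x e))\<^sup>2 \<le> (cmod (ip x (d e)) + \<epsilon> * nrm x)\<^sup>2"
        by (simp add: power_mono)
      also have "\<dots> \<le> 2 * (cmod (ip x (d e)))\<^sup>2 + 2 * (\<epsilon> * nrm x)\<^sup>2"
        using zero_le_power2[of "cmod (ip x (d e)) - \<epsilon> * nrm x"] by (simp add: power2_sum power2_diff)
      also have "(cmod (ip x (d e)))\<^sup>2 \<le> S"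
        unfolding S_def using E(1) e by (intro member_le_sum) auto
      finally show "(cmod (ip x e))\<^sup>2 \<le> 2 * S + 2 * \<epsilon>\<^sup>2 * (nrm x)\<^sup>2"
        by (simp add: power_mult_distrib)
    qed
    also have "\<dots> = 2 * k * S + 2 * k * \<epsilon>\<^sup>2 * (nrm x)\<^sup>2"
      by (simp add: k_def algebra_simps)
    finally have "(nrm x)\<^sup>2 \<le> Re (ip x x) + 4 * k * S + (4 * k * \<epsilon>\<^sup>2) * (nrm x)\<^sup>2"
      using gard[OF x] by simp
    moreover have "4 * k * \<epsilon>\<^sup>2 \<le> 1 / 2"
      using k by (simp add: \<epsilon>(2) field_simps)
    then have "(4 * k * \<epsilon>\<^sup>2) * (nrm x)\<^sup>2 \<le> 1 / 2 * (nrm x)\<^sup>2"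
      by (rule mult_right_mono) simp
    ultimately show ?thesis
      by (simp add: S_def algebra_simps)
  qed
  show thesis
  proof (rule that[of "d ` E" "8 * k"])
    show "finite (d ` E)" "d ` E \<subseteq> D" "0 \<le> 8 * k"
      using E(1) d(1) k by auto
  qed (rule est)
qed

end

subsection \<open>The majorant of a Pontryagin space\<close>

lemma hermitian_form_on_subset: "hermitian_form_on V ip \<Longrightarrow> W \<subseteq> V \<Longrightarrow> hermitian_form_on W ip"
  unfolding hermitian_form_on_def by blast

lemma hermitian_form_on_uminus: "hermitian_form_on V ip \<Longrightarrow> hermitian_form_on V (\<lambda>x y. - ip x y)"
  unfolding hermitian_form_on_def
  by (metis complex_cnj_minus minus_add_distrib mult_minus_right)

locale fundamental = hermitian_form V ip
  for V :: "'v::complex_vector set" and ip :: "'v form" +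
  fixes P N
  assumes decomp: "fundamental_decomposition V ip P N"
begin

lemma V_eq: "V = {p + n |p n. p \<in> P \<and> n \<in> N}"
  and orth: "p \<in> P \<Longrightarrow> n \<in> N \<Longrightarrow> ip p n = 0"
  and P: "hilbert_on P ip"
  and N: "csubspace N"
  and neg: "n \<in> N \<Longrightarrow> n \<noteq> 0 \<Longrightarrow> Re (ip n n) < 0"
  and N_finite: "\<exists>B. finite B \<and> N = cspan B"
  using decomp unfolding fundamental_decomposition_def by blast+

sublocale P: hilbert_carrier P ip
  using P by unfold_locales

lemma P_subset: "P \<subseteq> V"
  unfolding V_eq using complex_vector.subspace_0[OF N] by force

lemma N_subset: "N \<subseteq> V"
  unfolding V_eq using P.zero_mem by force

sublocale N: prehilbert_carrier N "\<lambda>x y. - ip x y"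
  using N neg hermitian_form_on_uminus[OF hermitian_form_on_subset[OF hermitian N_subset]]
  by unfold_locales auto

lemma NH: "hilbert_carrier N (\<lambda>x y. - ip x y)"
  using N_finite N.complete_if_finite_span unfolding hilbert_carrier_def by blast

sublocale N: hilbert_carrier N "\<lambda>x y. - ip x y"
  by (rule NH)

text \<open>\<open>pos\<close> and \<open>maj\<close> copy the local definitions of
  \<open>majorant\<close> for a fixed decomposition, so that \<open>majorant\<close> unfolds to
  \<open>maj\<close> once the decomposition is chosen.\<close>

definition pos :: "'v \<Rightarrow> 'v" where "pos x = (THE p. p \<in> P \<and> x - p \<in> N)"
definition maj :: "'v form" where "maj x y = ip (pos x) (pos y) - ip (x - pos x) (y - pos y)"

lemma orth': "n \<in> N \<Longrightarrow> p \<in> P \<Longrightarrow> ip n p = 0"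
  using orth[of p n] commute[of p n] P_subset N_subset by auto

text \<open>The difference of two candidates lies in both \<open>P\<close> and \<open>N\<close>,
  hence is orthogonal to itself and vanishes by definiteness.\<close>

lemma pos_unique:
  assumes "p \<in> P" "x - p \<in> N"
  shows "pos x = p"
  unfolding pos_def
proof (rule the_equality)
  fix q assume q: "q \<in> P \<and> x - q \<in> N"
  have "(x - p) - (x - q) \<in> N"
    using q assms by (blast intro: N.diff_mem)
  then have "q - p \<in> N"
    by simp
  moreover have "q - p \<in> P"
    using q assms by simp
  ultimately have "ip (q - p) (q - p) = 0"
    by (intro orth)
  then have "q - p = 0"
    using P.Re_self_pos[of "q - p"] \<open>q - p \<in> P\<close> by auto
  then show "q = p"
    by simp
qed (use assms in auto)

lemma pos_mem:
  assumes "x \<in> V"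
  shows "pos x \<in> P" "x - pos x \<in> N" "pos x \<in> V"
proof -
  obtain p n where "p \<in> P" "n \<in> N" "x = p + n"
    using assms unfolding V_eq by blast
  then have "pos x = p" "x - p \<in> N" "p \<in> P"
    using pos_unique[of p x] by auto
  then show "pos x \<in> P" "x - pos x \<in> N" "pos x \<in> V"
    using P_subset by auto
qed

lemma pos_add: "x \<in> V \<Longrightarrow> y \<in> V \<Longrightarrow> pos (x + y) = pos x + pos y"
  by (rule pos_unique)
    (use pos_mem[of x] pos_mem[of y] N.add_mem[of "x - pos x" "y - pos y"] in
      \<open>auto simp: algebra_simps\<close>)

lemma pos_scale: "x \<in> V \<Longrightarrow> pos (c *\<^sub>C x) = c *\<^sub>C pos x"
  by (rule pos_unique)
    (use pos_mem[of x] N.scale_mem[of "x - pos x" c] in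
      \<open>auto simp: complex_vector.scale_right_diff_distrib\<close>)

lemma pos_diff: "x \<in> V \<Longrightarrow> y \<in> V \<Longrightarrow> pos (x - y) = pos x - pos y"
  by (rule pos_unique)
    (use pos_mem[of x] pos_mem[of y] N.diff_mem[of "x - pos x" "y - pos y"] in
      \<open>auto simp: algebra_simps\<close>)

lemma ip_split: "x \<in> V \<Longrightarrow> y \<in> V \<Longrightarrow> ip x y = ip (pos x) (pos y) + ip (x - pos x) (y - pos y)"
proof -
  assume x: "x \<in> V" and y: "y \<in> V"
  have "ip (pos x + (x - pos x)) (pos y + (y - pos y)) = ip (pos x) (pos y) + ip (x - pos x) (y - pos y)"
    using pos_mem[OF x] pos_mem[OF y] subsetD[OF N_subset]
      orth[OF pos_mem(1)[OF x] pos_mem(2)[OF y]] orth'[OF pos_mem(2)[OF x] pos_mem(1)[OF y]]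
    by (simp only: add_left add_right add_mem add_0_left add_0_right)
  then show ?thesis
    by simp
qed

lemma maj_hermitian: "hermitian_form_on V maj"
  unfolding hermitian_form_on_def
proof (intro conjI ballI allI)
  fix x y z assume m: "x \<in> V" "y \<in> V" "z \<in> V"
  show "maj (x + y) z = maj x z + maj y z"
    using m pos_mem by (simp add: maj_def pos_add algebra_simps)
next
  fix c x y assume m: "x \<in> V" "y \<in> V"
  have "c *\<^sub>C x - c *\<^sub>C pos x = c *\<^sub>C (x - pos x)"
    by (simp add: complex_vector.scale_right_diff_distrib)
  then show "maj (c *\<^sub>C x) y = c * maj x y"
    using m pos_mem by (simp add: maj_def pos_scale algebra_simps)
next
  fix x y assume m: "x \<in> V" "y \<in> V"
  have 1: "ip (pos y) (pos x) = cnj (ip (pos x) (pos y))"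
    using m pos_mem by (intro commute) auto
  have 2: "ip (y - pos y) (x - pos x) = cnj (ip (x - pos x) (y - pos y))"
    using m pos_mem by (intro commute) auto
  show "maj y x = cnj (maj x y)"
    unfolding maj_def 1 2 by simp
qed

lemma maj_self: "x \<in> V \<Longrightarrow> Re (maj x x) = (P.nrm (pos x))\<^sup>2 + (N.nrm (x - pos x))\<^sup>2"
  unfolding P.nrm_sq[OF pos_mem(1)] N.nrm_sq[OF pos_mem(2)] by (simp add: maj_def)

sublocale maj: prehilbert_carrier V maj
proof unfold_locales
  fix x assume x: "x \<in> V" "x \<noteq> 0"
  have "pos x \<noteq> 0 \<or> x - pos x \<noteq> 0"
    using x by auto
  then show "0 < Re (maj x x)"
    using pos_mem[OF x(1)] P.nrm_eq_0_iff[of "pos x"] N.nrm_eq_0_iff[of "x - pos x"]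
    unfolding maj_self[OF x(1)] by (auto simp: sum_power2_gt_zero_iff)
qed (use subspace maj_hermitian in auto)

lemma maj_sq: "x \<in> V \<Longrightarrow> (maj.nrm x)\<^sup>2 = (P.nrm (pos x))\<^sup>2 + (N.nrm (x - pos x))\<^sup>2"
  using maj.nrm_sq maj_self by simp

lemma pos_le: "x \<in> V \<Longrightarrow> P.nrm (pos x) \<le> maj.nrm x"
  and neg_le: "x \<in> V \<Longrightarrow> N.nrm (x - pos x) \<le> maj.nrm x"
  by (rule power2_le_imp_le; simp add: maj_sq)+

lemma maj_le: "x \<in> V \<Longrightarrow> maj.nrm x \<le> P.nrm (pos x) + N.nrm (x - pos x)"
  by (rule power2_le_imp_le) (use pos_mem in \<open>auto simp: maj_sq power2_sum\<close>)

lemma maj_hilbert: "hilbert_on V maj"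
  unfolding hilbert_on_def
proof (intro conjI allI impI)
  fix X :: "nat \<Rightarrow> 'v"
  assume X: "range X \<subseteq> V \<and> (\<forall>e>0. \<exists>M. \<forall>i\<ge>M. \<forall>j\<ge>M. maj.nrm (X i - X j) < e)"
  then have mem: "X i \<in> V" for i by auto
  have C: "\<exists>M. \<forall>i\<ge>M. \<forall>j\<ge>M. maj.nrm (X i - X j) < e" if "e > 0" for e
    using X that by blast
  obtain p where p: "P.lim_to (\<lambda>i. pos (X i)) p"
  proof (rule P.Cauchy_lim_to)
    fix e :: real assume "e > 0"
    then obtain M where M: "\<forall>i\<ge>M. \<forall>j\<ge>M. maj.nrm (X i - X j) < e"
      using C by blast
    have "P.nrm (pos (X i) - pos (X j)) \<le> maj.nrm (X i - X j)" for i j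
      using pos_le[of "X i - X j"] mem by (simp add: pos_diff)
    then show "\<exists>M. \<forall>i\<ge>M. \<forall>j\<ge>M. P.nrm (pos (X i) - pos (X j)) < e"
      using M le_less_trans by blast
  qed (use pos_mem mem in auto)
  obtain n where n: "N.lim_to (\<lambda>i. X i - pos (X i)) n"
  proof (rule N.Cauchy_lim_to)
    fix e :: real assume "e > 0"
    then obtain M where M: "\<forall>i\<ge>M. \<forall>j\<ge>M. maj.nrm (X i - X j) < e"
      using C by blast
    have "N.nrm ((X i - pos (X i)) - (X j - pos (X j))) \<le> maj.nrm (X i - X j)" for i j
      using neg_le[of "X i - X j"] mem by (simp add: pos_diff algebra_simps)
    then show "\<exists>M. \<forall>i\<ge>M. \<forall>j\<ge>M. N.nrm ((X i - pos (X i)) - (X j - pos (X j))) < e"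
      using M le_less_trans by blast
  qed (use pos_mem mem in auto)
  have pn: "p \<in> P" "n \<in> N"
    using p n by (auto simp: P.lim_to_def N.lim_to_def)
  have l: "p + n \<in> V"
    using subsetD[OF P_subset pn(1)] subsetD[OF N_subset pn(2)] by simp
  have pl: "pos (p + n) = p"
    using pn by (intro pos_unique) auto
  have "(\<lambda>i. maj.nrm (X i - (p + n))) \<longlonglongrightarrow> 0"
  proof (rule Lim_null_comparison[of _ "\<lambda>i. P.nrm (pos (X i) - p) + N.nrm (X i - pos (X i) - n)"])
    have "maj.nrm (X i - (p + n)) \<le> P.nrm (pos (X i) - p) + N.nrm (X i - pos (X i) - n)" for i
    proof -
      have "pos (X i - (p + n)) = pos (X i) - p"
        using mem l by (simp only: pos_diff pl)
      moreover from this have "X i - (p + n) - pos (X i - (p + n)) = X i - pos (X i) - n"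
        by simp
      ultimately show ?thesis
        using maj_le[of "X i - (p + n)"] mem l by (simp only: diff_mem)
    qed
    then show "\<forall>\<^sub>F i in sequentially. norm (maj.nrm (X i - (p + n))) \<le>
        P.nrm (pos (X i) - p) + N.nrm (X i - pos (X i) - n)"
      using mem l by simp
    show "(\<lambda>i. P.nrm (pos (X i) - p) + N.nrm (X i - pos (X i) - n)) \<longlonglongrightarrow> 0"
      using tendsto_add[of "\<lambda>i. P.nrm (pos (X i) - p)" 0 _ "\<lambda>i. N.nrm (X i - pos (X i) - n)" 0] p n
      by (simp add: P.lim_to_def N.lim_to_def)
  qed
  then show "\<exists>l\<in>V. (\<lambda>i. maj.nrm (X i - l)) \<longlonglongrightarrow> 0"
    using l by blast
qed (use subspace maj_hermitian maj.Re_self_pos in auto)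

text \<open>The vector \<open>y'\<close> is the image of \<open>y\<close> under the fundamental
  symmetry, which reverses the sign of the negative part. It exchanges the two forms and is
  isometric for \<open>maj\<close>, so Cauchy-Schwarz for \<open>maj\<close> bounds
  \<open>ip\<close> with constant 1.\<close>

lemma maj_via_ip:
  assumes y: "y \<in> V"
  obtains y' where "y' \<in> V" "\<And>x. x \<in> V \<Longrightarrow> maj x y = ip x y'" "\<And>x. x \<in> V \<Longrightarrow> ip x y = maj x y'"
    "maj.nrm y' = maj.nrm y"
proof
  let ?y = "pos y - (y - pos y)"
  have py: "pos y \<in> P" "y - pos y \<in> N" "pos y \<in> V" "y - pos y \<in> V"
    using pos_mem[OF y] N_subset by auto
  have ps: "pos ?y = pos y"
    using py N.minus_mem[OF py(2)] by (intro pos_unique) auto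
  have mi: "?y - pos ?y = - (y - pos y)"
    by (simp add: ps)
  show m: "?y \<in> V"
    using py by simp
  show "maj x y = ip x ?y" if "x \<in> V" for x
    using ip_split[OF that m] pos_mem[OF that] y that minus_right[OF py(4), of "x - pos x"]
    unfolding mi by (simp only: maj_def ps diff_mem minus_right add_uminus_conv_diff)
  show ipm: "ip x y = maj x ?y" if "x \<in> V" for x
    using ip_split[OF that y] pos_mem[OF that] y that minus_right[OF py(4), of "x - pos x"]
    unfolding maj_def mi by (simp only: ps diff_mem minus_right diff_minus_eq_add)
  have "maj ?y ?y = maj y y"
    unfolding maj_def mi ps using minus_left[OF py(4) minus_mem[OF py(4)]] minus_right[OF py(4) py(4)]
    by simp
  then show "maj.nrm ?y = maj.nrm y"
    by (simp add: form_norm_def)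
qed

text \<open>The Garding vectors are an orthonormal basis of the negative part. By Parseval the sum
  over them is minus the form on that part, and passing from \<open>ip\<close> to \<open>maj\<close>
  adds this quantity twice; so the inequality holds with factor 2, and even as an equality.\<close>

lemma pontryagin_carrier: "pontryagin_carrier V ip maj"
proof -
  interpret M: hilbert_carrier V maj
    using maj_hilbert by unfold_locales
  show ?thesis
  proof unfold_locales
    show "hermitian_form_on V ip"
      by (rule hermitian)
    show "cmod (ip x y) \<le> form_norm maj x * form_norm maj y" if x: "x \<in> V" and y: "y \<in> V" for x y
    proof -
      obtain y' where y': "y' \<in> V" "\<And>x. x \<in> V \<Longrightarrow> ip x y = maj x y'" "maj.nrm y' = maj.nrm y"
        using maj_via_ip[OF y] by metis
      then show ?thesis
        using maj.Cauchy_Schwarz[OF x y'(1)] y'(2)[OF x] by simp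
    qed
    show "\<exists>y'\<in>V. \<forall>x\<in>V. maj x y = ip x y'" if "y \<in> V" for y
      using maj_via_ip[OF that] by metis
    obtain B where B: "finite B" "N = cspan B"
      using N_finite by blast
    obtain E where E: "finite E" "E \<subseteq> N"
      "\<And>x. x \<in> N \<Longrightarrow> Re (- ip x x) = (\<Sum>e\<in>E. (cmod (- ip x e))\<^sup>2)"
      by (rule N.finite_span_orthonormal_basis[OF B]) blast
    have "(form_norm maj x)\<^sup>2 \<le> Re (ip x x) + 2 * (\<Sum>e\<in>E. (cmod (ip x e))\<^sup>2)" if x: "x \<in> V" for x
    proof -
      have "ip x e = ip (x - pos x) e" if e: "e \<in> E" for e
        using orth[OF pos_mem(1)[OF x], of e] subsetD[OF E(2) e] subsetD[OF N_subset, of e]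
          pos_mem[OF x] x by simp
      then have "(\<Sum>e\<in>E. (cmod (ip x e))\<^sup>2) = - Re (ip (x - pos x) (x - pos x))"
        using E(3)[OF pos_mem(2)[OF x]] by simp
      moreover have "(form_norm maj x)\<^sup>2 = Re (ip x x) - 2 * Re (ip (x - pos x) (x - pos x))"
        unfolding maj.nrm_sq[OF x] maj_def ip_split[OF x x] by simp
      ultimately show ?thesis
        by simp
    qed
    then show "\<exists>E. finite E \<and> E \<subseteq> V \<and>
        (\<forall>x\<in>V. (form_norm maj x)\<^sup>2 \<le> Re (ip x x) + 2 * (\<Sum>e\<in>E. (cmod (ip x e))\<^sup>2))"
      using E(1,2) N_subset by (intro exI[of _ E]) auto
  qed
qed

end

lemma pontryagin_carrier_majorant:
  assumes "pontryagin_space V ip"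
  shows "pontryagin_carrier V ip (majorant V ip)"
proof -
  define PN where "PN = (SOME (P, N). fundamental_decomposition V ip P N)"
  have "\<exists>PN. (case PN of (P, N) \<Rightarrow> fundamental_decomposition V ip P N)"
    using assms by (auto simp: pontryagin_space_def)
  then have "case PN of (P, N) \<Rightarrow> fundamental_decomposition V ip P N"
    unfolding PN_def by (rule someI_ex)
  then obtain P N where PN: "PN = (P, N)" "fundamental_decomposition V ip P N"
    by (cases PN) auto
  interpret fundamental V ip P N
    using assms PN(2) by unfold_locales (auto simp: pontryagin_space_def)
  have "majorant V ip = maj"
    unfolding majorant_def PN_def[symmetric] PN(1)
    by (simp add: Let_def maj_def pos_def fun_eq_iff)
  then show ?thesis
    using pontryagin_carrier by simp
qed

subsection \<open>Orthogonal sums\<close>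

definition sum_form :: "'v form \<Rightarrow> 'w form \<Rightarrow> ('v \<times> 'w) form" where
  "sum_form ip ip' x y = ip (fst x) (fst y) + ip' (snd x) (snd y)"

lemma hermitian_form_on_sum:
  assumes "hermitian_form_on V ip" "hermitian_form_on W ip'"
  shows "hermitian_form_on (V \<times> W) (sum_form ip ip')"
proof -
  have 1: "ip (x + y) z = ip x z + ip y z" "ip (c *\<^sub>C x) y = c * ip x y" "ip y x = cnj (ip x y)"
    if "x \<in> V" "y \<in> V" "z \<in> V" for x y z c
    using assms(1) that unfolding hermitian_form_on_def by blast+
  have 2: "ip' (x + y) z = ip' x z + ip' y z" "ip' (c *\<^sub>C x) y = c * ip' x y" "ip' y x = cnj (ip' x y)"
    if "x \<in> W" "y \<in> W" "z \<in> W" for x y z c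
    using assms(2) that unfolding hermitian_form_on_def by blast+
  show ?thesis
    unfolding hermitian_form_on_def sum_form_def
  proof (intro conjI ballI allI)
    fix x y assume "x \<in> V \<times> W" "y \<in> V \<times> W"
    then show "ip (fst y) (fst x) + ip' (snd y) (snd x) = cnj (ip (fst x) (fst y) + ip' (snd x) (snd y))"
      using 1(3)[of "fst x" "fst y" "fst x"] 2(3)[of "snd x" "snd y" "snd x"] by auto
  qed (auto simp: scaleC_prod_def 1(1,2) 2(1,2) algebra_simps)
qed

lemma csubspace_Times: "csubspace V \<Longrightarrow> csubspace W \<Longrightarrow> csubspace (V \<times> W)"
  unfolding complex_vector.subspace_def by (auto simp: scaleC_prod_def zero_prod_def)

lemma prehilbert_carrier_sum:
  assumes "prehilbert_carrier V h" "prehilbert_carrier W h'"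
  shows "prehilbert_carrier (V \<times> W) (sum_form h h')"
proof -
  interpret A: prehilbert_carrier V h by fact
  interpret B: prehilbert_carrier W h' by fact
  show ?thesis
  proof unfold_locales
    fix x assume x: "x \<in> V \<times> W" "x \<noteq> 0"
    have "0 \<le> Re (h (fst x) (fst x))" "0 \<le> Re (h' (snd x) (snd x))"
      using x by (auto intro: A.Re_self_nonneg B.Re_self_nonneg)
    moreover have "0 < Re (h (fst x) (fst x)) \<or> 0 < Re (h' (snd x) (snd x))"
      using x A.Re_self_pos[of "fst x"] B.Re_self_pos[of "snd x"] by (auto simp: prod_eq_iff)
    ultimately show "0 < Re (sum_form h h' x x)"
      unfolding sum_form_def by auto
  qed (use A.subspace B.subspace A.hermitian B.hermitian in
      \<open>auto intro: csubspace_Times hermitian_form_on_sum\<close>)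
qed

lemma pontryagin_carrier_sum:
  assumes "pontryagin_carrier V ip h" "pontryagin_carrier W ip' h'"
  shows "pontryagin_carrier (V \<times> W) (sum_form ip ip') (sum_form h h')"
proof -
  interpret A: pontryagin_carrier V ip h by fact
  interpret B: pontryagin_carrier W ip' h' by fact
  interpret S: prehilbert_carrier "V \<times> W" "sum_form h h'"
    by (rule prehilbert_carrier_sum) (rule A.H.prehilbert_carrier_axioms B.H.prehilbert_carrier_axioms)+
  have sq: "(S.nrm x)\<^sup>2 = (A.nrm (fst x))\<^sup>2 + (B.nrm (snd x))\<^sup>2" if "x \<in> V \<times> W" for x
    using that by (auto simp: S.nrm_sq A.H.nrm_sq B.H.nrm_sq sum_form_def)
  have le: "A.nrm (fst x) \<le> S.nrm x" "B.nrm (snd x) \<le> S.nrm x" if "x \<in> V \<times> W" for x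
    by (rule power2_le_imp_le; use sq[OF that] that in auto)+
  have ge: "S.nrm x \<le> A.nrm (fst x) + B.nrm (snd x)" if "x \<in> V \<times> W" for x
    by (rule power2_le_imp_le) (use sq[OF that] that in \<open>auto simp: power2_sum\<close>)
  have "hilbert_on (V \<times> W) (sum_form h h')"
    unfolding hilbert_on_def
  proof (intro conjI allI impI)
    fix X :: "nat \<Rightarrow> 'a \<times> 'b"
    assume X: "range X \<subseteq> V \<times> W \<and> (\<forall>e>0. \<exists>M. \<forall>i\<ge>M. \<forall>j\<ge>M. S.nrm (X i - X j) < e)"
    then have mem: "X i \<in> V \<times> W" for i by auto
    then have mem': "fst (X i) \<in> V" "snd (X i) \<in> W" for i
      by (auto simp: mem_Times_iff)
    have C: "\<exists>M. \<forall>i\<ge>M. \<forall>j\<ge>M. S.nrm (X i - X j) < e" if "e > 0" for e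
      using X that by blast
    obtain p where p: "A.H.lim_to (\<lambda>i. fst (X i)) p"
    proof (rule A.H.Cauchy_lim_to)
      fix e :: real assume "e > 0"
      then obtain M where M: "\<forall>i\<ge>M. \<forall>j\<ge>M. S.nrm (X i - X j) < e"
        using C by blast
      have "A.nrm (fst (X i) - fst (X j)) \<le> S.nrm (X i - X j)" for i j
        using le(1)[of "X i - X j"] mem S.diff_mem by simp
      then show "\<exists>M. \<forall>i\<ge>M. \<forall>j\<ge>M. A.nrm (fst (X i) - fst (X j)) < e"
        using M le_less_trans by blast
    qed (use mem' in auto)
    obtain n where n: "B.H.lim_to (\<lambda>i. snd (X i)) n"
    proof (rule B.H.Cauchy_lim_to)
      fix e :: real assume "e > 0"
      then obtain M where M: "\<forall>i\<ge>M. \<forall>j\<ge>M. S.nrm (X i - X j) < e"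
        using C by blast
      have "B.nrm (snd (X i) - snd (X j)) \<le> S.nrm (X i - X j)" for i j
        using le(2)[of "X i - X j"] mem S.diff_mem by simp
      then show "\<exists>M. \<forall>i\<ge>M. \<forall>j\<ge>M. B.nrm (snd (X i) - snd (X j)) < e"
        using M le_less_trans by blast
    qed (use mem' in auto)
    have l: "(p, n) \<in> V \<times> W"
      using p n by (auto simp: A.H.lim_to_def B.H.lim_to_def)
    have "(\<lambda>i. S.nrm (X i - (p, n))) \<longlonglongrightarrow> 0"
    proof (rule Lim_null_comparison[of _ "\<lambda>i. A.nrm (fst (X i) - p) + B.nrm (snd (X i) - n)"])
      have "S.nrm (X i - (p, n)) \<le> A.nrm (fst (X i) - p) + B.nrm (snd (X i) - n)" for i
        using ge[OF S.diff_mem[OF mem l], of i] by simp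
      then show "\<forall>\<^sub>F i in sequentially. norm (S.nrm (X i - (p, n))) \<le>
          A.nrm (fst (X i) - p) + B.nrm (snd (X i) - n)"
        using S.nrm_nonneg[OF S.diff_mem[OF mem l]] by simp
      show "(\<lambda>i. A.nrm (fst (X i) - p) + B.nrm (snd (X i) - n)) \<longlonglongrightarrow> 0"
        using tendsto_add[of "\<lambda>i. A.nrm (fst (X i) - p)" 0 _ "\<lambda>i. B.nrm (snd (X i) - n)" 0] p n
        by (simp add: A.H.lim_to_def B.H.lim_to_def)
    qed
    then show "\<exists>l\<in>V \<times> W. (\<lambda>i. S.nrm (X i - l)) \<longlonglongrightarrow> 0"
      using l by blast
  qed (use S.subspace S.hermitian S.Re_self_pos in auto)
  then interpret SH: hilbert_carrier "V \<times> W" "sum_form h h'"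
    by unfold_locales
  show ?thesis
  proof unfold_locales
    show "hermitian_form_on (V \<times> W) (sum_form ip ip')"
      by (rule hermitian_form_on_sum[OF A.hermitian B.hermitian])
    show "cmod (sum_form ip ip' x y) \<le> S.nrm x * S.nrm y" if x: "x \<in> V \<times> W" and y: "y \<in> V \<times> W" for x y
    proof -
      have "cmod (sum_form ip ip' x y) \<le> A.nrm (fst x) * A.nrm (fst y) + B.nrm (snd x) * B.nrm (snd y)"
        unfolding sum_form_def using A.ip_bounded[of "fst x" "fst y"] B.ip_bounded[of "snd x" "snd y"] x y
        by (intro order_trans[OF norm_triangle_ineq add_mono]) auto
      also have "\<dots> \<le> S.nrm x * S.nrm y"
      proof (rule power2_le_imp_le)
        let ?a = "A.nrm (fst x)" and ?b = "A.nrm (fst y)" and ?c = "B.nrm (snd x)" and ?d = "B.nrm (snd y)"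
        \<comment> \<open>Cauchy-Schwarz in the plane: the two sides differ by the square of ?a * ?d
          - ?c * ?b.\<close>
        have "(?a * ?b + ?c * ?d)\<^sup>2 \<le> (?a\<^sup>2 + ?c\<^sup>2) * (?b\<^sup>2 + ?d\<^sup>2)"
          using zero_le_power2[of "?a * ?d - ?c * ?b"] by (simp add: power2_eq_square algebra_simps)
        then show "(?a * ?b + ?c * ?d)\<^sup>2 \<le> (S.nrm x * S.nrm y)\<^sup>2"
          using x y by (simp add: power_mult_distrib sq)
      qed (use x y in auto)
      finally show ?thesis .
    qed
    show "\<exists>y'\<in>V \<times> W. \<forall>x\<in>V \<times> W. sum_form h h' x y = sum_form ip ip' x y'" if y: "y \<in> V \<times> W" for y
    proof -
      obtain a b where "a \<in> V" "\<forall>x\<in>V. h x (fst y) = ip x a" "b \<in> W" "\<forall>x\<in>W. h' x (snd y) = ip' x b"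
        using A.h_via_ip[of "fst y"] B.h_via_ip[of "snd y"] y by (auto simp: mem_Times_iff)
      then show ?thesis
        by (intro bexI[of _ "(a, b)"]) (auto simp: sum_form_def)
    qed
    obtain E where E: "finite E" "E \<subseteq> V"
      "\<And>x. x \<in> V \<Longrightarrow> (A.nrm x)\<^sup>2 \<le> Re (ip x x) + 2 * (\<Sum>e\<in>E. (cmod (ip x e))\<^sup>2)"
      using A.garding by blast
    obtain F where F: "finite F" "F \<subseteq> W"
      "\<And>x. x \<in> W \<Longrightarrow> (B.nrm x)\<^sup>2 \<le> Re (ip' x x) + 2 * (\<Sum>e\<in>F. (cmod (ip' x e))\<^sup>2)"
      using B.garding by blast
    \<comment> \<open>Removing \<open>0\<close> from \<open>E\<close> and \<open>F\<close> makes the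
      two images disjoint, so that the sum over their union splits; pairings with \<open>0\<close>
      contribute nothing.\<close>
    let ?E = "insert 0 ((\<lambda>e. (e, 0)) ` (E - {0}) \<union> (\<lambda>f. (0, f)) ` (F - {0}))"
    have "(S.nrm x)\<^sup>2 \<le> Re (sum_form ip ip' x x) + 2 * (\<Sum>e\<in>?E. (cmod (sum_form ip ip' x e))\<^sup>2)"
      if x: "x \<in> V \<times> W" for x
    proof -
      have x': "fst x \<in> V" "snd x \<in> W"
        using x by auto
      have "(\<Sum>e\<in>?E. (cmod (sum_form ip ip' x e))\<^sup>2)
        = (\<Sum>e\<in>(\<lambda>e. (e, 0)) ` (E - {0}). (cmod (sum_form ip ip' x e))\<^sup>2)
        + (\<Sum>e\<in>(\<lambda>f. (0, f)) ` (F - {0}). (cmod (sum_form ip ip' x e))\<^sup>2)"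
        using E(1) F(1) x' by (subst sum.insert, (force simp: zero_prod_def)+, subst sum.union_disjoint)
          (auto simp: sum_form_def)
      also have "\<dots> = (\<Sum>e\<in>E - {0}. (cmod (ip (fst x) e))\<^sup>2) + (\<Sum>e\<in>F - {0}. (cmod (ip' (snd x) e))\<^sup>2)"
        using x' by (subst (1 2) sum.reindex) (auto simp: sum_form_def inj_on_def)
      also have "(\<Sum>e\<in>E - {0}. (cmod (ip (fst x) e))\<^sup>2) = (\<Sum>e\<in>E. (cmod (ip (fst x) e))\<^sup>2)"
        using E(1) x' by (intro sum.mono_neutral_left) auto
      also have "(\<Sum>e\<in>F - {0}. (cmod (ip' (snd x) e))\<^sup>2) = (\<Sum>e\<in>F. (cmod (ip' (snd x) e))\<^sup>2)"
        using F(1) x' by (intro sum.mono_neutral_left) auto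
      finally show ?thesis
        using E(3)[OF x'(1)] F(3)[OF x'(2)] sq[OF x] by (simp add: sum_form_def)
    qed
    then show "\<exists>E. finite E \<and> E \<subseteq> V \<times> W \<and> (\<forall>x\<in>V \<times> W. (S.nrm x)\<^sup>2 \<le>
        Re (sum_form ip ip' x x) + 2 * (\<Sum>e\<in>E. (cmod (sum_form ip ip' x e))\<^sup>2))"
      using E(1,2) F(1,2) by (intro exI[of _ ?E]) (auto simp: zero_prod_def)
  qed
qed

section \<open>Transfer of vectors between Pontryagin spaces with equal Gram matrices\<close>

context pontryagin_carrier
begin

lemma approx_if_total:
  assumes "csubspace D" "D \<subseteq> V"
    and "\<And>z. z \<in> V \<Longrightarrow> (\<And>d. d \<in> D \<Longrightarrow> ip d z = 0) \<Longrightarrow> z = 0"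
    and "v \<in> V" "e > 0"
  shows "\<exists>d\<in>D. nrm (v - d) < e"
proof -
  obtain X where X: "H.lim_to X v" "range X \<subseteq> D"
    by (rule dense_if_total[OF assms(1-4)])
  have "\<forall>\<^sub>F i in sequentially. nrm (X i - v) < e"
    using X(1) assms(5) unfolding H.lim_to_def by (intro order_tendstoD[where y = 0]) auto
  then obtain i where "nrm (X i - v) < e"
    by (meson eventually_happens trivial_limit_sequentially)
  moreover have "X i \<in> D" "X i \<in> V"
    using X(2) assms(2) by auto
  ultimately show ?thesis
    using H.nrm_diff_commute[of "X i" v] assms(4) by auto
qed

lemma lim_to_ip_right:
  assumes "H.lim_to X l" "v \<in> V"
  shows "(\<lambda>i. ip v (X i)) \<longlonglongrightarrow> ip v l"
proof -
  have "X i \<in> V" "l \<in> V" for i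
    using assms by (auto simp: H.lim_to_def)
  then show ?thesis
    using tendsto_cnj[OF lim_to_ip_left[OF assms]] commute[of _ v] assms(2) by simp
qed

end

text \<open>The map sending \<open>a i\<close> to \<open>b i\<close> extends continuously: the Garding inequality of the target,
  with test vectors from the dense span of the \<open>b i\<close>, only involves inner products that the
  map preserves.\<close>

lemma isometric_transfer:
  fixes a :: "'i \<Rightarrow> 'v::complex_vector" and b :: "'i \<Rightarrow> 'w::complex_vector"
  assumes "pontryagin_carrier V ip h" "pontryagin_carrier W ip' h'"
    and a: "\<And>i. i \<in> I \<Longrightarrow> a i \<in> V" and b: "\<And>i. i \<in> I \<Longrightarrow> b i \<in> W"
    and gram: "\<And>i j. i \<in> I \<Longrightarrow> j \<in> I \<Longrightarrow> ip (a i) (a j) = ip' (b i) (b j)"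
    and total_a: "\<And>z. z \<in> V \<Longrightarrow> (\<And>i. i \<in> I \<Longrightarrow> ip (a i) z = 0) \<Longrightarrow> z = 0"
    and total_b: "\<And>z. z \<in> W \<Longrightarrow> (\<And>i. i \<in> I \<Longrightarrow> ip' (b i) z = 0) \<Longrightarrow> z = 0"
    and v: "v \<in> V"
  obtains w where "w \<in> W" "\<And>i. i \<in> I \<Longrightarrow> ip v (a i) = ip' w (b i)"
proof -
  interpret A: pontryagin_carrier V ip h by fact
  interpret B: pontryagin_carrier W ip' h' by fact
  \<comment> \<open>The map is kept as a relation, the span of the pairs, so that linearity is built
    in. That it is single-valued is contained in \<open>bound\<close> below: a pair (0, y) has y of
    norm 0.\<close>
  define G where "G = cspan ((\<lambda>i. (a i, b i)) ` I)"
  have Gsub: "csubspace G"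
    unfolding G_def by (rule complex_vector.subspace_span)
  have gen: "(a i, b i) \<in> G" if "i \<in> I" for i
    unfolding G_def using that by (auto intro: complex_vector.span_base)
  have GVW: "G \<subseteq> V \<times> W"
    unfolding G_def using a b A.subspace B.subspace
    by (intro complex_vector.span_minimal csubspace_Times) auto
  have iso1: "ip (fst p) (a i) = ip' (snd p) (b i)" if "p \<in> G" "i \<in> I" for p i
  proof -
    let ?S = "{p \<in> V \<times> W. ip (fst p) (a i) = ip' (snd p) (b i)}"
    have "csubspace ?S"
      unfolding complex_vector.subspace_def using a[OF that(2)] b[OF that(2)]
      by (auto simp: scaleC_prod_def zero_prod_def)
    moreover have "(\<lambda>i. (a i, b i)) ` I \<subseteq> ?S"
      using gram a b that(2) by auto
    ultimately have "G \<subseteq> ?S"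
      unfolding G_def by (intro complex_vector.span_minimal)
    then show ?thesis using that by auto
  qed
  have iso: "ip (fst q) (fst p) = ip' (snd q) (snd p)" if "p \<in> G" "q \<in> G" for p q
  proof -
    let ?S = "{p \<in> V \<times> W. ip (fst q) (fst p) = ip' (snd q) (snd p)}"
    have q: "fst q \<in> V" "snd q \<in> W"
      using that GVW by auto
    then have "csubspace ?S"
      unfolding complex_vector.subspace_def by (auto simp: scaleC_prod_def zero_prod_def)
    moreover have "(\<lambda>i. (a i, b i)) ` I \<subseteq> ?S"
      using iso1[OF that(2)] a b by auto
    ultimately have "G \<subseteq> ?S"
      unfolding G_def by (intro complex_vector.span_minimal)
    then show ?thesis using that by auto
  qed
  have sub1: "csubspace (fst ` G)" and sub2: "csubspace (snd ` G)"
    using Gsub unfolding complex_vector.subspace_def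
    by (auto simp: image_iff) (metis fst_zero snd_zero fst_add snd_add scaleC_prod_def fst_conv snd_conv)+
  have subset: "fst ` G \<subseteq> V" "snd ` G \<subseteq> W"
    using GVW by auto
  have dense2: "\<exists>d\<in>snd ` G. B.nrm (w - d) < e" if "w \<in> W" "e > 0" for w e
  proof (rule B.approx_if_total[OF sub2 subset(2) _ that])
    show "z = 0" if "z \<in> W" "\<And>d. d \<in> snd ` G \<Longrightarrow> ip' d z = 0" for z
      using that gen by (intro total_b) force+
  qed
  obtain F K where F: "finite F" "F \<subseteq> snd ` G"
    and gard: "\<And>x. x \<in> W \<Longrightarrow> (B.nrm x)\<^sup>2 \<le> 2 * Re (ip' x x) + (\<Sum>d\<in>F. (cmod (ip' x d))\<^sup>2) * K"
    and K: "K \<ge> 0"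
    by (rule B.garding_dense[OF subset(2)], erule (1) dense2, rule that)
  have "\<forall>d\<in>F. \<exists>c. (c, d) \<in> G"
    using F(2) by force
  then obtain c where c: "\<And>d. d \<in> F \<Longrightarrow> (c d, d) \<in> G"
    by metis
  \<comment> \<open>The Garding inequality of \<open>W\<close> is read in \<open>V\<close>: both
    \<open>Re (ip x x)\<close> and the pairings with the preimages \<open>c d\<close> are bounded by
    the norm of \<open>x\<close>, which produces this constant.\<close>
  define M where "M = 2 + (\<Sum>d\<in>F. (A.nrm (c d))\<^sup>2) * K"
  have M: "M \<ge> 0"
    unfolding M_def using K by (auto intro!: add_nonneg_nonneg mult_nonneg_nonneg sum_nonneg)
  have bound: "B.nrm y \<le> sqrt M * A.nrm x" if xy: "(x, y) \<in> G" for x y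
  proof (rule power2_le_imp_le)
    have x: "x \<in> V" and y: "y \<in> W"
      using xy GVW by auto
    have "(B.nrm y)\<^sup>2 \<le> 2 * Re (ip x x) + (\<Sum>d\<in>F. (cmod (ip x (c d)))\<^sup>2) * K"
      using gard[OF y] iso[OF xy xy] iso[OF c xy] by (simp cong: sum.cong)
    also have "\<dots> \<le> 2 * (A.nrm x)\<^sup>2 + (\<Sum>d\<in>F. (A.nrm x)\<^sup>2 * (A.nrm (c d))\<^sup>2) * K"
    proof (intro add_mono mult_right_mono sum_mono K)
      show "2 * Re (ip x x) \<le> 2 * (A.nrm x)\<^sup>2"
        using A.ip_bounded[OF x x] complex_Re_le_cmod[of "ip x x"] by (simp add: power2_eq_square)
      fix d assume "d \<in> F"
      then have "c d \<in> V"
        using c GVW by blast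
      then show "(cmod (ip x (c d)))\<^sup>2 \<le> (A.nrm x)\<^sup>2 * (A.nrm (c d))\<^sup>2"
        using A.ip_bounded[OF x, of "c d"] by (metis norm_ge_zero power_mono power_mult_distrib)
    qed
    also have "\<dots> = (sqrt M * A.nrm x)\<^sup>2"
      using M by (simp add: power_mult_distrib M_def sum_distrib_left[symmetric] algebra_simps)
    finally show "(B.nrm y)\<^sup>2 \<le> (sqrt M * A.nrm x)\<^sup>2" .
    show "0 \<le> sqrt M * A.nrm x"
      using M x by simp
  qed
  obtain X where X: "A.H.lim_to X v" "range X \<subseteq> fst ` G"
  proof (rule A.dense_if_total[OF sub1 subset(1) _ v])
    show "z = 0" if "z \<in> V" "\<And>d. d \<in> fst ` G \<Longrightarrow> ip d z = 0" for z
      using that gen by (intro total_a) force+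
  qed
  have "\<forall>k. \<exists>y. (X k, y) \<in> G"
    using X(2) by force
  then obtain Y where Y: "\<And>k. (X k, Y k) \<in> G"
    by metis
  have mem: "X k \<in> V" "Y k \<in> W" for k
    using Y[of k] GVW by auto
  have YX: "B.nrm (Y i - Y j) \<le> sqrt M * A.nrm (X i - X j)" for i j
    using bound[of "X i - X j" "Y i - Y j"] complex_vector.subspace_diff[OF Gsub Y[of i] Y[of j]] by simp
  obtain w where w: "B.H.lim_to Y w"
  proof (rule B.H.Cauchy_lim_to)
    show "range Y \<subseteq> W"
      using mem by auto
    fix e :: real assume e: "e > 0"
    then have "e / (sqrt M + 1) > 0"
      using M by (simp add: add_nonneg_pos)
    then obtain N where N: "\<forall>i\<ge>N. \<forall>j\<ge>N. A.nrm (X i - X j) < e / (sqrt M + 1)"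
      using A.H.lim_to_Cauchy[OF X(1)] by blast
    have "B.nrm (Y i - Y j) < e" if "i \<ge> N" "j \<ge> N" for i j
    proof -
      have "A.nrm (X i - X j) * (sqrt M + 1) < e"
        using N that pos_less_divide_eq[of "sqrt M + 1"] M by (simp add: add_nonneg_pos)
      moreover have "B.nrm (Y i - Y j) \<le> (sqrt M + 1) * A.nrm (X i - X j)"
        using YX[of i j] mem by (simp add: algebra_simps add_increasing)
      ultimately show ?thesis
        by (simp add: mult.commute)
    qed
    then show "\<exists>N. \<forall>i\<ge>N. \<forall>j\<ge>N. B.nrm (Y i - Y j) < e"
      by blast
  qed
  show thesis
  proof (rule that)
    show "w \<in> W"
      using w by (simp add: B.H.lim_to_def)
    fix i assume i: "i \<in> I"
    have "(\<lambda>k. ip (X k) (a i)) \<longlonglongrightarrow> ip v (a i)"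
      by (rule A.lim_to_ip_left[OF X(1) a[OF i]])
    moreover have "(\<lambda>k. ip (X k) (a i)) \<longlonglongrightarrow> ip' w (b i)"
      using B.lim_to_ip_left[OF w b[OF i]] iso1[OF Y i] by simp
    ultimately show "ip v (a i) = ip' w (b i)"
      by (rule LIMSEQ_unique)
  qed
qed

section \<open>Resolvents of self-adjoint relations\<close>

locale selfadjoint =
  fixes V :: "'v::complex_vector set" and ip :: "'v form" and A :: "('v \<times> 'v) set"
  assumes pontryagin: "pontryagin_space V ip" and selfadjoint: "selfadjoint_relation V ip A"
begin

sublocale pontryagin_carrier V ip "majorant V ip"
  by (rule pontryagin_carrier_majorant[OF pontryagin])

abbreviation \<rho> :: "complex set" where "\<rho> \<equiv> resolvent_set V ip A"
abbreviation R :: "complex \<Rightarrow> 'v \<Rightarrow> 'v" where "R \<equiv> resolvent_op A"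

lemma A_subspace: "csubspace A"
  and A_mem: "(x, y) \<in> A \<Longrightarrow> x \<in> V" "(x, y) \<in> A \<Longrightarrow> y \<in> V"
  and A_eq: "A = rel_adj V ip A"
  using selfadjoint by (auto simp: selfadjoint_relation_def)

lemma A_add: "(x, y) \<in> A \<Longrightarrow> (u, v) \<in> A \<Longrightarrow> (x + u, y + v) \<in> A"
  using complex_vector.subspace_add[OF A_subspace, of "(x, y)" "(u, v)"] by simp

lemma A_diff: "(x, y) \<in> A \<Longrightarrow> (u, v) \<in> A \<Longrightarrow> (x - u, y - v) \<in> A"
  using complex_vector.subspace_diff[OF A_subspace, of "(x, y)" "(u, v)"] by simp

lemma A_scale: "(x, y) \<in> A \<Longrightarrow> (c *\<^sub>C x, c *\<^sub>C y) \<in> A"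
  using complex_vector.subspace_scale[OF A_subspace, of "(x, y)" c] by (simp add: scaleC_prod_def)

lemma A_zero: "(0, 0) \<in> A"
  using complex_vector.subspace_0[OF A_subspace] by (simp add: zero_prod_def)

lemma A_symmetric: "(x, y) \<in> A \<Longrightarrow> (u, v) \<in> A \<Longrightarrow> ip y u = ip x v"
  using equalityD1[OF A_eq] by (auto simp: rel_adj_def)

lemma A_maximal: "u \<in> V \<Longrightarrow> v \<in> V \<Longrightarrow> (\<And>x y. (x, y) \<in> A \<Longrightarrow> ip y u = ip x v) \<Longrightarrow> (u, v) \<in> A"
  by (subst A_eq) (auto simp: rel_adj_def)

text \<open>An adjoint is closed, since its defining equations pass to limits.\<close>

lemma A_closed:
  assumes "H.lim_to X l" "H.lim_to Y l'" "\<And>i. (X i, Y i) \<in> A"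
  shows "(l, l') \<in> A"
proof (rule A_maximal)
  fix x y assume xy: "(x, y) \<in> A"
  have "(\<lambda>i. ip y (X i)) \<longlonglongrightarrow> ip y l"
    using assms(1) A_mem[OF xy] by (intro lim_to_ip_right)
  moreover have "(\<lambda>i. ip y (X i)) \<longlonglongrightarrow> ip x l'"
    using lim_to_ip_right[OF assms(2), of x] A_mem[OF xy] A_symmetric[OF xy assms(3)] by simp
  ultimately show "ip y l = ip x l'"
    by (rule LIMSEQ_unique)
qed (use assms in \<open>auto simp: H.lim_to_def\<close>)

lemma resolvent_op_iff:
  assumes "\<zeta> \<in> \<rho>" "x \<in> V"
  shows "(k, x + \<zeta> *\<^sub>C k) \<in> A \<longleftrightarrow> k = R \<zeta> x"
proof -
  obtain R0 where R0: "bounded_op_on V ip R0" "resolvent_rel A \<zeta> = rel_graph V R0"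
    using assms(1) by (auto simp: resolvent_set_def)
  have iff: "(k, x + \<zeta> *\<^sub>C k) \<in> A \<longleftrightarrow> (x, k) \<in> resolvent_rel A \<zeta>" for k
    unfolding resolvent_rel_def rel_shift_def by (force simp: algebra_simps)
  have "(x, k) \<in> resolvent_rel A \<zeta> \<longleftrightarrow> k = R0 x" for k
    unfolding R0(2) rel_graph_def using assms(2) by auto
  then show ?thesis
    unfolding iff resolvent_op_def by simp
qed

lemma resolvent_op_in: "\<zeta> \<in> \<rho> \<Longrightarrow> x \<in> V \<Longrightarrow> (R \<zeta> x, x + \<zeta> *\<^sub>C R \<zeta> x) \<in> A"
  by (simp add: resolvent_op_iff)

lemma resolvent_op_mem [simp]: "\<zeta> \<in> \<rho> \<Longrightarrow> x \<in> V \<Longrightarrow> R \<zeta> x \<in> V"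
  using resolvent_op_in A_mem by blast

lemma resolvent_op_eqI: "\<zeta> \<in> \<rho> \<Longrightarrow> x \<in> V \<Longrightarrow> (k, y) \<in> A \<Longrightarrow> y = x + \<zeta> *\<^sub>C k \<Longrightarrow> R \<zeta> x = k"
  using resolvent_op_iff[of \<zeta> x k] by auto

lemma resolvent_op_add: "\<zeta> \<in> \<rho> \<Longrightarrow> x \<in> V \<Longrightarrow> y \<in> V \<Longrightarrow> R \<zeta> (x + y) = R \<zeta> x + R \<zeta> y"
  by (rule resolvent_op_eqI[OF _ _ A_add[OF resolvent_op_in resolvent_op_in]])
    (auto simp: scaleC_add_right)

lemma resolvent_op_scale: "\<zeta> \<in> \<rho> \<Longrightarrow> x \<in> V \<Longrightarrow> R \<zeta> (c *\<^sub>C x) = c *\<^sub>C R \<zeta> x"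
  by (rule resolvent_op_eqI[OF _ _ A_scale[OF resolvent_op_in]])
    (auto simp: scaleC_add_right scaleC_scaleC mult.commute)

lemma resolvent_op_diff: "\<zeta> \<in> \<rho> \<Longrightarrow> x \<in> V \<Longrightarrow> y \<in> V \<Longrightarrow> R \<zeta> (x - y) = R \<zeta> x - R \<zeta> y"
  using resolvent_op_add[of \<zeta> "x - y" y] by simp

lemma resolvent_op_zero: "\<zeta> \<in> \<rho> \<Longrightarrow> R \<zeta> 0 = 0"
  using resolvent_op_diff[of \<zeta> 0 0] by simp

lemma resolvent_op_sum:
  "\<zeta> \<in> \<rho> \<Longrightarrow> (\<And>i. i \<in> I \<Longrightarrow> f i \<in> V) \<Longrightarrow> R \<zeta> (sum f I) = (\<Sum>i\<in>I. R \<zeta> (f i))"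
  by (induction I rule: infinite_finite_induct) (auto simp: resolvent_op_zero resolvent_op_add)

lemma resolvent_op_bounded:
  assumes "\<zeta> \<in> \<rho>"
  obtains C where "C > 0" "\<And>x. x \<in> V \<Longrightarrow> nrm (R \<zeta> x) \<le> C * nrm x"
proof -
  obtain R0 where R0: "bounded_op_on V ip R0" "resolvent_rel A \<zeta> = rel_graph V R0"
    using assms by (auto simp: resolvent_set_def)
  then obtain C where C: "\<forall>x\<in>V. nrm (R0 x) \<le> C * nrm x"
    unfolding bounded_op_on_def pnorm_def by blast
  have "R \<zeta> x = R0 x" if "x \<in> V" for x
    using that unfolding resolvent_op_def R0(2) rel_graph_def by auto
  then have "nrm (R \<zeta> x) \<le> (\<bar>C\<bar> + 1) * nrm x" if x: "x \<in> V" for x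
    using C x mult_right_mono[of C "\<bar>C\<bar> + 1" "nrm x"] by fastforce
  then show thesis
    using that[of "\<bar>C\<bar> + 1"] by auto
qed

text \<open>Symmetry of \<open>A\<close> applied to the two elements of its graph that the
  resolvents provide. The adjoint formula is the case \<zeta> = cnj \<mu>, and all Gram matrices of
  resolvent vectors are computed from this identity.\<close>

lemma resolvent_op_pairing:
  assumes "\<zeta> \<in> \<rho>" "\<mu> \<in> \<rho>" "a \<in> V" "b \<in> V"
  shows "(\<zeta> - cnj \<mu>) * ip (R \<zeta> a) (R \<mu> b) = ip (R \<zeta> a) b - ip a (R \<mu> b)"
  using A_symmetric[OF resolvent_op_in[OF assms(1,3)] resolvent_op_in[OF assms(2,4)]] assms
  by (simp add: algebra_simps)

lemma resolvent_op_adjoint: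
  assumes "\<zeta> \<in> \<rho>" "cnj \<zeta> \<in> \<rho>" "a \<in> V" "b \<in> V"
  shows "ip (R \<zeta> a) b = ip a (R (cnj \<zeta>) b)"
  using resolvent_op_pairing[OF assms] by simp

lemma resolvent_identity:
  assumes "\<zeta> \<in> \<rho>" "\<mu> \<in> \<rho>" "a \<in> V"
  shows "R \<zeta> a - R \<mu> a = (\<zeta> - \<mu>) *\<^sub>C R \<zeta> (R \<mu> a)"
proof -
  have "R \<zeta> ((\<zeta> - \<mu>) *\<^sub>C R \<mu> a) = R \<zeta> a - R \<mu> a"
    by (rule resolvent_op_eqI[OF _ _ A_diff[OF resolvent_op_in resolvent_op_in]])
      (use assms in \<open>auto simp: algebra_simps complex_vector.scale_right_diff_distrib complex_vector.scale_left_diff_distrib\<close>)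
  then show ?thesis
    using assms by (simp add: resolvent_op_scale)
qed

lemma resolvent_op_eigenvector:
  assumes "(v, \<alpha> *\<^sub>C v) \<in> A" "\<zeta> \<in> \<rho>"
  shows "(\<alpha> - \<zeta>) *\<^sub>C R \<zeta> v = v"
proof -
  have "R \<zeta> ((\<alpha> - \<zeta>) *\<^sub>C v) = v"
    using A_mem[OF assms(1)]
    by (intro resolvent_op_eqI[OF assms(2) _ assms(1)]) (auto simp: complex_vector.scale_left_diff_distrib)
  then show ?thesis
    using assms A_mem[OF assms(1)] by (simp add: resolvent_op_scale)
qed

lemma eigenvalue_not_resolvent:
  assumes "(v, \<alpha> *\<^sub>C v) \<in> A" "\<alpha> \<in> \<rho>"
  shows "v = 0"
  using resolvent_op_eigenvector[OF assms] by simp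

subsection \<open>The nonreal spectrum is finite\<close>

text \<open>Dropping one linear constraint enlarges the domain by at most one dimension. In that
  direction the residual \<open>y - \<zeta> *\<^sub>C x\<close> stays away from 0, because
  \<open>A\<close> is closed and \<zeta> is no eigenvalue; the two estimates are then added.\<close>

lemma remove_constraint:
  assumes inj: "\<And>v. (v, \<zeta> *\<^sub>C v) \<in> A \<Longrightarrow> v = 0"
    and F: "F \<subseteq> V" "e \<in> V" and C: "C \<ge> 0"
      "\<And>x y. (x, y) \<in> A \<Longrightarrow> (\<And>f. f \<in> insert e F \<Longrightarrow> ip x f = 0) \<Longrightarrow> nrm x \<le> C * nrm (y - \<zeta> *\<^sub>C x)"
  shows "\<exists>C\<ge>0. \<forall>(x, y)\<in>A. (\<forall>f\<in>F. ip x f = 0) \<longrightarrow> nrm x \<le> C * nrm (y - \<zeta> *\<^sub>C x)"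
proof (cases "\<exists>(x, y)\<in>A. (\<forall>f\<in>F. ip x f = 0) \<and> ip x e \<noteq> 0")
  case False
  then show ?thesis
    using C by (intro exI[of _ C]) (auto intro!: C(2))
next
  case True
  then obtain x1 y1 where x1: "(x1, y1) \<in> A" "\<forall>f\<in>F. ip x1 f = 0" "ip x1 e \<noteq> 0"
    by blast
  define T where "T = {(x, y) \<in> A. \<forall>f\<in>F. ip x f = 0}"
  have T_mem: "x \<in> V" "y \<in> V" "(x, y) \<in> A" "y - \<zeta> *\<^sub>C x \<in> V" if "(x, y) \<in> T" for x y
    using that A_mem[of x y] by (auto simp: T_def)
  have T_diff: "(x - u, y - v) \<in> T" if "(x, y) \<in> T" "(u, v) \<in> T" for x y u v
    using that F(1) A_diff T_mem(1)[OF that(1)] T_mem(1)[OF that(2)] by (auto simp: T_def)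
  have T_scale: "(c *\<^sub>C x, c *\<^sub>C y) \<in> T" if "(x, y) \<in> T" for c x y
    using that F(1) A_scale T_mem(1)[OF that(1)] by (auto simp: T_def)
  have C': "nrm x \<le> C * nrm (y - \<zeta> *\<^sub>C x)" if "(x, y) \<in> T" "ip x e = 0" for x y
    using that C(2) by (auto simp: T_def)
  define x0 y0 where "x0 = (1 / ip x1 e) *\<^sub>C x1" and "y0 = (1 / ip x1 e) *\<^sub>C y1"
  have x0: "(x0, y0) \<in> T" "ip x0 e = 1"
  proof -
    have "(x1, y1) \<in> T"
      using x1 by (auto simp: T_def)
    then show "(x0, y0) \<in> T" "ip x0 e = 1"
      unfolding x0_def y0_def using T_scale x1(3) F(2) T_mem(1) by auto
  qed
  \<comment> \<open>If residuals tended to 0 along vectors with pairing 1, the differences of these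
    vectors would satisfy all constraints, so the old bound would make the sequence Cauchy. Its
    limit would be an eigenvector with pairing 1, against \<open>inj\<close>.\<close>
  have "\<exists>\<delta>>0. \<forall>(x, y)\<in>T. ip x e = 1 \<longrightarrow> \<delta> \<le> nrm (y - \<zeta> *\<^sub>C x)"
  proof (rule ccontr)
    assume neg: "\<not> ?thesis"
    have "\<exists>x y. (x, y) \<in> T \<and> ip x e = 1 \<and> nrm (y - \<zeta> *\<^sub>C x) < 1 / Suc i" for i
    proof -
      have "\<forall>(x, y)\<in>T. ip x e = 1 \<longrightarrow> 1 / Suc i \<le> nrm (y - \<zeta> *\<^sub>C x)"
        if no: "\<not> (\<exists>x y. (x, y) \<in> T \<and> ip x e = 1 \<and> nrm (y - \<zeta> *\<^sub>C x) < 1 / Suc i)"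
        using no by (intro ballI, simp only: split_paired_all prod.case) (meson not_le)
      moreover have "0 < 1 / real (Suc i)"
        by simp
      ultimately show ?thesis
        using neg by blast
    qed
    then obtain X Y where XY: "\<And>i. (X i, Y i) \<in> T" "\<And>i. ip (X i) e = 1"
      "\<And>i. nrm (Y i - \<zeta> *\<^sub>C X i) < 1 / Suc i"
      by metis
    have mem: "X i \<in> V" "Y i \<in> V" "Y i - \<zeta> *\<^sub>C X i \<in> V" for i
      using T_mem[OF XY(1)[of i]] by auto
    have est: "nrm (X i - X j) \<le> C * (1 / Suc i + 1 / Suc j)" for i j
    proof -
      have "nrm (X i - X j) \<le> C * nrm ((Y i - Y j) - \<zeta> *\<^sub>C (X i - X j))"
        using C'[OF T_diff[OF XY(1)[of i] XY(1)[of j]]] XY(2) mem F(2) by simp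
      also have "(Y i - Y j) - \<zeta> *\<^sub>C (X i - X j) = (Y i - \<zeta> *\<^sub>C X i) - (Y j - \<zeta> *\<^sub>C X j)"
        by (simp add: complex_vector.scale_right_diff_distrib)
      also have "C * nrm \<dots> \<le> C * (1 / Suc i + 1 / Suc j)"
        using H.nrm_triangle_diff[OF mem(3)[of i] mem(3)[of j]] XY(3)[of i] XY(3)[of j] C(1)
        by (intro mult_left_mono) auto
      finally show ?thesis .
    qed
    obtain l where l: "H.lim_to X l"
    proof (rule H.Cauchy_lim_to)
      show "range X \<subseteq> V"
        using mem by auto
      fix r :: real assume r: "r > 0"
      then have "r / (2 * (C + 1)) > 0"
        using C(1) by simp
      then obtain M where M: "1 / Suc M < r / (2 * (C + 1))"
        by (rule nat_approx_posE)
      have "nrm (X i - X j) < r" if "i \<ge> M" "j \<ge> M" for i j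
      proof -
        have "1 / Suc i \<le> 1 / Suc M" "1 / Suc j \<le> 1 / Suc M"
          using that by (auto simp: frac_le)
        then have "1 / Suc i + 1 / Suc j \<le> 1 / Suc M + 1 / Suc M"
          by (rule add_mono)
        also have "\<dots> \<le> r / (2 * (C + 1)) + r / (2 * (C + 1))"
          using M by (intro add_mono) auto
        also have "\<dots> = r / (C + 1)"
          by (simp only: mult.commute[of 2] divide_divide_eq_left[symmetric] field_sum_of_halves)
        finally have "1 / Suc i + 1 / Suc j \<le> r / (C + 1)" .
        then have "C * (1 / Suc i + 1 / Suc j) \<le> C * (r / (C + 1))"
          using C(1) by (rule mult_left_mono)
        also have "\<dots> < r"
          using r C(1) by (simp add: field_simps)
        finally show ?thesis
          using est[of i j] by simp
      qed
      then show "\<exists>M. \<forall>i\<ge>M. \<forall>j\<ge>M. nrm (X i - X j) < r"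
        by blast
    qed
    have lV: "l \<in> V"
      using l by (simp add: H.lim_to_def)
    have "H.lim_to Y (\<zeta> *\<^sub>C l)"
      unfolding H.lim_to_def
    proof (intro conjI)
      show "(\<lambda>i. nrm (Y i - \<zeta> *\<^sub>C l)) \<longlonglongrightarrow> 0"
      proof (rule Lim_null_comparison)
        have "nrm (Y i - \<zeta> *\<^sub>C l) \<le> 1 / Suc i + cmod \<zeta> * nrm (X i - l)" for i
        proof -
          have eq: "Y i - \<zeta> *\<^sub>C l = (Y i - \<zeta> *\<^sub>C X i) + \<zeta> *\<^sub>C (X i - l)"
            by (simp add: complex_vector.scale_right_diff_distrib)
          have "nrm (Y i - \<zeta> *\<^sub>C l) \<le> nrm (Y i - \<zeta> *\<^sub>C X i) + nrm (\<zeta> *\<^sub>C (X i - l))"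
            unfolding eq using H.nrm_triangle[OF mem(3)[of i], of "\<zeta> *\<^sub>C (X i - l)"] mem lV by simp
          then show ?thesis
            using XY(3)[of i] mem lV by simp
        qed
        then show "\<forall>\<^sub>F i in sequentially. norm (nrm (Y i - \<zeta> *\<^sub>C l)) \<le> 1 / Suc i + cmod \<zeta> * nrm (X i - l)"
          using mem lV by simp
        show "(\<lambda>i. 1 / Suc i + cmod \<zeta> * nrm (X i - l)) \<longlonglongrightarrow> 0"
          using l unfolding H.lim_to_def
          by (intro tendsto_add_zero tendsto_mult_right_zero LIMSEQ_Suc[OF lim_1_over_n]) auto
      qed
    qed (use mem lV in auto)
    then have "(l, \<zeta> *\<^sub>C l) \<in> A"
      using l XY(1) by (intro A_closed[of X l Y]) (auto simp: T_def)
    then have "l = 0"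
      by (rule inj)
    moreover have "(\<lambda>i. ip (X i) e) \<longlonglongrightarrow> ip l e"
      by (rule lim_to_ip_left[OF l F(2)])
    ultimately show False
      using XY(2) F(2) by (simp add: LIMSEQ_const_iff)
  qed
  then obtain \<delta> where \<delta>: "\<delta> > 0" "\<And>x y. (x, y) \<in> T \<Longrightarrow> ip x e = 1 \<Longrightarrow> \<delta> \<le> nrm (y - \<zeta> *\<^sub>C x)"
    by blast
  define g0 where "g0 = y0 - \<zeta> *\<^sub>C x0"
  have mem0: "x0 \<in> V" "y0 \<in> V" "g0 \<in> V"
    using T_mem[OF x0(1)] by (auto simp: g0_def)
  \<comment> \<open>From splitting \<open>x\<close> into \<open>x - c *\<^sub>C x0\<close>, where
    the old bound applies, and \<open>c *\<^sub>C x0\<close>, where the modulus of \<open>c\<close>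
    is at most \<open>nrm g / \<delta>\<close>.\<close>
  define C1 where "C1 = C * (1 + nrm g0 / \<delta>) + nrm x0 / \<delta>"
  have C1: "C1 \<ge> 0"
    unfolding C1_def using C(1) \<delta>(1) mem0 by simp
  have "nrm x \<le> C1 * nrm (y - \<zeta> *\<^sub>C x)" if xy: "(x, y) \<in> T" for x y
  proof -
    define g c where "g = y - \<zeta> *\<^sub>C x" and "c = ip x e"
    have mem: "x \<in> V" "y \<in> V" "g \<in> V"
      using T_mem[OF xy] by (auto simp: g_def)
    have c: "cmod c \<le> nrm g / \<delta>"
    proof (cases "c = 0")
      case False
      have "\<delta> \<le> nrm ((1 / c) *\<^sub>C y - \<zeta> *\<^sub>C (1 / c) *\<^sub>C x)"
        using False mem F(2) by (intro \<delta>(2) T_scale xy) (auto simp: c_def)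
      also have "(1 / c) *\<^sub>C y - \<zeta> *\<^sub>C (1 / c) *\<^sub>C x = (1 / c) *\<^sub>C g"
        by (simp add: g_def complex_vector.scale_right_diff_distrib scaleC_scaleC mult.commute)
      finally show ?thesis
        using mem False \<delta>(1) by (simp add: norm_divide field_simps)
    qed (use mem \<delta> in auto)
    have "nrm (x - c *\<^sub>C x0) \<le> C * nrm ((y - c *\<^sub>C y0) - \<zeta> *\<^sub>C (x - c *\<^sub>C x0))"
      using x0(2) mem mem0 F(2) by (intro C' T_diff T_scale xy x0(1)) (auto simp: c_def)
    also have "(y - c *\<^sub>C y0) - \<zeta> *\<^sub>C (x - c *\<^sub>C x0) = g - c *\<^sub>C g0"
      by (simp add: g_def g0_def complex_vector.scale_right_diff_distrib scaleC_scaleC mult.commute)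
    finally have 1: "nrm (x - c *\<^sub>C x0) \<le> C * nrm (g - c *\<^sub>C g0)" .
    have "nrm (g - c *\<^sub>C g0) \<le> nrm g + cmod c * nrm g0"
      using H.nrm_triangle_diff[of g "c *\<^sub>C g0"] mem mem0 by simp
    also have "\<dots> \<le> nrm g + nrm g / \<delta> * nrm g0"
      using c mem0 by (intro add_left_mono mult_right_mono) auto
    finally have 2: "C * nrm (g - c *\<^sub>C g0) \<le> C * (nrm g + nrm g / \<delta> * nrm g0)"
      using C(1) by (intro mult_left_mono)
    have "nrm x \<le> nrm (x - c *\<^sub>C x0) + nrm (c *\<^sub>C x0)"
      using H.nrm_triangle[of "x - c *\<^sub>C x0" "c *\<^sub>C x0"] mem mem0 by simp
    also have "nrm (c *\<^sub>C x0) \<le> nrm g / \<delta> * nrm x0"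
      using mult_right_mono[OF c, of "nrm x0"] mem0 by simp
    finally have "nrm x \<le> C * (nrm g + nrm g / \<delta> * nrm g0) + nrm g / \<delta> * nrm x0"
      using 1 2 by linarith
    also have "\<dots> = C1 * nrm g"
      by (simp add: C1_def algebra_simps)
    finally show ?thesis
      by (simp add: g_def)
  qed
  then show ?thesis
    using C1 unfolding T_def by (intro exI[of _ C1]) auto
qed

text \<open>On vectors annihilated by the Garding vectors \<open>E\<close> the form dominates the
  squared norm, and the imaginary part of the pairing of \<open>y - \<zeta> *\<^sub>C x\<close> with
  \<open>x\<close> is - Im \<zeta> times the form. This gives the classical bound with 1 / |Im
  \<zeta>|; the finitely many constraints are then lifted by
  \<open>remove_constraint\<close>.\<close>

lemma bounded_below:
  assumes inj: "\<And>v. (v, \<zeta> *\<^sub>C v) \<in> A \<Longrightarrow> v = 0" and "Im \<zeta> \<noteq> 0"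
  obtains C where "C \<ge> 0" "\<And>x y. (x, y) \<in> A \<Longrightarrow> nrm x \<le> C * nrm (y - \<zeta> *\<^sub>C x)"
proof -
  obtain E where E: "finite E" "E \<subseteq> V"
    and gard: "\<And>x. x \<in> V \<Longrightarrow> (nrm x)\<^sup>2 \<le> Re (ip x x) + 2 * (\<Sum>e\<in>E. (cmod (ip x e))\<^sup>2)"
    using garding by blast
  have start: "nrm x \<le> 1 / \<bar>Im \<zeta>\<bar> * nrm (y - \<zeta> *\<^sub>C x)" if xy: "(x, y) \<in> A" "\<forall>e\<in>E. ip x e = 0" for x y
  proof (cases "x = 0")
    case True
    then show ?thesis
      using A_mem[OF xy(1)] by simp
  next
    case False
    note mem = A_mem[OF xy(1)]
    define g where "g = y - \<zeta> *\<^sub>C x"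
    have g: "g \<in> V"
      using mem by (simp add: g_def)
    have "Im (ip y x) = 0"
      using A_symmetric[OF xy(1) xy(1)] commute[OF mem] by (metis Reals_cnj_iff complex_is_Real_iff)
    then have "Im (ip g x) = - Im \<zeta> * Re (ip x x)"
      using mem Im_self[OF mem(1)] by (simp add: g_def)
    then have "\<bar>Im \<zeta>\<bar> * Re (ip x x) \<le> cmod (ip g x)"
      using abs_Im_le_cmod[of "ip g x"] by (smt (verit) abs_mult abs_minus_cancel mult_left_mono abs_ge_zero abs_ge_self minus_mult_left)
    also have "\<dots> \<le> nrm g * nrm x"
      by (rule ip_bounded[OF g mem(1)])
    finally have "\<bar>Im \<zeta>\<bar> * (nrm x)\<^sup>2 \<le> nrm g * nrm x"
      using gard[OF mem(1)] xy(2) by (smt (verit) abs_ge_zero mult_left_mono norm_zero power_zero_numeral sum.neutral)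
    moreover have "nrm x > 0"
      using False mem H.nrm_eq_0_iff[of x] H.nrm_nonneg[of x] by linarith
    ultimately have "\<bar>Im \<zeta>\<bar> * nrm x \<le> nrm g"
      by (simp add: power2_eq_square)
    then show ?thesis
      using assms(2) by (simp add: g_def field_simps)
  qed
  \<comment> \<open>\<open>F\<close> collects the constraints already lifted; the case F = E is the
    claim.\<close>
  have "\<exists>C\<ge>0. \<forall>(x, y)\<in>A. (\<forall>f\<in>E - F. ip x f = 0) \<longrightarrow> nrm x \<le> C * nrm (y - \<zeta> *\<^sub>C x)"
    if "finite F" "F \<subseteq> E" for F
    using that
  proof (induction F rule: finite_induct)
    case empty
    then show ?case
      using start by (intro exI[of _ "1 / \<bar>Im \<zeta>\<bar>"]) auto
  next
    case (insert e F)
    then obtain C where C: "C \<ge> 0"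
      "\<And>x y. (x, y) \<in> A \<Longrightarrow> (\<forall>f\<in>E - F. ip x f = 0) \<Longrightarrow> nrm x \<le> C * nrm (y - \<zeta> *\<^sub>C x)"
      by blast
    show ?case
    proof (rule remove_constraint[OF inj, where e = e and C = C])
      show "nrm x \<le> C * nrm (y - \<zeta> *\<^sub>C x)"
        if "(x, y) \<in> A" "\<And>f. f \<in> insert e (E - insert e F) \<Longrightarrow> ip x f = 0" for x y
        using that by (intro C(2)) auto
    qed (use insert.prems E(2) C(1) in auto)
  qed
  from this[OF E(1) order_refl] show thesis
    using that by auto
qed

text \<open>A vector orthogonal to the range of \<open>A - \<zeta>\<close> is an eigenvector for cnj
  \<zeta>, so the range is dense; \<open>bounded_below\<close> makes it closed and the inverse
  bounded.\<close>

lemma nonreal_in_resolvent_set: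
  assumes "Im \<zeta> \<noteq> 0" and inj: "\<And>v. (v, \<zeta> *\<^sub>C v) \<in> A \<Longrightarrow> v = 0"
    and inj': "\<And>v. (v, cnj \<zeta> *\<^sub>C v) \<in> A \<Longrightarrow> v = 0"
  shows "\<zeta> \<in> \<rho>"
proof -
  obtain C where C: "C \<ge> 0" "\<And>x y. (x, y) \<in> A \<Longrightarrow> nrm x \<le> C * nrm (y - \<zeta> *\<^sub>C x)"
    by (rule bounded_below[OF _ assms(1)], erule inj, rule that)
  define D where "D = (\<lambda>(x, y). y - \<zeta> *\<^sub>C x) ` A"
  have D: "csubspace D"
    unfolding complex_vector.subspace_def
  proof (intro conjI ballI allI)
    show "0 \<in> D"
      unfolding D_def using A_zero by force
    fix d assume "d \<in> D"
    then obtain x y where xy: "(x, y) \<in> A" "d = y - \<zeta> *\<^sub>C x"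
      by (auto simp: D_def)
    show "c *\<^sub>C d \<in> D" for c
      unfolding D_def using A_scale[OF xy(1), of c] xy(2)
      by (intro image_eqI[of _ _ "(c *\<^sub>C x, c *\<^sub>C y)"])
        (auto simp: complex_vector.scale_right_diff_distrib scaleC_scaleC mult.commute)
    fix d' assume "d' \<in> D"
    then obtain x' y' where xy': "(x', y') \<in> A" "d' = y' - \<zeta> *\<^sub>C x'"
      by (auto simp: D_def)
    show "d + d' \<in> D"
      unfolding D_def using A_add[OF xy(1) xy'(1)] xy(2) xy'(2)
      by (intro image_eqI[of _ _ "(x + x', y + y')"]) (auto simp: scaleC_add_right)
  qed
  have DV: "D \<subseteq> V"
    unfolding D_def using A_mem by auto
  have triv: "z = 0" if z: "z \<in> V" "\<And>d. d \<in> D \<Longrightarrow> ip d z = 0" for z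
  proof (rule inj', rule A_maximal)
    fix x y assume xy: "(x, y) \<in> A"
    then have "ip (y - \<zeta> *\<^sub>C x) z = 0"
      unfolding D_def by (intro z(2)) (force simp: D_def)
    then show "ip y z = ip x (cnj \<zeta> *\<^sub>C z)"
      using A_mem[OF xy] z(1) by simp
  qed (use z in auto)
  have surj: "\<exists>k. (k, v + \<zeta> *\<^sub>C k) \<in> A" if v: "v \<in> V" for v
  proof -
    obtain G where G: "H.lim_to G v" "range G \<subseteq> D"
      by (rule dense_if_total[OF D DV triv v])
    have "\<forall>i. \<exists>x y. (x, y) \<in> A \<and> G i = y - \<zeta> *\<^sub>C x"
      using G(2) by (force simp: D_def)
    then obtain X Y where XY: "\<And>i. (X i, Y i) \<in> A" "\<And>i. G i = Y i - \<zeta> *\<^sub>C X i"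
      by metis
    have mem: "X i \<in> V" "Y i \<in> V" for i
      using A_mem[OF XY(1)[of i]] by auto
    have GV: "G i \<in> V" for i
      using G(2) DV by auto
    have est: "nrm (X i - X j) \<le> C * nrm (G i - G j)" for i j
      using C(2)[OF A_diff[OF XY(1)[of i] XY(1)[of j]]]
      by (simp add: XY(2) complex_vector.scale_right_diff_distrib algebra_simps)
    obtain l where l: "H.lim_to X l"
    proof (rule H.Cauchy_lim_to)
      show "range X \<subseteq> V"
        using mem by auto
      fix r :: real assume r: "r > 0"
      then have "r / (C + 1) > 0"
        using C(1) by simp
      then obtain M where M: "\<forall>i\<ge>M. \<forall>j\<ge>M. nrm (G i - G j) < r / (C + 1)"
        using H.lim_to_Cauchy[OF G(1)] by blast
      have "nrm (X i - X j) < r" if "i \<ge> M" "j \<ge> M" for i j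
      proof -
        have "nrm (X i - X j) \<le> C * (r / (C + 1))"
          using M that C(1) est[of i j] by (meson less_imp_le mult_left_mono order_trans)
        also have "\<dots> < r"
          using r C(1) by (simp add: field_simps)
        finally show ?thesis .
      qed
      then show "\<exists>M. \<forall>i\<ge>M. \<forall>j\<ge>M. nrm (X i - X j) < r"
        by blast
    qed
    have lV: "l \<in> V"
      using l by (simp add: H.lim_to_def)
    have "H.lim_to Y (v + \<zeta> *\<^sub>C l)"
      unfolding H.lim_to_def
    proof (intro conjI)
      show "(\<lambda>i. nrm (Y i - (v + \<zeta> *\<^sub>C l))) \<longlonglongrightarrow> 0"
      proof (rule Lim_null_comparison)
        have "nrm (Y i - (v + \<zeta> *\<^sub>C l)) \<le> nrm (G i - v) + cmod \<zeta> * nrm (X i - l)" for i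
        proof -
          have eq: "Y i - (v + \<zeta> *\<^sub>C l) = (G i - v) + \<zeta> *\<^sub>C (X i - l)"
            by (simp add: XY(2) complex_vector.scale_right_diff_distrib)
          show ?thesis
            unfolding eq using H.nrm_triangle[of "G i - v" "\<zeta> *\<^sub>C (X i - l)"] mem lV GV v by simp
        qed
        then show "\<forall>\<^sub>F i in sequentially. norm (nrm (Y i - (v + \<zeta> *\<^sub>C l))) \<le> nrm (G i - v) + cmod \<zeta> * nrm (X i - l)"
          using mem lV v by simp
        show "(\<lambda>i. nrm (G i - v) + cmod \<zeta> * nrm (X i - l)) \<longlonglongrightarrow> 0"
          using l G(1) unfolding H.lim_to_def
          by (intro tendsto_add_zero tendsto_mult_right_zero) auto
      qed
    qed (use mem lV v in auto)
    then have "(l, v + \<zeta> *\<^sub>C l) \<in> A"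
      by (rule A_closed[OF l _ XY(1)])
    then show ?thesis
      by blast
  qed
  have unique: "k = k'" if "(k, v + \<zeta> *\<^sub>C k) \<in> A" "(k', v + \<zeta> *\<^sub>C k') \<in> A" for v k k'
    using inj[of "k - k'"] A_diff[OF that] by (simp add: complex_vector.scale_right_diff_distrib)
  define R0 where "R0 v = (SOME k. (k, v + \<zeta> *\<^sub>C k) \<in> A)" for v
  have R0: "(R0 v, v + \<zeta> *\<^sub>C R0 v) \<in> A" if "v \<in> V" for v
    unfolding R0_def using surj[OF that] by (rule someI_ex)
  have R0_eq: "R0 v = k" if "(k, y) \<in> A" "y = v + \<zeta> *\<^sub>C k" "v \<in> V" for v k y
    using unique[OF R0] that by blast
  have "resolvent_rel A \<zeta> = rel_graph V R0"
  proof (rule equalityI; rule subsetI)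
    fix p assume "p \<in> resolvent_rel A \<zeta>"
    then obtain x y where "(x, y) \<in> A" "p = (y - \<zeta> *\<^sub>C x, x)"
      by (auto simp: resolvent_rel_def rel_shift_def)
    then show "p \<in> rel_graph V R0"
      using R0_eq[of x y "y - \<zeta> *\<^sub>C x"] A_mem[of x y] by (auto simp: rel_graph_def)
  next
    fix p assume "p \<in> rel_graph V R0"
    then obtain v where "v \<in> V" "p = (v, R0 v)"
      by (auto simp: rel_graph_def)
    then show "p \<in> resolvent_rel A \<zeta>"
      using R0[of v] by (force simp: resolvent_rel_def rel_shift_def)
  qed
  moreover have "bounded_op_on V ip R0"
    unfolding bounded_op_on_def clinear_on_def pnorm_def
  proof (intro conjI ballI allI)
    fix x assume x: "x \<in> V"
    show "R0 (c *\<^sub>C x) = c *\<^sub>C R0 x" for c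
      by (rule R0_eq[OF A_scale[OF R0[OF x], of c]])
        (use x in \<open>auto simp: scaleC_add_right scaleC_scaleC mult.commute\<close>)
    fix y assume y: "y \<in> V"
    show "R0 (x + y) = R0 x + R0 y"
      by (rule R0_eq[OF A_add[OF R0[OF x] R0[OF y]]]) (use x y in \<open>auto simp: scaleC_add_right\<close>)
  next
    show "R0 ` V \<subseteq> V"
      using R0 A_mem by blast
    show "\<exists>C. \<forall>x\<in>V. nrm (R0 x) \<le> C * nrm x"
      using C(2)[OF R0] by (intro exI[of _ C]) auto
  qed
  ultimately show ?thesis
    unfolding resolvent_set_def by blast
qed

text \<open>The functionals given by \<open>E\<close> have finite rank on \<open>D\<close>. The set
  \<open>B\<close> receives at most one vector per functional, chosen so that the earlier
  functionals vanish on it and the new one does not.\<close>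

lemma finite_codimension:
  assumes D: "csubspace D" "D \<subseteq> V" and "finite E" "E \<subseteq> V"
  shows "\<exists>B. finite B \<and> B \<subseteq> D \<and> (\<forall>x\<in>D. \<exists>y\<in>cspan B. \<forall>e\<in>E. ip (x - y) e = 0)"
  using assms(3,4)
proof (induction E rule: finite_induct)
  case empty
  then show ?case by auto
next
  case (insert e E)
  then obtain B where B: "finite B" "B \<subseteq> D" "\<And>x. x \<in> D \<Longrightarrow> \<exists>y\<in>cspan B. \<forall>e\<in>E. ip (x - y) e = 0"
    by blast
  have spanD: "cspan B \<subseteq> D"
    by (rule complex_vector.span_minimal[OF B(2) D(1)])
  show ?case
  proof (cases "\<exists>x\<in>D. (\<forall>e\<in>E. ip x e = 0) \<and> ip x e \<noteq> 0")
    case False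
    then have "\<forall>x\<in>D. \<exists>y\<in>cspan B. \<forall>f\<in>insert e E. ip (x - y) f = 0"
      using B(3) spanD complex_vector.subspace_diff[OF D(1)] by (metis insert_iff subsetD)
    then show ?thesis
      using B by blast
  next
    case True
    then obtain x0 where x0: "x0 \<in> D" "\<forall>e\<in>E. ip x0 e = 0" "ip x0 e \<noteq> 0"
      by blast
    have "\<exists>y\<in>cspan (insert x0 B). \<forall>f\<in>insert e E. ip (x - y) f = 0" if x: "x \<in> D" for x
    proof -
      obtain y where y: "y \<in> cspan B" "\<forall>e\<in>E. ip (x - y) e = 0"
        using B(3)[OF x] by blast
      define c where "c = ip (x - y) e / ip x0 e"
      have mem: "x \<in> V" "y \<in> V" "x0 \<in> V" "e \<in> V" "E \<subseteq> V"
        using x y x0 D(2) spanD insert.prems by auto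
      have "y + c *\<^sub>C x0 \<in> cspan (insert x0 B)"
        using y(1) complex_vector.span_mono[of B "insert x0 B"]
        by (intro complex_vector.span_add complex_vector.span_scale)
          (auto intro: complex_vector.span_base)
      moreover have "x - (y + c *\<^sub>C x0) = (x - y) - c *\<^sub>C x0"
        by simp
      then have "\<forall>f\<in>insert e E. ip (x - (y + c *\<^sub>C x0)) f = 0"
        using mem x0 y(2) subsetD[OF mem(5)] by (auto simp: c_def simp del: diff_diff_add)
      ultimately show ?thesis
        by blast
    qed
    then show ?thesis
      using B(1,2) x0(1) by (intro exI[of _ "insert x0 B"]) auto
  qed
qed

text \<open>Eigenvectors for the eigenvalues of a set disjoint from its conjugate span a neutral
  subspace, on which the Garding inequality bounds the norm by finitely many functionals.\<close>

lemma finite_eigenvalues: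
  assumes "\<zeta>\<^sub>0 \<in> \<rho>" and L: "\<And>\<alpha> \<beta>. \<alpha> \<in> L \<Longrightarrow> \<beta> \<in> L \<Longrightarrow> \<alpha> \<noteq> cnj \<beta>"
    and eig: "\<And>\<alpha>. \<alpha> \<in> L \<Longrightarrow> \<exists>v. v \<noteq> 0 \<and> (v, \<alpha> *\<^sub>C v) \<in> A"
  shows "finite L"
proof -
  obtain v where v: "\<And>\<alpha>. \<alpha> \<in> L \<Longrightarrow> v \<alpha> \<noteq> 0" "\<And>\<alpha>. \<alpha> \<in> L \<Longrightarrow> (v \<alpha>, \<alpha> *\<^sub>C v \<alpha>) \<in> A"
    using eig by metis
  have vV: "v \<alpha> \<in> V" if "\<alpha> \<in> L" for \<alpha>
    using A_mem v(2)[OF that] by blast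
  have ne: "\<alpha> - \<zeta>\<^sub>0 \<noteq> 0" if "\<alpha> \<in> L" for \<alpha>
    using eigenvalue_not_resolvent[OF v(2)[OF that]] v(1)[OF that] assms(1) by auto
  \<comment> \<open>\<open>A\<close> may be multivalued, so eigenvectors are separated with the
    everywhere defined operator \<open>R \<zeta>\<^sub>0\<close>, for which
    \<open>v \<alpha>\<close> has the eigenvalue
    \<open>1 / (\<alpha> - \<zeta>\<^sub>0)\<close>.\<close>
  have Rv: "R \<zeta>\<^sub>0 (v \<alpha>) = (1 / (\<alpha> - \<zeta>\<^sub>0)) *\<^sub>C v \<alpha>" if "\<alpha> \<in> L" for \<alpha>
  proof -
    have "(1 / (\<alpha> - \<zeta>\<^sub>0)) *\<^sub>C (\<alpha> - \<zeta>\<^sub>0) *\<^sub>C R \<zeta>\<^sub>0 (v \<alpha>) = (1 / (\<alpha> - \<zeta>\<^sub>0)) *\<^sub>C v \<alpha>"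
      using resolvent_op_eigenvector[OF v(2)[OF that] assms(1)] by simp
    then show ?thesis
      using ne[OF that] by (simp add: scaleC_scaleC scaleC_one)
  qed
  have indep: "\<forall>\<alpha>\<in>T. u \<alpha> = 0" if "finite T" "T \<subseteq> L" "(\<Sum>\<alpha>\<in>T. u \<alpha> *\<^sub>C v \<alpha>) = 0" for T u
    using that
  proof (induction T arbitrary: u rule: finite_induct)
    case (insert \<beta> T)
    have mem: "u \<alpha> *\<^sub>C v \<alpha> \<in> V" if "\<alpha> \<in> insert \<beta> T" for \<alpha>
      using vV insert.prems that by auto
    have "0 = R \<zeta>\<^sub>0 (\<Sum>\<alpha>\<in>insert \<beta> T. u \<alpha> *\<^sub>C v \<alpha>)"
      using insert.prems resolvent_op_zero[OF assms(1)] by simp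
    also have "\<dots> = (\<Sum>\<alpha>\<in>insert \<beta> T. R \<zeta>\<^sub>0 (u \<alpha> *\<^sub>C v \<alpha>))"
      by (rule resolvent_op_sum[OF assms(1) mem])
    also have "\<dots> = (\<Sum>\<alpha>\<in>insert \<beta> T. (u \<alpha> / (\<alpha> - \<zeta>\<^sub>0)) *\<^sub>C v \<alpha>)"
      using insert.prems vV assms(1) Rv
      by (intro sum.cong) (auto simp: resolvent_op_scale scaleC_scaleC)
    finally have 1: "(u \<beta> / (\<beta> - \<zeta>\<^sub>0)) *\<^sub>C v \<beta> + (\<Sum>\<alpha>\<in>T. (u \<alpha> / (\<alpha> - \<zeta>\<^sub>0)) *\<^sub>C v \<alpha>) = 0"
      using insert.hyps by simp
    have "(1 / (\<beta> - \<zeta>\<^sub>0)) *\<^sub>C (u \<beta> *\<^sub>C v \<beta> + (\<Sum>\<alpha>\<in>T. u \<alpha> *\<^sub>C v \<alpha>)) = 0"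
      using insert by simp
    then have 2: "(u \<beta> / (\<beta> - \<zeta>\<^sub>0)) *\<^sub>C v \<beta> + (\<Sum>\<alpha>\<in>T. (u \<alpha> / (\<beta> - \<zeta>\<^sub>0)) *\<^sub>C v \<alpha>) = 0"
      by (simp add: scaleC_add_right complex_vector.scale_sum_right scaleC_scaleC)
    have "(\<Sum>\<alpha>\<in>T. (u \<alpha> / (\<alpha> - \<zeta>\<^sub>0) - u \<alpha> / (\<beta> - \<zeta>\<^sub>0)) *\<^sub>C v \<alpha>) = 0"
      using trans[OF 1 2[symmetric]]
      by (simp only: add_left_cancel complex_vector.scale_left_diff_distrib sum_subtractf diff_self)
    then have "\<forall>\<alpha>\<in>T. u \<alpha> / (\<alpha> - \<zeta>\<^sub>0) - u \<alpha> / (\<beta> - \<zeta>\<^sub>0) = 0"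
      by (rule insert.IH[rotated]) (use insert.prems in auto)
    moreover have "\<alpha> = \<beta>" if "\<alpha> \<in> T" "u \<alpha> / (\<alpha> - \<zeta>\<^sub>0) - u \<alpha> / (\<beta> - \<zeta>\<^sub>0) = 0" "u \<alpha> \<noteq> 0" for \<alpha>
      using that ne[of \<alpha>] ne[of \<beta>] insert.prems by (simp add: field_simps)
    ultimately have uT: "\<forall>\<alpha>\<in>T. u \<alpha> = 0"
      using insert.hyps by blast
    then have "(\<Sum>\<alpha>\<in>T. u \<alpha> *\<^sub>C v \<alpha>) = 0"
      by (intro sum.neutral) simp
    then have "u \<beta> *\<^sub>C v \<beta> = 0"
      using insert by simp
    then have "u \<beta> = 0"
      using v(1)[of \<beta>] insert.prems by (auto simp: complex_vector.scale_eq_0_iff)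
    then show ?case
      using uT by simp
  qed simp
  have injv: "inj_on v L"
  proof (rule inj_onI, rule ccontr)
    fix \<alpha> \<beta> assume *: "\<alpha> \<in> L" "\<beta> \<in> L" "v \<alpha> = v \<beta>" "\<alpha> \<noteq> \<beta>"
    have "\<forall>\<gamma>\<in>{\<alpha>, \<beta>}. (if \<gamma> = \<alpha> then 1 else - 1 :: complex) = 0"
      by (rule indep) (use * in \<open>auto simp: complex_vector.scale_minus_left\<close>)
    then show False
      by simp
  qed
  have independent: "\<not> complex_vector.dependent (v ` L)"
  proof
    assume "complex_vector.dependent (v ` L)"
    then obtain t u where tu: "finite t" "t \<subseteq> v ` L" "(\<Sum>w\<in>t. u w *\<^sub>C w) = 0" "\<exists>w\<in>t. u w \<noteq> 0"
      unfolding complex_vector.dependent_explicit by blast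
    obtain T where T: "T \<subseteq> L" "finite T" "t = v ` T"
      using tu(1,2) by (metis finite_subset_image)
    have "(\<Sum>\<alpha>\<in>T. u (v \<alpha>) *\<^sub>C v \<alpha>) = 0"
      using tu(3) T injv by (simp add: sum.reindex inj_on_subset)
    then have "\<forall>\<alpha>\<in>T. u (v \<alpha>) = 0"
      by (rule indep[OF T(2,1)])
    then show False
      using tu(4) T(3) by auto
  qed
  define D where "D = cspan (v ` L)"
  have D: "csubspace D" "D \<subseteq> V"
    unfolding D_def using vV by (auto intro!: complex_vector.subspace_span cspan_subset)
  have gen_orth: "ip (v \<alpha>) (v \<beta>) = 0" if "\<alpha> \<in> L" "\<beta> \<in> L" for \<alpha> \<beta>
  proof -
    have "(\<alpha> - cnj \<beta>) * ip (v \<alpha>) (v \<beta>) = 0"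
      using A_symmetric[OF v(2)[OF that(1)] v(2)[OF that(2)]] vV that by (simp add: algebra_simps)
    then show ?thesis
      using L[OF that] by auto
  qed
  have orth1: "ip x (v \<beta>) = 0" if "x \<in> D" "\<beta> \<in> L" for x \<beta>
    by (rule orthogonal_cspan[of "v ` L"]) (use that vV gen_orth in \<open>auto simp: D_def\<close>)
  have neutral: "ip x x = 0" if x: "x \<in> D" for x
  proof (rule orthogonal_cspan[of "v ` L"])
    fix d assume "d \<in> v ` L"
    then show "ip d x = 0"
      using orth1[OF x] commute[of x d] x D(2) vV by auto
  qed (use x D vV in \<open>auto simp: D_def\<close>)
  obtain E where E: "finite E" "E \<subseteq> V"
    and gard: "\<And>x. x \<in> V \<Longrightarrow> (nrm x)\<^sup>2 \<le> Re (ip x x) + 2 * (\<Sum>e\<in>E. (cmod (ip x e))\<^sup>2)"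
    using garding by blast
  obtain B where B: "finite B" "B \<subseteq> D" "\<forall>x\<in>D. \<exists>y\<in>cspan B. \<forall>e\<in>E. ip (x - y) e = 0"
    using finite_codimension[OF D E] by blast
  have "D \<subseteq> cspan B"
  proof
    fix x assume x: "x \<in> D"
    then obtain y where y: "y \<in> cspan B" "\<forall>e\<in>E. ip (x - y) e = 0"
      using B(3) by blast
    have yD: "y \<in> D"
      using y(1) complex_vector.span_minimal[OF B(2) D(1)] by blast
    then have xy: "x - y \<in> D" "x - y \<in> V"
      using x D complex_vector.subspace_diff[OF D(1)] by auto
    have "(nrm (x - y))\<^sup>2 \<le> 0"
      using gard[OF xy(2)] neutral[OF xy(1)] y(2) by simp
    then have "nrm (x - y) = 0"
      by simp
    then have "x - y = 0"
      using H.nrm_eq_0_iff[OF xy(2)] by blast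
    then show "x \<in> cspan B"
      using y(1) by simp
  qed
  then have "finite (v ` L)"
    using complex_vector.independent_span_bound[OF B(1) independent] complex_vector.span_superset[of "v ` L"]
    unfolding D_def by blast
  then show ?thesis
    using injv by (rule finite_imageD)
qed

text \<open>\<open>L s\<close> consists of eigenvalues in one open half-plane, hence contains no
  conjugate pair, as \<open>finite_eigenvalues\<close> requires. A nonreal point outside \<rho> is
  an eigenvalue or the conjugate of one.\<close>

lemma finite_nonreal_spectrum:
  assumes "\<zeta>\<^sub>0 \<in> \<rho>"
  shows "finite (- \<real> - \<rho>)"
proof -
  define L where "L s = {\<alpha>. s * Im \<alpha> > 0 \<and> (\<exists>v. v \<noteq> 0 \<and> (v, \<alpha> *\<^sub>C v) \<in> A)}" for s :: real
  have fin: "finite (L s)" for s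
  proof (rule finite_eigenvalues[OF assms])
    fix \<alpha> \<beta> assume "\<alpha> \<in> L s" "\<beta> \<in> L s"
    then show "\<alpha> \<noteq> cnj \<beta>"
      by (auto simp: L_def)
  qed (auto simp: L_def)
  have "- \<real> - \<rho> \<subseteq> (L 1 \<union> L (-1)) \<union> cnj ` (L 1 \<union> L (-1))"
  proof
    fix \<zeta> assume z: "\<zeta> \<in> - \<real> - \<rho>"
    then have im: "Im \<zeta> \<noteq> 0"
      by (auto simp: complex_is_Real_iff)
    then consider v where "v \<noteq> 0" "(v, \<zeta> *\<^sub>C v) \<in> A" | v where "v \<noteq> 0" "(v, cnj \<zeta> *\<^sub>C v) \<in> A"
      using nonreal_in_resolvent_set[OF im] z by blast
    then show "\<zeta> \<in> (L 1 \<union> L (-1)) \<union> cnj ` (L 1 \<union> L (-1))"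
    proof cases
      case 1
      then show ?thesis
        using im by (auto simp: L_def)
    next
      case 2
      then have "cnj \<zeta> \<in> L 1 \<union> L (-1)"
        using im by (auto simp: L_def)
      then have "cnj (cnj \<zeta>) \<in> cnj ` (L 1 \<union> L (-1))"
        by (rule imageI)
      then show ?thesis
        by simp
    qed
  qed
  then show ?thesis
    using fin by (meson finite_UnI finite_imageI finite_subset)
qed

subsection \<open>Analytic continuation of resolvent pairings\<close>

text \<open>The resolvent identity expresses \<open>R \<mu>\<close> through \<open>R \<zeta>\<close>
  and a term with factor \<mu> - \<zeta>; below the radius 1 / (2 * C) that term is absorbed by half
  of the left-hand side.\<close>

lemma resolvent_op_locally_bounded:
  assumes "\<zeta> \<in> \<rho>"
  obtains C \<epsilon> where "\<epsilon> > 0" "C > 0"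
    "\<And>\<mu> x. \<mu> \<in> \<rho> \<Longrightarrow> cmod (\<mu> - \<zeta>) < \<epsilon> \<Longrightarrow> x \<in> V \<Longrightarrow> nrm (R \<mu> x) \<le> C * nrm x"
proof -
  obtain C where C: "C > 0" "\<And>x. x \<in> V \<Longrightarrow> nrm (R \<zeta> x) \<le> C * nrm x"
    by (rule resolvent_op_bounded[OF assms]) blast
  have "nrm (R \<mu> x) \<le> 2 * C * nrm x" if "\<mu> \<in> \<rho>" "cmod (\<mu> - \<zeta>) < 1 / (2 * C)" "x \<in> V" for \<mu> x
  proof -
    have "R \<mu> x = R \<zeta> x + (\<mu> - \<zeta>) *\<^sub>C R \<zeta> (R \<mu> x)"
      using resolvent_identity[OF assms that(1,3)] by (simp add: algebra_simps complex_vector.scale_left_diff_distrib)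
    then have "nrm (R \<mu> x) \<le> nrm (R \<zeta> x) + cmod (\<mu> - \<zeta>) * nrm (R \<zeta> (R \<mu> x))"
      using H.nrm_triangle[of "R \<zeta> x" "(\<mu> - \<zeta>) *\<^sub>C R \<zeta> (R \<mu> x)"] that assms by simp
    also have "\<dots> \<le> C * nrm x + 1 / (2 * C) * (C * nrm (R \<mu> x))"
      using C that assms by (intro add_mono mult_mono) auto
    finally show ?thesis
      using C(1) by (simp add: field_simps)
  qed
  then show thesis
    using that[of "1 / (2 * C)" "2 * C"] C(1) by simp
qed

lemma resolvent_pairing_continuous:
  assumes "a \<in> V" "b \<in> V"
  shows "continuous_on \<rho> (\<lambda>\<mu>. ip (R \<mu> a) b)"
  unfolding continuous_on_def
proof
  fix \<zeta> assume z: "\<zeta> \<in> \<rho>"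
  obtain C \<epsilon> where C: "\<epsilon> > 0" "C > 0"
    "\<And>\<mu> x. \<mu> \<in> \<rho> \<Longrightarrow> cmod (\<mu> - \<zeta>) < \<epsilon> \<Longrightarrow> x \<in> V \<Longrightarrow> nrm (R \<mu> x) \<le> C * nrm x"
    by (rule resolvent_op_locally_bounded[OF z]) blast
  show "((\<lambda>\<mu>. ip (R \<mu> a) b) \<longlongrightarrow> ip (R \<zeta> a) b) (at \<zeta> within \<rho>)"
  proof (rule LIM_zero_cancel, rule Lim_null_comparison)
    let ?g = "\<lambda>\<mu>. cmod (\<mu> - \<zeta>) * (C * nrm (R \<zeta> a) * nrm b)"
    show "\<forall>\<^sub>F \<mu> in at \<zeta> within \<rho>. norm (ip (R \<mu> a) b - ip (R \<zeta> a) b) \<le> ?g \<mu>"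
      unfolding eventually_at
    proof (intro exI[of _ \<epsilon>] conjI ballI impI C(1))
      fix \<mu> assume mu: "\<mu> \<in> \<rho>" "\<mu> \<noteq> \<zeta> \<and> dist \<mu> \<zeta> < \<epsilon>"
      have "ip (R \<mu> a) b - ip (R \<zeta> a) b = ip (R \<mu> a - R \<zeta> a) b"
        using assms mu z by simp
      also have "\<dots> = (\<mu> - \<zeta>) * ip (R \<mu> (R \<zeta> a)) b"
        using resolvent_identity[OF mu(1) z assms(1)] assms mu z by simp
      also have "norm \<dots> \<le> ?g \<mu>"
        unfolding norm_mult
      proof (intro mult_left_mono)
        have "cmod (ip (R \<mu> (R \<zeta> a)) b) \<le> nrm (R \<mu> (R \<zeta> a)) * nrm b"
          using assms mu z by (intro ip_bounded) auto
        also have "\<dots> \<le> C * nrm (R \<zeta> a) * nrm b"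
          using assms mu z by (intro mult_right_mono C(3)) (auto simp: dist_norm)
        finally show "cmod (ip (R \<mu> (R \<zeta> a)) b) \<le> C * nrm (R \<zeta> a) * nrm b" .
      qed simp
      finally show "norm (ip (R \<mu> a) b - ip (R \<zeta> a) b) \<le> ?g \<mu>" .
    qed
    have "((\<lambda>\<mu>. cmod (\<mu> - \<zeta>)) \<longlongrightarrow> 0) (at \<zeta> within \<rho>)"
      by (intro tendsto_norm_zero LIM_zero tendsto_ident_at)
    then show "(?g \<longlongrightarrow> 0) (at \<zeta> within \<rho>)"
      by (rule tendsto_mult_left_zero)
  qed
qed

text \<open>By the resolvent identity the difference quotient is
  \<open>ip (R \<mu> (R \<zeta> a)) b\<close>, so continuity of such pairings already yields the
  derivative.\<close>

lemma resolvent_pairing_holomorphic: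
  assumes "\<zeta>\<^sub>0 \<in> \<rho>" "a \<in> V" "b \<in> V"
  shows "(\<lambda>\<mu>. ip (R \<mu> a) b) holomorphic_on (\<rho> - \<real>)"
proof (rule holomorphic_onI)
  fix \<zeta> assume z: "\<zeta> \<in> \<rho> - \<real>"
  have "((\<lambda>\<mu>. ip (R \<mu> a) b) has_field_derivative ip (R \<zeta> (R \<zeta> a)) b) (at \<zeta> within (\<rho> - \<real>))"
    unfolding has_field_derivative_iff
  proof (rule Lim_transform_eventually)
    have "((\<lambda>\<mu>. ip (R \<mu> (R \<zeta> a)) b) \<longlongrightarrow> ip (R \<zeta> (R \<zeta> a)) b) (at \<zeta> within \<rho>)"
      using resolvent_pairing_continuous[of "R \<zeta> a" b] assms z by (auto simp: continuous_on_def)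
    then show "((\<lambda>\<mu>. ip (R \<mu> (R \<zeta> a)) b) \<longlongrightarrow> ip (R \<zeta> (R \<zeta> a)) b) (at \<zeta> within \<rho> - \<real>)"
      by (rule tendsto_within_subset) auto
    show "\<forall>\<^sub>F \<mu> in at \<zeta> within \<rho> - \<real>.
        ip (R \<mu> (R \<zeta> a)) b = (ip (R \<mu> a) b - ip (R \<zeta> a) b) / (\<mu> - \<zeta>)"
      unfolding eventually_at_filter
    proof (intro always_eventually allI impI)
      fix \<mu> assume mu: "\<mu> \<noteq> \<zeta>" "\<mu> \<in> \<rho> - \<real>"
      have "ip (R \<mu> a) b - ip (R \<zeta> a) b = ip (R \<mu> a - R \<zeta> a) b"
        using assms mu z by simp
      also have "\<dots> = (\<mu> - \<zeta>) * ip (R \<mu> (R \<zeta> a)) b"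
        using resolvent_identity[of \<mu> \<zeta> a] assms mu z by simp
      finally show "ip (R \<mu> (R \<zeta> a)) b = (ip (R \<mu> a) b - ip (R \<zeta> a) b) / (\<mu> - \<zeta>)"
        using mu(1) by simp
    qed
  qed
  then show "(\<lambda>\<mu>. ip (R \<mu> a) b) field_differentiable at \<zeta> within \<rho> - \<real>"
    unfolding field_differentiable_def by blast
qed

text \<open>Deleting the finite nonreal spectrum from a half-plane leaves an open connected set, to
  which the identity theorem applies. The sign of \<open>s\<close> selects the half-plane, so that
  one proof serves both.\<close>

lemma continuation_half_plane:
  assumes "\<zeta>\<^sub>0 \<in> \<rho>" and hol: "\<phi> holomorphic_on (\<rho> - \<real>)" and s: "s \<noteq> (0::real)"
    and U: "open U" "U \<noteq> {}" "\<And>z. z \<in> U \<Longrightarrow> s * Im z > 0" "\<And>z. z \<in> U \<Longrightarrow> z \<in> \<rho> \<Longrightarrow> \<phi> z = 0"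
    and w: "w \<in> \<rho>" "s * Im w > 0"
  shows "\<phi> w = 0"
proof -
  define S where "S = {z. s * Im z > 0} - (- \<real> - \<rho>)"
  have fin: "finite (- \<real> - \<rho>)"
    by (rule finite_nonreal_spectrum[OF assms(1)])
  have half: "{z. s * Im z > 0} = {z. (s * \<i>) \<bullet> z > 0}"
    by (auto simp: inner_complex_def)
  have opn: "open {z. s * Im z > 0}"
    unfolding half by (rule open_halfspace_gt)
  have conn: "connected {z. s * Im z > 0}"
    unfolding half by (intro convex_connected convex_halfspace_gt)
  have S: "open S" "connected S"
    unfolding S_def using opn conn fin
    by (auto intro!: open_Diff finite_imp_closed connected_open_delete_finite simp: DIM_complex)
  have SR: "S \<subseteq> \<rho> - \<real>"
    using s by (auto simp: S_def complex_is_Real_iff)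
  have "open (U - (- \<real> - \<rho>))"
    using U(1) fin by (intro open_Diff finite_imp_closed)
  moreover have "infinite U"
    using U(1,2) by (metis finite_imp_not_open)
  then have "U - (- \<real> - \<rho>) \<noteq> {}"
    using fin by (metis finite.emptyI finite_Diff2)
  then obtain \<xi> where xi: "\<xi> \<in> U - (- \<real> - \<rho>)"
    by blast
  ultimately have "\<xi> islimpt (U - (- \<real> - \<rho>))"
    using interior_limit_point[of \<xi> "U - (- \<real> - \<rho>)"] interior_open by metis
  moreover have "U - (- \<real> - \<rho>) \<subseteq> S"
    using U(3) by (auto simp: S_def)
  moreover have "w \<in> S"
    using w by (auto simp: S_def)
  ultimately show ?thesis
    using analytic_continuation[of \<phi> S "U - (- \<real> - \<rho>)" \<xi> w] holomorphic_on_subset[OF hol SR] S xi U(3,4) SR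
    by blast
qed

text \<open>The half-planes are treated separately, since \<rho> need not contain real points
  joining them. Real points of \<rho> are then reached by continuity, along a vertical sequence of
  nonreal points.\<close>

lemma continuation:
  assumes "\<zeta>\<^sub>0 \<in> \<rho>" and hol: "\<phi> holomorphic_on (\<rho> - \<real>)" and cont: "continuous_on \<rho> \<phi>"
    and U: "open U" "U \<noteq> {}" "\<And>z. z \<in> U \<Longrightarrow> Im z > 0" "\<And>z. z \<in> U \<Longrightarrow> z \<in> \<rho> \<Longrightarrow> \<phi> z = 0"
    and U': "open U'" "U' \<noteq> {}" "\<And>z. z \<in> U' \<Longrightarrow> Im z < 0" "\<And>z. z \<in> U' \<Longrightarrow> z \<in> \<rho> \<Longrightarrow> \<phi> z = 0"
    and w: "w \<in> \<rho>"
  shows "\<phi> w = 0"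
proof -
  have nonreal: "\<phi> w = 0" if "w \<in> \<rho>" "Im w \<noteq> 0" for w
  proof (cases "Im w > 0")
    case True
    then show ?thesis
      using continuation_half_plane[OF assms(1) hol _ U(1,2), of 1] U(3,4) that by auto
  next
    case False
    then show ?thesis
      using continuation_half_plane[OF assms(1) hol _ U'(1,2), of "-1"] U'(3,4) that by auto
  qed
  show ?thesis
  proof (cases "Im w = 0")
    case True
    define X where "X n = w + \<i> * of_real (1 / real (Suc n))" for n
    have X: "X \<longlonglongrightarrow> w"
      unfolding X_def using tendsto_add[OF tendsto_const tendsto_mult[OF tendsto_const tendsto_of_real[OF LIMSEQ_Suc[OF lim_1_over_n]]], of w \<i>]
      by simp
    have injX: "inj X"
      by (auto simp: X_def inj_on_def)
    have ImX: "Im (X n) \<noteq> 0" for n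
      using True by (simp add: X_def)
    \<comment> \<open>An injective sequence meets a finite set only finitely often.\<close>
    have "finite (X -` (- \<real> - \<rho>))"
      using finite_nonreal_spectrum[OF assms(1)] injX by (rule finite_vimageI)
    then have "\<forall>\<^sub>F n in sequentially. n \<notin> X -` (- \<real> - \<rho>)"
      by (simp add: eventually_cofinite vimage_def flip: cofinite_eq_sequentially)
    then have ev: "\<forall>\<^sub>F n in sequentially. X n \<in> \<rho>"
      by (rule eventually_mono) (use ImX in \<open>auto simp: complex_is_Real_iff\<close>)
    have "(\<lambda>n. \<phi> (X n)) \<longlonglongrightarrow> \<phi> w"
      by (rule continuous_on_tendsto_compose[OF cont X w ev])
    moreover have "\<forall>\<^sub>F n in sequentially. \<phi> (X n) = 0"
      using ev by (rule eventually_mono) (use nonreal ImX in blast)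
    ultimately show ?thesis
      using LIMSEQ_unique[OF _ tendsto_eventually] by blast
  qed (use nonreal w in blast)
qed

end

section \<open>Adjoints and inverses of bounded operators\<close>

lemma form_norm_cinner [simp]: "form_norm cinner = norm"
  by (simp add: fun_eq_iff form_norm_def Re_cinner norm_eq_sqrt_inner)

text \<open>Puts the coefficient space under the lemmas for carrier sets; its Riesz representation
  supplies the adjoints.\<close>

interpretation cinner: hilbert_carrier "UNIV :: 'g::complex_hilbert_space set" cinner
  rewrites "form_norm cinner = (norm :: 'g \<Rightarrow> real)"
proof -
  show "hilbert_carrier (UNIV :: 'g set) cinner"
    unfolding hilbert_carrier_def hilbert_on_def
  proof (intro conjI ballI impI allI)
    show "hermitian_form_on (UNIV :: 'g set) cinner"
      unfolding hermitian_form_on_def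
      using cinner_add_left cinner_scaleC_left cinner_commute by blast
    show "0 < Re (cinner x x)" if "x \<noteq> 0" for x :: 'g
      using that by (simp add: Re_cinner)
    fix X :: "nat \<Rightarrow> 'g"
    assume X: "range X \<subseteq> UNIV \<and> (\<forall>e>0. \<exists>M. \<forall>i\<ge>M. \<forall>j\<ge>M. form_norm cinner (X i - X j) < e)"
    have "Cauchy X"
      unfolding Cauchy_def using X by (simp add: dist_norm)
    then obtain l where "X \<longlonglongrightarrow> l"
      using Cauchy_convergent convergent_def by blast
    then have "(\<lambda>i. norm (X i - l)) \<longlonglongrightarrow> 0"
      by (intro tendsto_norm_zero LIM_zero)
    then show "\<exists>l\<in>UNIV. (\<lambda>i. form_norm cinner (X i - l)) \<longlonglongrightarrow> 0"
      by auto
  qed (simp add: complex_vector.subspace_UNIV)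
qed simp

lemma cinner_ext: "(\<And>x. cinner x a = cinner x b) \<Longrightarrow> a = (b :: 'g::complex_hilbert_space)"
  using cinner_self[of "a - b"] by (simp add: cinner.diff_right)

lemma scale_op_apply [simp]: "blinfun_apply (scale_op c) x = c *\<^sub>C x"
  unfolding scale_op_def by (simp add: bounded_linear_Blinfun_apply bounded_linear_scaleC)

lemma clinear_opD:
  assumes "clinear_op T"
  shows "blinfun_apply T (x + y) = blinfun_apply T x + blinfun_apply T y"
    "blinfun_apply T (c *\<^sub>C x) = c *\<^sub>C blinfun_apply T x"
  using assms by (auto simp: clinear_op_def clinear_on_def)

text \<open>\<open>op_adj\<close> is a definite description. The Riesz lemma, applied for fixed
  \<open>y\<close> to the functional that pairs \<open>T x\<close> with \<open>y\<close>, provides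
  the value at \<open>y\<close>; pairing that value with itself gives the bound by
  \<open>norm T\<close>.\<close>

lemma op_adj:
  fixes T :: "'g::complex_hilbert_space \<Rightarrow>\<^sub>L 'g"
  assumes "clinear_op T"
  shows "cinner (blinfun_apply T x) y = cinner x (blinfun_apply (op_adj T) y)"
proof -
  have "\<exists>z. \<forall>x. cinner (blinfun_apply T x) y = cinner x z" for y
  proof -
    have *: "cmod (cinner (blinfun_apply T x) y) \<le> (norm T * norm y) * norm x" for x
      using cinner.Cauchy_Schwarz[of "blinfun_apply T x" y] norm_blinfun[of T x]
      by (smt (verit) UNIV_I mult.assoc mult.commute mult_right_mono norm_ge_zero)
    obtain z where "\<And>x. cinner (blinfun_apply T x) y = cinner x z"
    proof (rule cinner.Riesz[of "\<lambda>x. cinner (blinfun_apply T x) y" "norm T * norm y"])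
      show "cmod (cinner (blinfun_apply T x) y) \<le> (norm T * norm y) * norm x" for x
        by (rule *)
    qed (auto simp: clinear_opD[OF assms])
    then show ?thesis by blast
  qed
  then obtain z where z: "\<And>x y. cinner (blinfun_apply T x) y = cinner x (z y)"
    by metis
  have "bounded_linear z"
  proof (rule bounded_linear_intro[where K = "norm T"])
    show "z (x + y) = z x + z y" for x y
      by (rule cinner_ext) (simp add: z[symmetric] cinner.add_right)
    show "z (r *\<^sub>R x) = r *\<^sub>R z x" for r x
      by (rule cinner_ext) (simp add: z[symmetric] scaleR_eq_scaleC cinner.scale_right)
    show "norm (z y) \<le> norm y * norm T" for y
    proof (cases "z y = 0")
      case False
      have "(norm (z y))\<^sup>2 = cmod (cinner (blinfun_apply T (z y)) y)"
        unfolding z cinner_self by (simp add: norm_power)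
      also have "\<dots> \<le> norm (blinfun_apply T (z y)) * norm y"
        using cinner.Cauchy_Schwarz by simp
      also have "\<dots> \<le> norm T * norm (z y) * norm y"
        by (intro mult_right_mono norm_blinfun) auto
      finally show ?thesis
        using False by (simp add: power2_eq_square mult.commute mult.left_commute)
    qed simp
  qed
  then have "\<forall>x y. cinner (blinfun_apply T x) y = cinner x (blinfun_apply (Blinfun z) y)"
    by (simp add: bounded_linear_Blinfun_apply z)
  then have "\<forall>x y. cinner (blinfun_apply T x) y = cinner x (blinfun_apply (op_adj T) y)"
    unfolding op_adj_def
  proof (rule theI)
    fix T' assume T': "\<forall>x y. cinner (blinfun_apply T x) y = cinner x (blinfun_apply T' y)"
    show "T' = Blinfun z"
    proof (rule blinfun_eqI, rule cinner_ext)
      fix y x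
      show "cinner x (blinfun_apply T' y) = cinner x (blinfun_apply (Blinfun z) y)"
        unfolding bounded_linear_Blinfun_apply[OF \<open>bounded_linear z\<close>] z[symmetric] using T' by simp
    qed
  qed
  then show ?thesis
    by blast
qed

text \<open>The Riesz lemma in the coefficient space, applied to the pairing of \<open>g x\<close>
  with \<open>v\<close>, shows that the description in \<open>padj\<close> denotes.\<close>

lemma (in pontryagin_carrier) cinner_padj:
  fixes g :: "'g::complex_hilbert_space \<Rightarrow> 'v"
  assumes lin: "clinear_on UNIV g" and g: "range g \<subseteq> V" and C: "\<And>x. nrm (g x) \<le> C * norm x"
    and v: "v \<in> V"
  shows "cinner (padj ip g v) x = ip v (g x)"
proof -
  have mem: "g x \<in> V" for x
    using g by blast
  have bound: "cmod (ip (g x) v) \<le> (C * nrm v) * norm x" for x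
  proof -
    have "cmod (ip (g x) v) \<le> nrm (g x) * nrm v"
      by (rule ip_bounded[OF mem v])
    also have "\<dots> \<le> C * norm x * nrm v"
      using C v by (intro mult_right_mono) auto
    finally show ?thesis
      by (simp add: mult.commute mult.left_commute)
  qed
  obtain y where y: "\<And>x. ip (g x) v = cinner x y"
  proof (rule cinner.Riesz[of "\<lambda>x. ip (g x) v" "C * nrm v"])
    show "ip (g (x + y)) v = ip (g x) v + ip (g y) v" "ip (g (c *\<^sub>C x)) v = c * ip (g x) v" for x y c
      using lin mem v by (simp_all add: clinear_on_def)
  qed (use bound in auto)
  have y': "cinner y x = ip v (g x)" for x
    using y[of x] commute[OF mem v] cinner_commute[of x y] by simp
  have "padj ip g v = y"
    unfolding padj_def
  proof (rule the_equality)
    fix z assume z: "\<forall>x. cinner z x = ip v (g x)"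
    show "z = y"
      by (rule cinner_ext) (metis z y' cinner_commute)
  qed (use y' in simp)
  then show ?thesis
    using y' by simp
qed

lemma scale_op_add: "scale_op (a + b) = scale_op a + scale_op b"
  by (rule blinfun_eqI) (simp add: scaleC_add_left blinfun.add_left)

lemma bounded_linear_scale_op: "bounded_linear (scale_op :: complex \<Rightarrow> 'g::complex_hilbert_space \<Rightarrow>\<^sub>L 'g)"
proof (rule bounded_linear_intro[where K = 1])
  show "scale_op (r *\<^sub>R c) = r *\<^sub>R (scale_op c :: 'g \<Rightarrow>\<^sub>L 'g)" for r c
    by (rule blinfun_eqI) (simp add: blinfun.scaleR_left scaleR_eq_scaleC scaleC_scaleC scaleC_complex_def)
  show "norm (scale_op c :: 'g \<Rightarrow>\<^sub>L 'g) \<le> norm c * 1" for c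
    by (rule norm_blinfun_bound) (simp_all add: norm_scaleC)
qed (rule scale_op_add)

lemma bounded_linear_scale_op_compose:
  "bounded_linear (\<lambda>h. scale_op h o\<^sub>L (D :: 'g::complex_hilbert_space \<Rightarrow>\<^sub>L 'g))"
  by (rule bounded_linear_compose[OF
        bounded_bilinear.bounded_linear_left[OF bounded_bilinear_blinfun_compose] bounded_linear_scale_op])

lemma op_inv:
  assumes "op_invertible T"
  shows "op_inv T o\<^sub>L T = id_blinfun" "T o\<^sub>L op_inv T = id_blinfun"
proof -
  have "op_inv T o\<^sub>L T = id_blinfun \<and> T o\<^sub>L op_inv T = id_blinfun"
    unfolding op_inv_def
  proof (rule theI')
    obtain R where R: "R o\<^sub>L T = id_blinfun" "T o\<^sub>L R = id_blinfun"
      using assms by (auto simp: op_invertible_def)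
    have "S = R" if "S o\<^sub>L T = id_blinfun" "T o\<^sub>L S = id_blinfun" for S
    proof (rule blinfun_eqI)
      fix x
      have "blinfun_apply S x = blinfun_apply (S o\<^sub>L T) (blinfun_apply R x)"
        using R(2) by (metis blinfun_apply_blinfun_compose blinfun_apply_id_blinfun id_apply)
      then show "blinfun_apply S x = blinfun_apply R x"
        using that by simp
    qed
    then show "\<exists>!R. R o\<^sub>L T = id_blinfun \<and> T o\<^sub>L R = id_blinfun"
      using R by blast
  qed
  then show "op_inv T o\<^sub>L T = id_blinfun" "T o\<^sub>L op_inv T = id_blinfun"
    by auto
qed

lemma op_inv_apply:
  assumes "op_invertible T"
  shows "blinfun_apply (op_inv T) (blinfun_apply T x) = x" "blinfun_apply T (blinfun_apply (op_inv T) x) = x"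
  using arg_cong[OF op_inv(1)[OF assms], of "\<lambda>S. blinfun_apply S x"]
    arg_cong[OF op_inv(2)[OF assms], of "\<lambda>S. blinfun_apply S x"] by auto

text \<open>Inverses are formed among bounded real-linear maps; complex linearity is inherited from
  \<open>T\<close>.\<close>

lemma clinear_op_inv:
  assumes "clinear_op T" "op_invertible T"
  shows "clinear_op (op_inv T)"
  unfolding clinear_op_def clinear_on_def
proof (intro conjI ballI allI)
  fix c x
  have "blinfun_apply T (c *\<^sub>C blinfun_apply (op_inv T) x) = c *\<^sub>C x"
    by (simp add: clinear_opD[OF assms(1)] op_inv_apply[OF assms(2)])
  then show "blinfun_apply (op_inv T) (c *\<^sub>C x) = c *\<^sub>C blinfun_apply (op_inv T) x"
    using op_inv_apply(1)[OF assms(2)] by metis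
qed (simp add: blinfun.add_right)

text \<open>A perturbation \<open>T\<close> of an invertible \<open>T0\<close> is inverted by solving
  \<open>x = x - R0 (T x - y)\<close> with the contraction principle.\<close>

lemma op_invertible_perturbation:
  fixes T0 :: "'g::complex_hilbert_space \<Rightarrow>\<^sub>L 'g"
  assumes "op_invertible T0"
  obtains \<epsilon> C where "\<epsilon> > 0" "\<And>T. norm (T - T0) < \<epsilon> \<Longrightarrow> op_invertible T \<and> norm (op_inv T) \<le> C"
proof -
  define R0 where "R0 = op_inv T0"
  define c where "c = norm R0 + 1"
  have c: "c > 0" "norm R0 \<le> c"
    by (auto simp: c_def add_nonneg_pos)
  note R0 = op_inv_apply[OF assms, folded R0_def]
  \<comment> \<open>Within this radius \<open>R0\<close> composed with \<open>T - T0\<close>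
    contracts by 1 / 2, which bounds the inverse of \<open>T\<close> by 2 * c. The summand 1 in
    \<open>c\<close> keeps it positive when \<open>R0\<close> is zero.\<close>
  have main: "op_invertible T \<and> norm (op_inv T) \<le> 2 * c" if T: "norm (T - T0) < 1 / (2 * c)" for T
  proof -
    have small: "norm (blinfun_apply R0 (blinfun_apply (T - T0) x)) \<le> 1 / 2 * norm x" for x
    proof -
      have "norm (blinfun_apply R0 (blinfun_apply (T - T0) x)) \<le> norm R0 * norm (blinfun_apply (T - T0) x)"
        by (rule norm_blinfun)
      also have "\<dots> \<le> c * (1 / (2 * c) * norm x)"
      proof (intro mult_mono)
        have "norm (blinfun_apply (T - T0) x) \<le> norm (T - T0) * norm x"
          by (rule norm_blinfun)
        also have "\<dots> \<le> 1 / (2 * c) * norm x"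
          using T by (intro mult_right_mono) auto
        finally show "norm (blinfun_apply (T - T0) x) \<le> 1 / (2 * c) * norm x" .
      qed (use c in auto)
      finally show ?thesis
        using c by simp
    qed
    have split: "blinfun_apply R0 (blinfun_apply T x) = x + blinfun_apply R0 (blinfun_apply (T - T0) x)" for x
      by (simp add: blinfun.diff_left blinfun.diff_right R0)
    have low: "norm x \<le> 2 * c * norm (blinfun_apply T x)" for x
    proof -
      have "norm x \<le> norm (blinfun_apply R0 (blinfun_apply T x)) + norm (blinfun_apply R0 (blinfun_apply (T - T0) x))"
        using norm_triangle_ineq4[of "blinfun_apply R0 (blinfun_apply T x)" "blinfun_apply R0 (blinfun_apply (T - T0) x)"]
        by (simp add: split)
      also have "\<dots> \<le> c * norm (blinfun_apply T x) + 1 / 2 * norm x"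
      proof (rule add_mono[OF _ small])
        have "norm (blinfun_apply R0 (blinfun_apply T x)) \<le> norm R0 * norm (blinfun_apply T x)"
          by (rule norm_blinfun)
        also have "\<dots> \<le> c * norm (blinfun_apply T x)"
          using c by (intro mult_right_mono) auto
        finally show "norm (blinfun_apply R0 (blinfun_apply T x)) \<le> c * norm (blinfun_apply T x)" .
      qed
      finally show ?thesis
        by simp
    qed
    have "\<exists>x. blinfun_apply T x = y" for y
    proof -
      let ?f = "\<lambda>x. x - blinfun_apply R0 (blinfun_apply T x - y)"
      have "?f x - ?f x' = - blinfun_apply R0 (blinfun_apply (T - T0) (x - x'))" for x x'
      proof -
        have "?f x - ?f x' = (x - x') - blinfun_apply R0 (blinfun_apply T (x - x'))"
          by (simp add: blinfun.diff_right)
        also have "\<dots> = - blinfun_apply R0 (blinfun_apply (T - T0) (x - x'))"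
          unfolding split by simp
        finally show ?thesis .
      qed
      then have "dist (?f x) (?f x') \<le> 1 / 2 * dist x x'" for x x'
        unfolding dist_norm using small[of "x - x'"] by (metis norm_minus_cancel)
      then have "\<exists>!x. ?f x = x"
        by (intro banach_fix_type[of "1/2"]) auto
      then obtain x where "blinfun_apply R0 (blinfun_apply T x - y) = 0"
        by auto
      then have "blinfun_apply T x - y = 0"
        using R0(2)[of "blinfun_apply T x - y"] by simp
      then show ?thesis
        by auto
    qed
    then obtain S where S: "\<And>y. blinfun_apply T (S y) = y"
      by metis
    have inj: "x = x'" if "blinfun_apply T x = blinfun_apply T x'" for x x'
      using low[of "x - x'"] that by (simp add: blinfun.diff_right)
    have bl: "bounded_linear S"
    proof (rule bounded_linear_intro[where K = "2 * c"])
      show "S (x + y) = S x + S y" "S (r *\<^sub>R x) = r *\<^sub>R S x" for x y r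
        by (rule inj; simp add: S blinfun.add_right blinfun.scaleR_right)+
      show "norm (S x) \<le> norm x * (2 * c)" for x
        using low[of "S x"] by (simp add: S mult.commute)
    qed
    have inv: "Blinfun S o\<^sub>L T = id_blinfun" "T o\<^sub>L Blinfun S = id_blinfun"
      by (rule blinfun_eqI; simp add: bounded_linear_Blinfun_apply[OF bl] S; rule inj; simp add: S)+
    then have invertible: "op_invertible T"
      by (auto simp: op_invertible_def)
    have "norm (op_inv T) \<le> 2 * c"
    proof (rule norm_blinfun_bound)
      show "norm (blinfun_apply (op_inv T) x) \<le> 2 * c * norm x" for x
        using low[of "blinfun_apply (op_inv T) x"] by (simp add: op_inv_apply[OF invertible])
    qed (use c in simp)
    then show ?thesis
      using invertible by blast
  qed
  show thesis
    by (rule that[of "1 / (2 * c)" "2 * c"]) (use main c in auto)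
qed

text \<open>The derivative must be multiplication of one operator by the complex increment; this is
  the differentiability condition inside \<open>hdom\<close>, isolated at a point.\<close>

definition op_holomorphic_at :: "('g::complex_hilbert_space) opfun \<Rightarrow> complex \<Rightarrow> bool" where
  "op_holomorphic_at Q w \<longleftrightarrow> (\<exists>D. (Q has_derivative (\<lambda>h. scale_op h o\<^sub>L D)) (at w))"

lemma op_holomorphic_at_continuous: "op_holomorphic_at Q w \<Longrightarrow> isCont Q w"
  unfolding op_holomorphic_at_def using has_derivative_continuous by blast

lemma op_holomorphic_at_add:
  assumes "op_holomorphic_at Q w" "op_holomorphic_at Q' w"
  shows "op_holomorphic_at (\<lambda>z. Q z + Q' z) w"
proof -
  obtain D D' where "(Q has_derivative (\<lambda>h. scale_op h o\<^sub>L D)) (at w)"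
    "(Q' has_derivative (\<lambda>h. scale_op h o\<^sub>L D')) (at w)"
    using assms by (auto simp: op_holomorphic_at_def)
  then have "((\<lambda>z. Q z + Q' z) has_derivative (\<lambda>h. (scale_op h o\<^sub>L D) + (scale_op h o\<^sub>L D'))) (at w)"
    by (rule has_derivative_add)
  moreover have "(scale_op h o\<^sub>L D) + (scale_op h o\<^sub>L D') = scale_op h o\<^sub>L (D + D')" for h
    by (rule blinfun_eqI) (simp add: blinfun.add_left scaleC_add_right)
  ultimately show ?thesis
    by (auto simp: op_holomorphic_at_def)
qed

lemma op_holomorphic_at_scale:
  fixes F :: "('g::complex_hilbert_space) opfun"
  assumes "(q has_field_derivative q') (at w)" "op_holomorphic_at F w"
  shows "op_holomorphic_at (\<lambda>z. scale_op (q z) o\<^sub>L F z) w"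
proof -
  obtain D where D: "(F has_derivative (\<lambda>h. scale_op h o\<^sub>L D)) (at w)"
    using assms by (auto simp: op_holomorphic_at_def)
  have "((\<lambda>z. scale_op (q z) :: 'g \<Rightarrow>\<^sub>L 'g) has_derivative (\<lambda>h. scale_op (q' * h))) (at w)"
    using bounded_linear.has_derivative[OF bounded_linear_scale_op] assms(1)
    by (auto simp: has_field_derivative_def)
  from bounded_bilinear.FDERIV[OF bounded_bilinear_blinfun_compose this D]
  have "((\<lambda>z. scale_op (q z) o\<^sub>L F z) has_derivative
      (\<lambda>h. (scale_op (q w) o\<^sub>L (scale_op h o\<^sub>L D)) + (scale_op (q' * h) o\<^sub>L F w))) (at w)" .
  moreover have "(scale_op (q w) o\<^sub>L (scale_op h o\<^sub>L D)) + (scale_op (q' * h) o\<^sub>L F w)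
      = scale_op h o\<^sub>L ((scale_op (q w) o\<^sub>L D) + (scale_op q' o\<^sub>L F w))" for h
    by (rule blinfun_eqI)
      (simp add: blinfun.add_left scaleC_add_right scaleC_scaleC mult.commute)
  ultimately show ?thesis
    by (auto simp: op_holomorphic_at_def)
qed

text \<open>The identity \<open>diff\<close> first gives continuity of the inverse and then its
  derivative - W D W, as for scalar reciprocals. Complex linearity of the values is what lets the
  scalar increment pass through \<open>W z\<close>.\<close>

lemma op_holomorphic_at_inv:
  fixes F :: "('g::complex_hilbert_space) opfun"
  assumes hol: "op_holomorphic_at F w" and inv: "op_invertible (F w)"
    and clin: "\<forall>\<^sub>F z in at w. clinear_op (F z)" "clinear_op (F w)"
  shows "op_holomorphic_at (\<lambda>z. op_inv (F z)) w"
proof -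
  define W where "W z = op_inv (F z)" for z
  obtain D where D: "(F has_derivative (\<lambda>h. scale_op h o\<^sub>L D)) (at w)"
    using hol by (auto simp: op_holomorphic_at_def)
  obtain \<epsilon> C where eps: "\<epsilon> > 0" "\<And>T. norm (T - F w) < \<epsilon> \<Longrightarrow> op_invertible T \<and> norm (op_inv T) \<le> C"
    by (rule op_invertible_perturbation[OF inv]) (rule that)
  have C: "C \<ge> 0"
    using order_trans[OF norm_ge_zero conjunct2[OF eps(2)[of "F w"]]] eps(1) by simp
  have cont: "(F \<longlongrightarrow> F w) (at w)"
    using op_holomorphic_at_continuous[OF hol] by (simp add: isCont_def)
  then have "\<forall>\<^sub>F z in at w. norm (F z - F w) < \<epsilon>"
    using eps(1) by (auto simp: tendsto_iff dist_norm)
  then have ev: "\<forall>\<^sub>F z in at w. op_invertible (F z) \<and> norm (W z) \<le> C"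
    by (rule eventually_mono) (use eps(2) W_def in auto)
  have diff: "W z - W w = - (W z o\<^sub>L ((F z - F w) o\<^sub>L W w))" if "op_invertible (F z)" for z
    by (rule blinfun_eqI) (simp add: W_def blinfun.diff_left blinfun.diff_right blinfun.minus_left
        op_inv_apply[OF that] op_inv_apply[OF inv])
  have contW: "(W \<longlongrightarrow> W w) (at w)"
  proof (rule LIM_zero_cancel, rule Lim_null_comparison)
    show "\<forall>\<^sub>F z in at w. norm (W z - W w) \<le> C * (norm (F z - F w) * norm (W w))"
      using ev
    proof (rule eventually_mono)
      fix z assume z: "op_invertible (F z) \<and> norm (W z) \<le> C"
      have "norm (W z - W w) \<le> norm (W z) * norm ((F z - F w) o\<^sub>L W w)"
        using diff z norm_blinfun_compose by (metis norm_minus_cancel)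
      also have "\<dots> \<le> C * (norm (F z - F w) * norm (W w))"
        using z C by (intro mult_mono norm_blinfun_compose) auto
      finally show "norm (W z - W w) \<le> C * (norm (F z - F w) * norm (W w))" .
    qed
    have "((\<lambda>z. norm (F z - F w)) \<longlongrightarrow> 0) (at w)"
      by (intro tendsto_norm_zero LIM_zero cont)
    then show "((\<lambda>z. C * (norm (F z - F w) * norm (W w))) \<longlongrightarrow> 0) (at w)"
      by (intro tendsto_mult_right_zero tendsto_mult_left_zero)
  qed
  define E where "E = - (W w o\<^sub>L (D o\<^sub>L W w))"
  define r where "r z = F z - F w - (scale_op (z - w) o\<^sub>L D)" for z
  have "(W has_derivative (\<lambda>h. scale_op h o\<^sub>L E)) (at w)"
    unfolding has_derivative_iff_norm
  proof
    show "bounded_linear (\<lambda>h. scale_op h o\<^sub>L E)"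
      by (rule bounded_linear_scale_op_compose)
    show "((\<lambda>z. norm (W z - W w - (scale_op (z - w) o\<^sub>L E)) / norm (z - w)) \<longlongrightarrow> 0) (at w)"
    proof (rule Lim_null_comparison)
      let ?g = "\<lambda>z. norm (W z - W w) * norm (D o\<^sub>L W w) + C * (norm (r z) / norm (z - w)) * norm (W w)"
      show "\<forall>\<^sub>F z in at w. norm (norm (W z - W w - (scale_op (z - w) o\<^sub>L E)) / norm (z - w)) \<le> ?g z"
        using ev clin(1) eventually_neq_at_within[of w w UNIV]
      proof eventually_elim
        case (elim z)
        have lin: "clinear_op (W z)"
          unfolding W_def using elim by (intro clinear_op_inv) auto
        \<comment> \<open>\<open>F z - F w\<close> is split into its linear part and the remainder
          \<open>r z\<close>. In the linear part \<open>W z - W w\<close> tends to 0, and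
          \<open>r z\<close> is small relative to \<open>z - w\<close>.\<close>
        have "W z - W w - (scale_op (z - w) o\<^sub>L E) =
          - (scale_op (z - w) o\<^sub>L ((W z - W w) o\<^sub>L (D o\<^sub>L W w))) - (W z o\<^sub>L (r z o\<^sub>L W w))"
        proof (rule blinfun_eqI)
          fix x
          let ?y = "blinfun_apply (W w) x"
          have "blinfun_apply (W z) x - ?y = - blinfun_apply (W z) (blinfun_apply (F z) ?y - blinfun_apply (F w) ?y)"
            using arg_cong[OF diff[OF conjunct1[OF elim(1)]], of "\<lambda>S. blinfun_apply S x"]
            by (simp add: blinfun.diff_left blinfun.minus_left)
          also have "blinfun_apply (F z) ?y - blinfun_apply (F w) ?y = blinfun_apply (r z) ?y + (z - w) *\<^sub>C blinfun_apply D ?y"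
            by (simp add: r_def blinfun.diff_left)
          finally have "blinfun_apply (W z) x - ?y =
              - (blinfun_apply (W z) (blinfun_apply (r z) ?y) + (z - w) *\<^sub>C blinfun_apply (W z) (blinfun_apply D ?y))"
            by (simp add: clinear_opD[OF lin])
          then show "blinfun_apply (W z - W w - (scale_op (z - w) o\<^sub>L E)) x =
            blinfun_apply (- (scale_op (z - w) o\<^sub>L ((W z - W w) o\<^sub>L (D o\<^sub>L W w))) - (W z o\<^sub>L (r z o\<^sub>L W w))) x"
            by (simp add: E_def blinfun.diff_left blinfun.minus_left complex_vector.scale_right_diff_distrib)
        qed
        also have "norm \<dots> \<le> norm (scale_op (z - w) o\<^sub>L ((W z - W w) o\<^sub>L (D o\<^sub>L W w))) + norm (W z o\<^sub>L (r z o\<^sub>L W w))"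
          by (metis norm_minus_cancel norm_triangle_ineq4)
        also have "\<dots> \<le> norm (z - w) * (norm (W z - W w) * norm (D o\<^sub>L W w)) + C * (norm (r z) * norm (W w))"
        proof (intro add_mono)
          have "norm (scale_op (z - w) :: 'g \<Rightarrow>\<^sub>L 'g) \<le> norm (z - w)"
            by (rule norm_blinfun_bound) (simp_all add: norm_scaleC)
          then show "norm (scale_op (z - w) o\<^sub>L ((W z - W w) o\<^sub>L (D o\<^sub>L W w))) \<le> norm (z - w) * (norm (W z - W w) * norm (D o\<^sub>L W w))"
            by (intro order_trans[OF norm_blinfun_compose] mult_mono norm_blinfun_compose) auto
          show "norm (W z o\<^sub>L (r z o\<^sub>L W w)) \<le> C * (norm (r z) * norm (W w))"
            using elim C by (intro order_trans[OF norm_blinfun_compose] mult_mono norm_blinfun_compose) auto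
        qed
        finally have "norm (W z - W w - (scale_op (z - w) o\<^sub>L E)) \<le>
            norm (z - w) * (norm (W z - W w) * norm (D o\<^sub>L W w)) + C * (norm (r z) * norm (W w))" .
        then have "norm (W z - W w - (scale_op (z - w) o\<^sub>L E)) / norm (z - w) \<le>
            (norm (z - w) * (norm (W z - W w) * norm (D o\<^sub>L W w)) + C * (norm (r z) * norm (W w))) / norm (z - w)"
          by (rule divide_right_mono) simp
        also have "\<dots> = ?g z"
          using elim by (simp add: add_divide_distrib)
        finally show ?case
          by simp
      qed
      have 1: "((\<lambda>z. norm (W z - W w)) \<longlongrightarrow> 0) (at w)"
        by (intro tendsto_norm_zero LIM_zero contW)
      have 2: "((\<lambda>z. norm (r z) / norm (z - w)) \<longlongrightarrow> 0) (at w)"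
        using D unfolding has_derivative_iff_norm r_def by simp
      show "(?g \<longlongrightarrow> 0) (at w)"
        using tendsto_add[OF tendsto_mult_left_zero[OF 1] tendsto_mult_left_zero[OF tendsto_mult_right_zero[OF 2]]]
        by simp
    qed
  qed
  then show ?thesis
    unfolding op_holomorphic_at_def W_def by blast
qed

lemma hdom_iff: "hdom Q = {z. \<exists>F r. r > 0 \<and> (\<forall>w\<in>ball z r. op_holomorphic_at F w) \<and>
    (\<forall>w\<in>ball z r. w \<notin> \<real> \<and> w \<noteq> z \<longrightarrow> F w = Q w)}"
  by (simp add: hdom_def op_holomorphic_at_def)

lemma op_holomorphic_at_hdom:
  assumes "r > 0" "\<And>w. w \<in> ball z r \<Longrightarrow> op_holomorphic_at Q w" "z \<notin> \<real>"
  shows "z \<in> hdom Q" "hval Q z = Q z"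
proof -
  show "z \<in> hdom Q"
    unfolding hdom_iff using assms by (intro CollectI exI[of _ Q] exI[of _ r]) auto
  have "at z within - \<real> = at z"
    using assms(3) by (intro at_within_open) (auto simp: open_Compl closed_complex_Reals)
  moreover have "(Q \<longlongrightarrow> Q z) (at z)"
    using op_holomorphic_at_continuous[OF assms(2)[of z]] assms(1) by (simp add: isCont_def)
  ultimately show "hval Q z = Q z"
    unfolding hval_def by (simp add: tendsto_Lim)
qed

lemma open_contains_subball:
  assumes "open S" "z \<in> S"
  obtains r where "r > 0" "ball z r \<subseteq> S"
  using assms by (metis openE)

text \<open>Near any nonreal point \<open>z\<close> the function is a holomorphic one divided by a
  power of the distance to \<open>z\<close>; a ball in \<open>S\<close> close to \<open>z\<close>
  but missing it avoids the pole.\<close>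

lemma meromorphic_nonreal_holomorphic_ball:
  assumes "meromorphic_nonreal Q" "open S" "S \<noteq> {}" "S \<inter> \<real> = {}"
  obtains w r where "r > 0" "ball w r \<subseteq> S" "\<And>u. u \<in> ball w r \<Longrightarrow> op_holomorphic_at Q u"
proof -
  obtain z where z: "z \<in> S" "z \<notin> \<real>"
    using assms by blast
  obtain k F r where F: "r > 0" "\<And>w. w \<in> ball z r \<Longrightarrow> op_holomorphic_at F w"
    "\<And>w. w \<in> ball z r \<Longrightarrow> w \<notin> \<real> \<Longrightarrow> w \<noteq> z \<Longrightarrow> F w = scale_op ((w - z) ^ k) o\<^sub>L Q w"
    using assms(1) z(2) unfolding meromorphic_nonreal_def hdom_iff by blast
  define U where "U = S \<inter> ball z r - {z}"
  have U: "open U"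
    unfolding U_def using assms(2) by auto
  have "open (S \<inter> ball z r)" "z \<in> S \<inter> ball z r"
    using assms(2) z F(1) by auto
  then have "U \<noteq> {}"
    unfolding U_def by (metis Diff_eq_empty_iff empty_iff not_open_singleton subset_singletonD)
  then obtain w where w: "w \<in> U"
    by blast
  obtain s where s: "s > 0" "ball w s \<subseteq> U"
    using open_contains_subball[OF U w] .
  have "op_holomorphic_at Q u" if u: "u \<in> ball w s" for u
  proof -
    have uU: "u \<in> U"
      using u s by blast
    then have "u - z \<noteq> 0"
      by (auto simp: U_def)
    then have u': "u \<in> - {z}"
      by auto
    have "(\<lambda>u. 1 / (u - z) ^ k) holomorphic_on - {z}"
      by (intro holomorphic_intros) auto
    then obtain q' where "((\<lambda>u. 1 / (u - z) ^ k) has_field_derivative q') (at u)"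
      using holomorphic_on_imp_differentiable_at[of _ "- {z}" u] u'
      unfolding field_differentiable_def by (auto simp: open_Compl)
    then have "op_holomorphic_at (\<lambda>u. scale_op (1 / (u - z) ^ k) o\<^sub>L F u) u"
      using F(2) uU by (intro op_holomorphic_at_scale) (auto simp: U_def)
    then obtain D where D: "((\<lambda>u. scale_op (1 / (u - z) ^ k) o\<^sub>L F u) has_derivative (\<lambda>h. scale_op h o\<^sub>L D)) (at u)"
      by (auto simp: op_holomorphic_at_def)
    have "(Q has_derivative (\<lambda>h. scale_op h o\<^sub>L D)) (at u)"
    proof (rule has_derivative_transform_within_open[OF D U uU])
      fix x assume x: "x \<in> U"
      then have "F x = scale_op ((x - z) ^ k) o\<^sub>L Q x" "x - z \<noteq> 0"
        using F(3)[of x] assms(4) by (auto simp: U_def)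
      then show "scale_op (1 / (x - z) ^ k) o\<^sub>L F x = Q x"
        by (intro blinfun_eqI) (simp add: scaleC_scaleC scaleC_one)
    qed
    then show ?thesis
      by (auto simp: op_holomorphic_at_def)
  qed
  then show thesis
    using that[of s w] s by (auto simp: U_def)
qed

lemma gen_nevanlinnaD:
  assumes "Q \<in> gen_nevanlinna"
  shows "meromorphic_nonreal Q" "z \<in> hdom Q \<Longrightarrow> clinear_op (hval Q z)"
    "z \<in> hdom Q \<Longrightarrow> z \<notin> \<real> \<Longrightarrow> op_adj (hval Q z) = hval Q (cnj z)"
  using assms by (auto simp: gen_nevanlinna_def gen_nevanlinna_class_def)

lemma hval_adjoint:
  assumes "Q \<in> gen_nevanlinna" "z \<in> hdom Q" "z \<notin> \<real>"
  shows "cinner (blinfun_apply (hval Q z) x) y = cinner x (blinfun_apply (hval Q (cnj z)) y)"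
  using op_adj[OF gen_nevanlinnaD(2)[OF assms(1,2)]] gen_nevanlinnaD(3)[OF assms] by metis

lemma cnj_ball: "u \<in> ball (cnj w) r \<longleftrightarrow> cnj u \<in> ball w r"
  by (simp add: dist_norm complex_mod_cnj flip: complex_cnj_diff) (metis complex_cnj_cnj complex_cnj_diff complex_mod_cnj)

lemma clinear_op_add: "clinear_op S \<Longrightarrow> clinear_op T \<Longrightarrow> clinear_op (S + T)"
  by (simp add: clinear_op_def clinear_on_def blinfun.add_left scaleC_add_right)

text \<open>Real points of regularity are moved to nearby nonreal ones; invertibility passes to the
  conjugate points by taking adjoints.\<close>

lemma regular_good_ball:
  fixes m \<tau> :: "('g::complex_hilbert_space) opfun"
  assumes m: "m \<in> gen_nevanlinna" and \<tau>: "\<tau> \<in> gen_nevanlinna"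
    and reg: "regular_opfun (\<lambda>z. m z + \<tau> z)" and X: "finite X"
  defines "W \<equiv> (\<lambda>z. op_inv (m z + \<tau> z))"
  obtains w r where "r > 0"
    "\<And>z. z \<in> ball w r \<Longrightarrow> Im z > 0"
    "\<And>z. z \<in> ball w r \<or> cnj z \<in> ball w r \<Longrightarrow> z \<notin> X \<and> z \<in> hdom m \<and> z \<in> hdom \<tau> \<and> z \<in> hdom W \<and>
      (\<forall>x. blinfun_apply (hval W z) (blinfun_apply (hval m z) x + blinfun_apply (hval \<tau> z) x) = x) \<and>
      (\<forall>x. blinfun_apply (hval m z) (blinfun_apply (hval W z) x) + blinfun_apply (hval \<tau> z) (blinfun_apply (hval W z) x) = x)"
proof -
  obtain \<mu> where mu: "\<mu> \<in> hdom (\<lambda>z. m z + \<tau> z)" "op_invertible (hval (\<lambda>z. m z + \<tau> z) \<mu>)"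
    using reg by (auto simp: regular_opfun_def)
  obtain F r where F: "r > 0" "\<And>w. w \<in> ball \<mu> r \<Longrightarrow> op_holomorphic_at F w"
    "\<And>w. w \<in> ball \<mu> r \<Longrightarrow> w \<notin> \<real> \<Longrightarrow> w \<noteq> \<mu> \<Longrightarrow> F w = m w + \<tau> w"
    using mu(1) unfolding hdom_iff by blast
  have nontriv: "at \<mu> within - \<real> \<noteq> bot"
  proof -
    have "\<mu> islimpt - \<real>"
      unfolding islimpt_approachable
    proof (intro allI impI)
      fix e :: real assume e: "e > 0"
      \<comment> \<open>The point \<mu> may be real or not; the vertical displacement only has to
        miss the one value that ends on the real axis.\<close>
      have "\<exists>d. 0 < d \<and> d < e \<and> Im \<mu> + d \<noteq> 0"
      proof (cases "Im \<mu> + e / 2 = 0")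
        case True
        then show ?thesis
          using e by (intro exI[of _ "e / 3"]) auto
      next
        case False
        then show ?thesis
          using e by (intro exI[of _ "e / 2"]) auto
      qed
      then obtain d where d: "0 < d" "d < e" "Im \<mu> + d \<noteq> 0"
        by blast
      then show "\<exists>x'\<in>- \<real>. x' \<noteq> \<mu> \<and> dist x' \<mu> < e"
        by (intro bexI[of _ "\<mu> + \<i> * of_real d"]) (auto simp: dist_norm norm_mult complex_is_Real_iff)
    qed
    then show ?thesis
      by (simp add: trivial_limit_within)
  qed
  have "hval (\<lambda>z. m z + \<tau> z) \<mu> = F \<mu>"
    unfolding hval_def
  proof (rule tendsto_Lim[OF nontriv])
    have "(F \<longlongrightarrow> F \<mu>) (at \<mu> within - \<real>)"
      using op_holomorphic_at_continuous[OF F(2)[of \<mu>]] F(1)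
      by (auto simp: isCont_def intro: tendsto_within_subset)
    moreover have "\<forall>\<^sub>F z in at \<mu> within - \<real>. F z = m z + \<tau> z"
      unfolding eventually_at using F(1,3)
      by (intro exI[of _ r]) (auto simp: dist_commute)
    ultimately show "((\<lambda>z. m z + \<tau> z) \<longlongrightarrow> F \<mu>) (at \<mu> within - \<real>)"
      by (rule Lim_transform_eventually)
  qed
  then have "op_invertible (F \<mu>)"
    using mu(2) by simp
  then obtain \<epsilon> C where eps: "\<epsilon> > 0" "\<And>T. norm (T - F \<mu>) < \<epsilon> \<Longrightarrow> op_invertible T \<and> norm (op_inv T) \<le> C"
    by (rule op_invertible_perturbation) (rule that)
  have "(F \<longlongrightarrow> F \<mu>) (at \<mu>)"
    using op_holomorphic_at_continuous[OF F(2)[of \<mu>]] F(1) by (auto simp: isCont_def)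
  then have "\<forall>\<^sub>F z in at \<mu>. norm (F z - F \<mu>) < \<epsilon>"
    using eps(1) by (auto simp: tendsto_iff dist_norm)
  then obtain r1 where r1: "r1 > 0" "\<And>z. z \<noteq> \<mu> \<Longrightarrow> dist z \<mu> < r1 \<Longrightarrow> norm (F z - F \<mu>) < \<epsilon>"
    unfolding eventually_at by auto
  define S where "S = ball \<mu> (min r r1) - \<real> - {\<mu>}"
  have S: "open S" "S \<inter> \<real> = {}"
    unfolding S_def by (auto intro!: open_Diff closed_complex_Reals)
  have inv: "op_invertible (m z + \<tau> z)" if "z \<in> S" for z
    using that F(3)[of z] r1(2)[of z] eps(2)[of "F z"] by (auto simp: S_def dist_commute)
  have "S \<noteq> {}"
  proof -
    have "\<exists>z. z \<in> - \<real> \<and> z \<noteq> \<mu> \<and> dist z \<mu> < min r r1"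
      using nontriv F(1) r1(1) unfolding trivial_limit_within islimpt_approachable
      by (metis min_less_iff_conj zero_less_dist_iff dist_self)
    then obtain z where "z \<in> - \<real>" "z \<noteq> \<mu>" "dist z \<mu> < min r r1"
      by blast
    then have "z \<in> S"
      by (auto simp: S_def dist_commute)
    then show ?thesis
      by blast
  qed
  \<comment> \<open>\<open>X\<close> is removed together with its conjugate, because a ball and its
    conjugate ball must both avoid \<open>X\<close>.\<close>
  define S1 where "S1 = S - X - cnj ` X"
  have fin: "finite (X \<union> cnj ` X)"
    using X by simp
  have S1_eq: "S1 = S - (X \<union> cnj ` X)"
    by (auto simp: S1_def)
  have "infinite S"
    using S(1) \<open>S \<noteq> {}\<close> by (metis finite_imp_not_open)
  then have "S1 \<noteq> {}"
    unfolding S1_eq using fin by (metis finite.emptyI finite_Diff2)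
  moreover have "open S1"
    unfolding S1_eq using S(1) fin by (intro open_Diff finite_imp_closed)
  moreover have "S1 \<inter> \<real> = {}"
    using S(2) by (auto simp: S1_def)
  \<comment> \<open>The balls shrink four times: \<open>m\<close> and \<tau> become holomorphic on a
    ball in \<open>S1\<close>, then also on a ball inside its conjugate. On the conjugate of the
    last ball \<open>m + \<tau>\<close> is invertible by \<open>inv\<close>.\<close>
  ultimately obtain w1 s1 where w1: "s1 > 0" "ball w1 s1 \<subseteq> S1" "\<And>u. u \<in> ball w1 s1 \<Longrightarrow> op_holomorphic_at m u"
    using meromorphic_nonreal_holomorphic_ball[OF gen_nevanlinnaD(1)[OF m], of S1] by metis
  have nr: "ball w1 s1 \<inter> \<real> = {}"
    using w1(2) \<open>S1 \<inter> \<real> = {}\<close> by blast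
  obtain w2 s2 where w2: "s2 > 0" "ball w2 s2 \<subseteq> ball w1 s1" "\<And>u. u \<in> ball w2 s2 \<Longrightarrow> op_holomorphic_at \<tau> u"
    by (rule meromorphic_nonreal_holomorphic_ball[OF gen_nevanlinnaD(1)[OF \<tau>], of "ball w1 s1"])
      (use w1(1) nr in auto)
  have nr2: "ball (cnj w2) s2 \<inter> \<real> = {}"
  proof -
    have "u \<notin> \<real>" if "u \<in> ball (cnj w2) s2" for u
      using that w2(2) nr unfolding cnj_ball by (metis Reals_cnj_iff IntI complex_cnj_cnj empty_iff subsetD)
    then show ?thesis by blast
  qed
  obtain w3 s3 where w3: "s3 > 0" "ball w3 s3 \<subseteq> ball (cnj w2) s2" "\<And>u. u \<in> ball w3 s3 \<Longrightarrow> op_holomorphic_at m u"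
    by (rule meromorphic_nonreal_holomorphic_ball[OF gen_nevanlinnaD(1)[OF m], of "ball (cnj w2) s2"])
      (use w2(1) nr2 in auto)
  obtain w4 s4 where w4: "s4 > 0" "ball w4 s4 \<subseteq> ball w3 s3" "\<And>u. u \<in> ball w4 s4 \<Longrightarrow> op_holomorphic_at \<tau> u"
    by (rule meromorphic_nonreal_holomorphic_ball[OF gen_nevanlinnaD(1)[OF \<tau>], of "ball w3 s3"])
      (use w3 nr2 in auto)
  define P where "P z \<longleftrightarrow> z \<notin> X \<and> z \<notin> \<real> \<and> op_holomorphic_at m z \<and> op_holomorphic_at \<tau> z" for z
  have P4: "P z" if "z \<in> ball w4 s4" for z
  proof -
    have "cnj z \<in> ball w2 s2"
      using that w4(2) w3(2) unfolding cnj_ball[symmetric] by blast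
    then have "cnj z \<in> S1" "cnj z \<notin> \<real>"
      using w2(2) w1(2) nr by blast+
    then show ?thesis
      using that w4 w3 unfolding P_def S1_def
      by (auto simp: Reals_cnj_iff)
  qed
  have P4': "P (cnj z) \<and> op_invertible (m (cnj z) + \<tau> (cnj z))" if "z \<in> ball w4 s4" for z
  proof -
    have "cnj z \<in> ball w2 s2"
      using that w4(2) w3(2) unfolding cnj_ball[symmetric] by blast
    then have "cnj z \<in> S1" "cnj z \<notin> \<real>" "op_holomorphic_at m (cnj z)" "op_holomorphic_at \<tau> (cnj z)"
      using w2 w1 nr by blast+
    then show ?thesis
      using inv unfolding P_def S1_def by auto
  qed
  define N where "N = {z. z \<in> ball w4 s4 \<or> cnj z \<in> ball w4 s4}"
  have N: "P z" if "z \<in> N" for z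
    using that P4 P4'[of "cnj z"] by (auto simp: N_def)
  have openN: "open N"
  proof -
    have "N = ball w4 s4 \<union> ball (cnj w4) s4"
      unfolding N_def by (auto simp only: cnj_ball)
    then show ?thesis by auto
  qed
  have Nval: "z \<in> hdom m" "hval m z = m z" "z \<in> hdom \<tau>" "hval \<tau> z = \<tau> z" if z: "z \<in> N" for z
  proof -
    obtain s where s: "s > 0" "ball z s \<subseteq> N"
      by (rule open_contains_subball[OF openN z])
    have nr: "z \<notin> \<real>"
      using N[OF z] by (simp add: P_def)
    have h: "op_holomorphic_at m u" "op_holomorphic_at \<tau> u" if "u \<in> ball z s" for u
      using N[of u] that s by (auto simp: P_def)
    show "z \<in> hdom m" "hval m z = m z" "z \<in> hdom \<tau>" "hval \<tau> z = \<tau> z"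
      using op_holomorphic_at_hdom[OF s(1) h(1) nr] op_holomorphic_at_hdom[OF s(1) h(2) nr] by auto
  qed
  have clin: "clinear_op (m z)" "clinear_op (\<tau> z)" if "z \<in> N" for z
    using gen_nevanlinnaD(2)[OF m Nval(1)[OF that]] gen_nevanlinnaD(2)[OF \<tau> Nval(3)[OF that]]
      Nval(2,4)[OF that] by auto
  have Ncnj: "cnj z \<in> N" if "z \<in> N" for z
    using that by (auto simp: N_def)
  have adj: "cinner (blinfun_apply (m z + \<tau> z) x) y = cinner x (blinfun_apply (m (cnj z) + \<tau> (cnj z)) y)"
    if "z \<in> N" for z x y
  proof -
    have nr: "z \<notin> \<real>"
      using N[OF that] by (simp add: P_def)
    show ?thesis
      using hval_adjoint[OF m Nval(1)[OF that] nr] hval_adjoint[OF \<tau> Nval(3)[OF that] nr]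
        Nval(2,4)[OF that] Nval(2,4)[OF Ncnj[OF that]]
      by (simp add: blinfun.add_left cinner_add_left cinner.add_right)
  qed
  have inv1: "op_invertible (m (cnj z) + \<tau> (cnj z))" if "z \<in> N" "op_invertible (m z + \<tau> z)" for z
  proof -
    let ?C = "op_inv (m z + \<tau> z)"
    have lin: "clinear_op ?C"
      by (intro clinear_op_inv clinear_op_add clin that)
    note C = op_inv_apply[OF that(2)]
    have "op_adj ?C o\<^sub>L (m (cnj z) + \<tau> (cnj z)) = id_blinfun"
    proof (rule blinfun_eqI, rule cinner_ext)
      fix y x
      show "cinner x (blinfun_apply (op_adj ?C o\<^sub>L (m (cnj z) + \<tau> (cnj z))) y) = cinner x (blinfun_apply id_blinfun y)"
        by (simp add: op_adj[OF lin, symmetric] adj[OF that(1), symmetric] C del: plus_blinfun.rep_eq)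
    qed
    moreover have "(m (cnj z) + \<tau> (cnj z)) o\<^sub>L op_adj ?C = id_blinfun"
    proof (rule blinfun_eqI, rule cinner_ext)
      fix y x
      show "cinner x (blinfun_apply ((m (cnj z) + \<tau> (cnj z)) o\<^sub>L op_adj ?C) y) = cinner x (blinfun_apply id_blinfun y)"
        by (simp add: op_adj[OF lin, symmetric] adj[OF that(1), symmetric] C del: plus_blinfun.rep_eq)
    qed
    ultimately show ?thesis
      unfolding op_invertible_def by blast
  qed
  have Ninv: "op_invertible (m z + \<tau> z)" if "z \<in> N" for z
    using that P4'[of z] P4'[of "cnj z"] inv1[of "cnj z"] Ncnj[of z] by (auto simp: N_def)
  have NW: "z \<in> hdom W" "hval W z = W z" if z: "z \<in> N" for z
  proof -
    obtain s where s: "s > 0" "ball z s \<subseteq> N"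
      by (rule open_contains_subball[OF openN z])
    have nr: "z \<notin> \<real>"
      using N[OF z] by (simp add: P_def)
    have h: "op_holomorphic_at W u" if "u \<in> ball z s" for u
    proof -
      have u: "u \<in> N"
        using that s by blast
      have "\<forall>\<^sub>F v in at u. v \<in> N"
        using openN u by (meson eventually_at_topological)
      then have "\<forall>\<^sub>F v in at u. clinear_op (m v + \<tau> v)"
        by (rule eventually_mono) (intro clinear_op_add clin)
      then show ?thesis
        unfolding W_def using N[OF u] Ninv[OF u] clin[OF u]
        by (intro op_holomorphic_at_inv op_holomorphic_at_add clinear_op_add) (auto simp: P_def)
    qed
    show "z \<in> hdom W" "hval W z = W z"
      using op_holomorphic_at_hdom[OF s(1) h nr] by auto
  qed
  have good: "z \<notin> X \<and> z \<in> hdom m \<and> z \<in> hdom \<tau> \<and> z \<in> hdom W \<and>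
      (\<forall>x. blinfun_apply (hval W z) (blinfun_apply (hval m z) x + blinfun_apply (hval \<tau> z) x) = x) \<and>
      (\<forall>x. blinfun_apply (hval m z) (blinfun_apply (hval W z) x) + blinfun_apply (hval \<tau> z) (blinfun_apply (hval W z) x) = x)"
    if "z \<in> N" for z
    using Nval[OF that] NW[OF that] N[OF that] op_inv_apply[OF Ninv[OF that]]
    by (auto simp: P_def W_def blinfun.add_left)
  have w4: "Im w4 \<noteq> 0"
    using P4[of w4] w4(1) by (auto simp: P_def complex_is_Real_iff)
  \<comment> \<open>\<open>w4\<close> may lie in either half-plane, so the one of \<open>w4\<close>
    and its conjugate in the upper half-plane is taken; limiting the radius by \<open>Im w\<close>
    keeps the ball there.\<close>
  define w where "w = (if Im w4 > 0 then w4 else cnj w4)"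
  define r where "r = min s4 (Im w)"
  have w: "Im w > 0"
    using w4 by (auto simp: w_def)
  have ballN: "z \<in> N" if "z \<in> ball w r" for z
    using that cnj_ball[of z w4 s4] by (auto simp: w_def r_def N_def split: if_splits)
  show thesis
  proof (rule that[of r w])
    show "r > 0"
      using w \<open>s4 > 0\<close> by (simp add: r_def)
    show "Im z > 0" if "z \<in> ball w r" for z
    proof -
      have "\<bar>Im (w - z)\<bar> < Im w"
        using that abs_Im_le_cmod[of "w - z"] by (simp add: r_def dist_norm)
      then show ?thesis
        by simp
    qed
    show "z \<notin> X \<and> z \<in> hdom m \<and> z \<in> hdom \<tau> \<and> z \<in> hdom W \<and>
      (\<forall>x. blinfun_apply (hval W z) (blinfun_apply (hval m z) x + blinfun_apply (hval \<tau> z) x) = x) \<and>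
      (\<forall>x. blinfun_apply (hval m z) (blinfun_apply (hval W z) x) + blinfun_apply (hval \<tau> z) (blinfun_apply (hval W z) x) = x)"
      if "z \<in> ball w r \<or> cnj z \<in> ball w r" for z
    proof -
      have "z \<in> N"
        using that ballN[of z] ballN[of "cnj z"] Ncnj[of "cnj z"] by auto
      then show ?thesis
        by (rule good)
    qed
  qed
qed

section \<open>Minimal realisations and generalised values\<close>

lemma (in selfadjoint) minimal_relation_total:
  assumes min: "minimal_relation V ip A \<zeta>\<^sub>0 g" and g: "range g \<subseteq> V"
    and z: "z \<in> V" "\<And>\<zeta> x. \<zeta> \<in> \<rho> \<Longrightarrow> ip (defect_family A \<zeta>\<^sub>0 g \<zeta> x) z = 0"
  shows "z = 0"
proof (rule total_if_dense)
  let ?G = "{defect_family A \<zeta>\<^sub>0 g \<zeta> x |\<zeta> x. \<zeta> \<in> \<rho>}"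
  have "g x \<in> V" for x
    using g by blast
  then have G: "?G \<subseteq> V"
    by (auto simp: defect_family_def)
  show "cspan ?G \<subseteq> V"
    by (rule cspan_subset[OF G])
  have "V = pclosure V ip (cspan ?G)"
    using min unfolding minimal_relation_def by blast
  then show "\<exists>d\<in>cspan ?G. nrm (v - d) < e" if "v \<in> V" "e > 0" for v e
    using that unfolding pclosure_def pnorm_def by blast
  show "ip d z = 0" if "d \<in> cspan ?G" for d
    by (rule orthogonal_cspan[OF G z(1) _ that]) (use z(2) in auto)
qed (rule z(1))

locale realisation = selfadjoint V ip A
  for V :: "'v::complex_vector set" and ip :: "'v form" and A :: "('v \<times> 'v) set" +
  fixes Q :: "('g::complex_hilbert_space) opfun" and \<zeta>\<^sub>0 :: complex and g :: "'g \<Rightarrow> 'v"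
  assumes realisation: "minimal_realisation Q V ip A \<zeta>\<^sub>0 g" and Q: "Q \<in> gen_nevanlinna"
begin

abbreviation \<gamma> :: "complex \<Rightarrow> 'g \<Rightarrow> 'v" where "\<gamma> \<equiv> defect_family A \<zeta>\<^sub>0 g"
definition B0 :: "'g \<Rightarrow>\<^sub>L 'g" where "B0 = op_adj (hval Q \<zeta>\<^sub>0)"

lemma \<zeta>\<^sub>0: "\<zeta>\<^sub>0 \<in> \<rho>" "\<zeta>\<^sub>0 \<in> hdom Q" "Im \<zeta>\<^sub>0 > 0"
  using realisation by (auto simp: minimal_realisation_def)

lemma g_clinear: "clinear_on UNIV g" and g_range: "range g \<subseteq> V"
  using realisation by (auto simp: minimal_realisation_def bounded_map_into_def)

lemma g_bounded: obtains C where "C > 0" "\<And>x. nrm (g x) \<le> C * norm x"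
proof -
  obtain C where C: "\<And>x. nrm (g x) \<le> C * norm x"
    using realisation by (auto simp: minimal_realisation_def bounded_map_into_def pnorm_def)
  have "nrm (g x) \<le> (\<bar>C\<bar> + 1) * norm x" for x
    by (rule order_trans[OF C mult_right_mono]) auto
  then show thesis
    using that[of "\<bar>C\<bar> + 1"] by auto
qed

lemma g_mem [simp]: "g x \<in> V"
  using g_range by blast

lemma g_add: "g (x + y) = g x + g y" and g_scale: "g (c *\<^sub>C x) = c *\<^sub>C g x"
  using g_clinear by (auto simp: clinear_on_def)

lemma defect_mem [simp]: "\<zeta> \<in> \<rho> \<Longrightarrow> \<gamma> \<zeta> x \<in> V"
  by (simp add: defect_family_def)

lemma defect_base: "\<gamma> \<zeta>\<^sub>0 x = g x"
  by (simp add: defect_family_def)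

lemma defect_clinear: "\<zeta> \<in> \<rho> \<Longrightarrow> clinear_on UNIV (\<gamma> \<zeta>)"
  by (auto simp: clinear_on_def defect_family_def g_add g_scale resolvent_op_add resolvent_op_scale
      scaleC_add_right scaleC_scaleC mult.commute)

lemma defect_bounded:
  assumes "\<zeta> \<in> \<rho>"
  obtains C where "\<And>x. nrm (\<gamma> \<zeta> x) \<le> C * norm x"
proof -
  obtain C where C: "C > 0" "\<And>x. nrm (g x) \<le> C * norm x"
    by (rule g_bounded) (rule that)
  obtain D where D: "D > 0" "\<And>x. x \<in> V \<Longrightarrow> nrm (R \<zeta> x) \<le> D * nrm x"
    by (rule resolvent_op_bounded[OF assms]) (rule that)
  have "nrm (\<gamma> \<zeta> x) \<le> (C + cmod (\<zeta> - \<zeta>\<^sub>0) * (D * C)) * norm x" for x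
  proof -
    have "nrm (\<gamma> \<zeta> x) \<le> nrm (g x) + cmod (\<zeta> - \<zeta>\<^sub>0) * nrm (R \<zeta> (g x))"
      unfolding defect_family_def
      using H.nrm_triangle[of "g x" "(\<zeta> - \<zeta>\<^sub>0) *\<^sub>C R \<zeta> (g x)"] assms by simp
    also have "\<dots> \<le> C * norm x + cmod (\<zeta> - \<zeta>\<^sub>0) * (D * (C * norm x))"
    proof (intro add_mono mult_left_mono C(2))
      have "nrm (R \<zeta> (g x)) \<le> D * nrm (g x)"
        by (rule D(2)) simp
      also have "\<dots> \<le> D * (C * norm x)"
        using C(2) D(1) by (intro mult_left_mono) auto
      finally show "nrm (R \<zeta> (g x)) \<le> D * (C * norm x)" .
    qed simp
    finally show ?thesis
      by (simp add: algebra_simps)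
  qed
  then show thesis
    by (rule that)
qed

lemma cinner_padj_defect:
  assumes "\<zeta> \<in> \<rho>" "v \<in> V"
  shows "cinner (padj ip (\<gamma> \<zeta>) v) x = ip v (\<gamma> \<zeta> x)" "cinner x (padj ip (\<gamma> \<zeta>) v) = ip (\<gamma> \<zeta> x) v"
proof -
  obtain C where C: "\<And>x. nrm (\<gamma> \<zeta> x) \<le> C * norm x"
    by (rule defect_bounded[OF assms(1)]) (rule that)
  show *: "cinner (padj ip (\<gamma> \<zeta>) v) x = ip v (\<gamma> \<zeta> x)"
    by (rule cinner_padj[OF defect_clinear[OF assms(1)] _ C assms(2)]) (use assms in auto)
  show "cinner x (padj ip (\<gamma> \<zeta>) v) = ip (\<gamma> \<zeta> x) v"
    using * commute[of v "\<gamma> \<zeta> x"] assms cinner_commute[of x "padj ip (\<gamma> \<zeta>) v"]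
    by (metis cinner_commute defect_mem)
qed

lemma cinner_padj_g:
  assumes "v \<in> V"
  shows "cinner (padj ip g v) x = ip v (g x)" "cinner x (padj ip g v) = ip (g x) v"
proof -
  have "\<gamma> \<zeta>\<^sub>0 = g"
    by (simp add: fun_eq_iff defect_base)
  then show "cinner (padj ip g v) x = ip v (g x)" "cinner x (padj ip g v) = ip (g x) v"
    using cinner_padj_defect[OF \<zeta>\<^sub>0(1) assms] by auto
qed

lemma Q_expansion:
  assumes "\<zeta> \<in> \<rho>" "\<zeta> \<in> hdom Q"
  shows "cinner (blinfun_apply (hval Q \<zeta>) x) y = cinner (blinfun_apply B0 x) y + (\<zeta> - cnj \<zeta>\<^sub>0) * ip (\<gamma> \<zeta> x) (g y)"
proof -
  have "blinfun_apply (hval Q \<zeta>) x = blinfun_apply B0 x + (\<zeta> - cnj \<zeta>\<^sub>0) *\<^sub>C padj ip g (\<gamma> \<zeta> x)"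
    using realisation assms unfolding minimal_realisation_def B0_def by blast
  then show ?thesis
    using assms by (simp add: cinner_add_left cinner_scaleC_left cinner_padj_g)
qed

text \<open>The representation of \<open>Q\<close> evaluated at \<open>\<zeta>\<^sub>0\<close>
  itself. It lets later computations move the constant operator \<open>B0\<close> from one side of
  the inner product to the other.\<close>

lemma B0_commutator:
  "cinner (blinfun_apply B0 x) y - cinner x (blinfun_apply B0 y) = - (\<zeta>\<^sub>0 - cnj \<zeta>\<^sub>0) * ip (g x) (g y)"
proof -
  have "cinner (blinfun_apply (hval Q \<zeta>\<^sub>0) x) y = cinner x (blinfun_apply B0 y)"
    unfolding B0_def by (rule op_adj[OF gen_nevanlinnaD(2)[OF Q \<zeta>\<^sub>0(2)]])
  then have "cinner x (blinfun_apply B0 y) = cinner (blinfun_apply B0 x) y + (\<zeta>\<^sub>0 - cnj \<zeta>\<^sub>0) * ip (g x) (g y)"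
    using Q_expansion[OF \<zeta>\<^sub>0(1,2), of x y] by (simp add: defect_base)
  then show ?thesis
    by (simp add: algebra_simps)
qed

lemma defect_shift:
  assumes "\<mu> \<in> \<rho>" "\<nu> \<in> \<rho>"
  shows "(\<mu> - \<nu>) *\<^sub>C R \<nu> (\<gamma> \<mu> u) = \<gamma> \<mu> u - \<gamma> \<nu> u"
proof -
  have "(\<mu> - \<nu>) *\<^sub>C R \<nu> (\<gamma> \<mu> u) = (\<mu> - \<nu>) *\<^sub>C R \<nu> (g u) + (\<mu> - \<zeta>\<^sub>0) *\<^sub>C ((\<mu> - \<nu>) *\<^sub>C R \<nu> (R \<mu> (g u)))"
    using assms by (simp add: defect_family_def resolvent_op_add resolvent_op_scale scaleC_add_right
        scaleC_scaleC mult.commute)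
  also have "(\<mu> - \<nu>) *\<^sub>C R \<nu> (R \<mu> (g u)) = R \<mu> (g u) - R \<nu> (g u)"
    using resolvent_identity[OF assms(2,1), of "g u"]
    by (simp add: complex_vector.scale_left_diff_distrib algebra_simps)
  also have "(\<mu> - \<nu>) *\<^sub>C R \<nu> (g u) + (\<mu> - \<zeta>\<^sub>0) *\<^sub>C (R \<mu> (g u) - R \<nu> (g u)) = \<gamma> \<mu> u - \<gamma> \<nu> u"
    by (simp add: defect_family_def complex_vector.scale_right_diff_distrib
        complex_vector.scale_left_diff_distrib)
  finally show ?thesis .
qed

text \<open>The Nevanlinna kernel is recovered from the representation, in a form without
  denominators: at \<zeta> = cnj \<mu> it only expresses the symmetry of \<open>Q\<close>, and at
  all other points it determines the pairing of the defect vectors.\<close>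

lemma defect_kernel:
  assumes "\<zeta> \<in> \<rho>" "\<zeta> \<in> hdom Q" "\<mu> \<in> \<rho>" "\<mu> \<in> hdom Q"
  shows "(\<zeta> - cnj \<mu>) * ip (\<gamma> \<zeta> x) (\<gamma> \<mu> y) =
    cinner (blinfun_apply (hval Q \<zeta>) x) y - cinner x (blinfun_apply (hval Q \<mu>) y)"
proof -
  \<comment> \<open>Of these pairings only \<open>s\<close> contains two resolvents;
    \<open>resolvent_op_pairing\<close> reduces it to \<open>q\<close> and \<open>r\<close>.\<close>
  define p q r s where "p = ip (g x) (g y)" and "q = ip (R \<zeta> (g x)) (g y)"
    and "r = ip (g x) (R \<mu> (g y))" and "s = ip (R \<zeta> (g x)) (R \<mu> (g y))"
  have s: "(\<zeta> - cnj \<mu>) * s = q - r"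
    unfolding s_def q_def r_def by (rule resolvent_op_pairing) (use assms in auto)
  have Qz: "cinner (blinfun_apply (hval Q \<zeta>) x) y =
      cinner (blinfun_apply B0 x) y + (\<zeta> - cnj \<zeta>\<^sub>0) * (p + (\<zeta> - \<zeta>\<^sub>0) * q)"
    using Q_expansion[OF assms(1,2)] assms by (simp add: defect_family_def p_def q_def)
  have "cinner x (blinfun_apply (hval Q \<mu>) y) = cnj (cinner (blinfun_apply (hval Q \<mu>) y) x)"
    by (rule cinner_commute)
  also have "\<dots> = cnj (cinner (blinfun_apply B0 y) x) + (cnj \<mu> - \<zeta>\<^sub>0) * cnj (ip (\<gamma> \<mu> y) (g x))"
    unfolding Q_expansion[OF assms(3,4)] by simp
  also have "cnj (cinner (blinfun_apply B0 y) x) = cinner x (blinfun_apply B0 y)"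
    by (rule cinner_commute[symmetric])
  also have "cnj (ip (\<gamma> \<mu> y) (g x)) = ip (g x) (\<gamma> \<mu> y)"
    using commute[of "\<gamma> \<mu> y" "g x"] assms by simp
  finally have "cinner x (blinfun_apply (hval Q \<mu>) y) =
      cinner x (blinfun_apply B0 y) + (cnj \<mu> - \<zeta>\<^sub>0) * ip (g x) (\<gamma> \<mu> y)" .
  then have Qm: "cinner x (blinfun_apply (hval Q \<mu>) y) =
      cinner x (blinfun_apply B0 y) + (cnj \<mu> - \<zeta>\<^sub>0) * (p + (cnj \<mu> - cnj \<zeta>\<^sub>0) * r)"
    using assms by (simp add: defect_family_def p_def r_def)
  have lhs: "ip (\<gamma> \<zeta> x) (\<gamma> \<mu> y) = p + (cnj \<mu> - cnj \<zeta>\<^sub>0) * r + (\<zeta> - \<zeta>\<^sub>0) * (q + (cnj \<mu> - cnj \<zeta>\<^sub>0) * s)"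
    using assms by (simp add: defect_family_def p_def q_def r_def s_def algebra_simps)
  have "(\<zeta> - cnj \<mu>) * ip (\<gamma> \<zeta> x) (\<gamma> \<mu> y) =
      (\<zeta> - cnj \<mu>) * (p + (cnj \<mu> - cnj \<zeta>\<^sub>0) * r + (\<zeta> - \<zeta>\<^sub>0) * q)
        + (\<zeta> - \<zeta>\<^sub>0) * (cnj \<mu> - cnj \<zeta>\<^sub>0) * ((\<zeta> - cnj \<mu>) * s)"
    unfolding lhs by (simp add: algebra_simps)
  also have "\<dots> = (\<zeta> - cnj \<zeta>\<^sub>0) * (p + (\<zeta> - \<zeta>\<^sub>0) * q) - (cnj \<mu> - \<zeta>\<^sub>0) * (p + (cnj \<mu> - cnj \<zeta>\<^sub>0) * r)
      + (- (\<zeta>\<^sub>0 - cnj \<zeta>\<^sub>0) * p)"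
    unfolding s by (simp add: algebra_simps)
  also have "- (\<zeta>\<^sub>0 - cnj \<zeta>\<^sub>0) * p = cinner (blinfun_apply B0 x) y - cinner x (blinfun_apply B0 y)"
    unfolding p_def by (rule B0_commutator[symmetric])
  finally show ?thesis
    unfolding Qz Qm by simp
qed

lemma defect_resolvent_pairing:
  assumes "\<mu> \<in> \<rho>" "\<nu> \<in> \<rho>" "cnj \<nu> \<in> \<rho>" "v \<in> V"
  shows "(\<mu> - cnj \<nu>) * ip (\<gamma> \<mu> u) (R \<nu> v) = ip (\<gamma> \<mu> u) v - ip (\<gamma> (cnj \<nu>) u) v"
proof -
  have "ip (\<gamma> \<mu> u) (R \<nu> v) = ip (R (cnj \<nu>) (\<gamma> \<mu> u)) v"
    using resolvent_op_adjoint[of "cnj \<nu>" "\<gamma> \<mu> u" v] assms by simp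
  then have "(\<mu> - cnj \<nu>) * ip (\<gamma> \<mu> u) (R \<nu> v) = ip ((\<mu> - cnj \<nu>) *\<^sub>C R (cnj \<nu>) (\<gamma> \<mu> u)) v"
    using assms by simp
  then show ?thesis
    unfolding defect_shift[OF assms(1,3)] using assms by simp
qed

lemma defect_total:
  assumes "z \<in> V" "\<And>\<zeta> x. \<zeta> \<in> \<rho> \<Longrightarrow> ip (\<gamma> \<zeta> x) z = 0"
  shows "z = 0"
  using realisation assms by (intro minimal_relation_total[OF _ g_range]) (auto simp: minimal_realisation_def)

text \<open>\<open>k\<close> is one value at \<open>g x\<close> of the inverse of
  \<open>A - \<alpha>\<close>. At a spectral point such a value may be missing or not unique, hence
  the quantifier.\<close>

lemma value_iff:
  "(x, y) \<in> generalised_value Q V ip A \<zeta>\<^sub>0 g \<alpha> \<longleftrightarrow>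
    (\<exists>k. (k, g x + of_real \<alpha> *\<^sub>C k) \<in> A \<and>
      y = blinfun_apply B0 x + (of_real \<alpha> - cnj \<zeta>\<^sub>0) *\<^sub>C padj ip g (g x + (of_real \<alpha> - \<zeta>\<^sub>0) *\<^sub>C k))"
  (is "?L \<longleftrightarrow> ?R")
proof -
  have res: "(a, k) \<in> resolvent_rel A \<zeta> \<longleftrightarrow> (k, a + \<zeta> *\<^sub>C k) \<in> A" for a k \<zeta>
    unfolding resolvent_rel_def rel_shift_def by (force simp: algebra_simps)
  have add: "(a, b) \<in> rel_add (Id_on V) (rel_scale c (resolvent_rel A \<zeta>)) \<longleftrightarrow>
      (\<exists>k. a \<in> V \<and> (k, a + \<zeta> *\<^sub>C k) \<in> A \<and> b = a + c *\<^sub>C k)" for a b c \<zeta>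
    unfolding rel_add_def rel_scale_def res[symmetric] by auto
  have gr: "(a, b) \<in> rel_graph W f \<longleftrightarrow> a \<in> W \<and> b = f a" for a b and W :: "'x set" and f :: "'x \<Rightarrow> 'y"
    unfolding rel_graph_def by auto
  have comp: "(x, z) \<in> rel_graph UNIV g O rel_add (Id_on V) (rel_scale c (resolvent_rel A \<zeta>)) O rel_graph V (padj ip g)
      \<longleftrightarrow> (\<exists>k. (k, g x + \<zeta> *\<^sub>C k) \<in> A \<and> z = padj ip g (g x + c *\<^sub>C k))" for z c \<zeta>
    unfolding relcomp_unfold using A_mem by (auto simp: gr add)
  have "?L \<longleftrightarrow> (\<exists>z. (x, z) \<in> rel_graph UNIV g O rel_add (Id_on V)
        (rel_scale (of_real \<alpha> - \<zeta>\<^sub>0) (resolvent_rel A (of_real \<alpha>))) O rel_graph V (padj ip g)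
      \<and> y = blinfun_apply B0 x + (of_real \<alpha> - cnj \<zeta>\<^sub>0) *\<^sub>C z)"
    unfolding generalised_value_def rel_add_def[of "rel_graph UNIV (blinfun_apply (op_adj (hval Q \<zeta>\<^sub>0)))"]
      rel_scale_def[of "of_real \<alpha> - cnj \<zeta>\<^sub>0"] B0_def by (auto simp: gr)
  also have "\<dots> \<longleftrightarrow> ?R"
    unfolding comp by auto
  finally show ?thesis .
qed

end

section \<open>Boundary values of vectors of a model space at a real point\<close>

locale window =
  fixes U U' :: "complex set"
  assumes U: "open U" "U \<noteq> {}" "\<And>z. z \<in> U \<Longrightarrow> Im z > 0"
    and U': "open U'" "U' \<noteq> {}" "\<And>z. z \<in> U' \<Longrightarrow> Im z < 0"
    and not_conjugate: "z \<in> U \<union> U' \<Longrightarrow> cnj z \<notin> U \<union> U'"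

text \<open>All identities are used at points of the window \<open>U \<union> U'\<close> only.  As it does not contain
  conjugate points, the Nevanlinna kernel never has to be evaluated on its diagonal.\<close>

locale realisation_window = realisation V ip A Q \<zeta>\<^sub>0 g + window U U'
  for V :: "'v::complex_vector set" and ip A and Q :: "('g::complex_hilbert_space) opfun" and \<zeta>\<^sub>0 g U U' +
  assumes window: "z \<in> U \<union> U' \<Longrightarrow> z \<in> \<rho> \<and> cnj z \<in> \<rho> \<and> z \<in> hdom Q \<and> cnj z \<in> hdom Q"
begin

abbreviation \<Lambda> :: "complex set" where "\<Lambda> \<equiv> U \<union> U'"

lemma window_continuation:
  assumes "\<phi> holomorphic_on (\<rho> - \<real>)" "continuous_on \<rho> \<phi>" "\<And>z. z \<in> \<Lambda> \<Longrightarrow> \<phi> z = 0" "w \<in> \<rho>"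
  shows "\<phi> w = 0"
  by (rule continuation[OF \<zeta>\<^sub>0(1) assms(1,2) U _ U']) (use assms(3,4) in auto)

text \<open>Minimality speaks about all resolvent points; since pairings with defect vectors extend
  by \<open>window_continuation\<close>, the window alone is already total.\<close>

lemma window_total:
  assumes "z \<in> V" "\<And>\<mu> u. \<mu> \<in> \<Lambda> \<Longrightarrow> ip (\<gamma> \<mu> u) z = 0"
  shows "z = 0"
proof (rule defect_total[OF assms(1)])
  fix \<zeta> x assume z: "\<zeta> \<in> \<rho>"
  have eq: "ip (\<gamma> \<zeta> x) z = ip (g x) z + (\<zeta> - \<zeta>\<^sub>0) * ip (R \<zeta> (g x)) z" if "\<zeta> \<in> \<rho>" for \<zeta>
    using that assms(1) by (simp add: defect_family_def)
  have "ip (g x) z + (\<zeta> - \<zeta>\<^sub>0) * ip (R \<zeta> (g x)) z = 0"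
  proof (rule window_continuation[where \<phi> = "\<lambda>\<zeta>. ip (g x) z + (\<zeta> - \<zeta>\<^sub>0) * ip (R \<zeta> (g x)) z", OF _ _ _ z])
    show "(\<lambda>\<zeta>. ip (g x) z + (\<zeta> - \<zeta>\<^sub>0) * ip (R \<zeta> (g x)) z) holomorphic_on \<rho> - \<real>"
      by (intro holomorphic_intros resolvent_pairing_holomorphic[OF \<zeta>\<^sub>0(1)] g_mem assms(1))
    show "continuous_on \<rho> (\<lambda>\<zeta>. ip (g x) z + (\<zeta> - \<zeta>\<^sub>0) * ip (R \<zeta> (g x)) z)"
      by (intro continuous_intros resolvent_pairing_continuous g_mem assms(1))
    show "ip (g x) z + (\<mu> - \<zeta>\<^sub>0) * ip (R \<mu> (g x)) z = 0" if "\<mu> \<in> \<Lambda>" for \<mu>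
      using assms(2)[OF that, of x] eq[of \<mu>] window[OF that] by simp
  qed
  then show "ip (\<gamma> \<zeta> x) z = 0"
    using eq[OF z] by simp
qed

text \<open>Green's identity, paired with the defect vectors: \<open>f\<close> is a vector whose boundary
  values at the real point \<open>\<alpha>\<close> are \<open>x\<close> and \<open>y\<close>.\<close>

definition boundary_values :: "real \<Rightarrow> 'v \<Rightarrow> 'g \<Rightarrow> 'g \<Rightarrow> bool" where
  "boundary_values \<alpha> f x y \<longleftrightarrow> (\<forall>\<mu>\<in>\<Lambda>. \<forall>u.
     (of_real \<alpha> - \<mu>) * ip (\<gamma> \<mu> u) f = cinner u y - cinner (blinfun_apply (hval Q \<mu>) u) x)"

lemma real_ne: "of_real \<alpha> - \<zeta>\<^sub>0 \<noteq> 0" "of_real \<alpha> - cnj \<zeta>\<^sub>0 \<noteq> 0"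
  using \<zeta>\<^sub>0(3) by (auto simp: complex_eq_iff)

text \<open>\<open>f\<close> plays the role of the defect vector of \<open>x\<close> at \<alpha>,
  formed with one choice \<open>k\<close> of the resolvent value. The identity is
  \<open>defect_kernel\<close> with \<alpha> in place of a resolvent point, and the proof is the
  same computation.\<close>

lemma boundary_valuesI:
  assumes k: "(k, g x + of_real \<alpha> *\<^sub>C k) \<in> A" and f: "f = g x + (of_real \<alpha> - \<zeta>\<^sub>0) *\<^sub>C k"
    and y: "y = blinfun_apply B0 x + (of_real \<alpha> - cnj \<zeta>\<^sub>0) *\<^sub>C padj ip g f"
  shows "boundary_values \<alpha> f x y"
  unfolding boundary_values_def
proof (intro ballI allI)
  fix \<mu> u assume mu: "\<mu> \<in> \<Lambda>"
  let ?a = "complex_of_real \<alpha>"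
  have mr: "\<mu> \<in> \<rho>" "\<mu> \<in> hdom Q"
    using window[OF mu] by auto
  have kV: "k \<in> V"
    using A_mem[OF k] by simp
  have fV: "f \<in> V"
    using kV by (simp add: f)
  define p q r s where "p = ip (g u) (g x)" and "q = ip (R \<mu> (g u)) (g x)"
    and "r = ip (g u) k" and "s = ip (R \<mu> (g u)) k"
  have "ip (g u + \<mu> *\<^sub>C R \<mu> (g u)) k = ip (R \<mu> (g u)) (g x + ?a *\<^sub>C k)"
    by (rule A_symmetric[OF resolvent_op_in[OF mr(1) g_mem] k])
  then have s: "(?a - \<mu>) * s = r - q"
    using mr kV by (simp add: q_def r_def s_def algebra_simps)
  have lhs: "ip (\<gamma> \<mu> u) f = p + (\<mu> - \<zeta>\<^sub>0) * q + (?a - cnj \<zeta>\<^sub>0) * (r + (\<mu> - \<zeta>\<^sub>0) * s)"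
    using mr kV by (simp add: f defect_family_def p_def q_def r_def s_def algebra_simps)
  have rhs: "cinner u y = cinner u (blinfun_apply B0 x) + (?a - \<zeta>\<^sub>0) * (p + (?a - cnj \<zeta>\<^sub>0) * r)"
    unfolding y using fV kV
    by (simp add: cinner.add_right cinner.scale_right cinner_padj_g f p_def r_def)
  have Qm: "cinner (blinfun_apply (hval Q \<mu>) u) x =
      cinner (blinfun_apply B0 u) x + (\<mu> - cnj \<zeta>\<^sub>0) * (p + (\<mu> - \<zeta>\<^sub>0) * q)"
    using Q_expansion[OF mr, of u x] mr by (simp add: defect_family_def p_def q_def)
  have B: "cinner u (blinfun_apply B0 x) = cinner (blinfun_apply B0 u) x + (\<zeta>\<^sub>0 - cnj \<zeta>\<^sub>0) * p"
    using B0_commutator[of u x] unfolding p_def by (simp add: algebra_simps)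
  have "(?a - \<mu>) * ip (\<gamma> \<mu> u) f = (?a - \<mu>) * (p + (\<mu> - \<zeta>\<^sub>0) * q + (?a - cnj \<zeta>\<^sub>0) * r)
      + (?a - cnj \<zeta>\<^sub>0) * (\<mu> - \<zeta>\<^sub>0) * ((?a - \<mu>) * s)"
    unfolding lhs by (simp add: algebra_simps)
  also have "\<dots> = cinner u y - cinner (blinfun_apply (hval Q \<mu>) u) x"
    unfolding s rhs Qm B by (simp add: algebra_simps)
  finally show "(?a - \<mu>) * ip (\<gamma> \<mu> u) f = cinner u y - cinner (blinfun_apply (hval Q \<mu>) u) x" .
qed

text \<open>After solving for \<open>k\<close>, the identities on the window say that
  \<open>(\<alpha> - \<nu>) * ip (\<gamma> \<nu> u) k + ip (\<gamma> \<nu> u) (g x)\<close> does not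
  depend on \<nu>. This continues to all of \<rho>. Comparing \<nu> with a conjugate point
  \<open>cnj c\<close> places \<open>k\<close> in the resolvent relation at \<alpha>, and taking
  \<open>\<nu> = \<zeta>\<^sub>0\<close> identifies \<open>y\<close>.\<close>

lemma boundary_valuesD:
  assumes f: "f \<in> V" and bv: "boundary_values \<alpha> f x y"
  obtains k where "k \<in> V" "(k, g x + of_real \<alpha> *\<^sub>C k) \<in> A" "f = g x + (of_real \<alpha> - \<zeta>\<^sub>0) *\<^sub>C k"
    "y = blinfun_apply B0 x + (of_real \<alpha> - cnj \<zeta>\<^sub>0) *\<^sub>C padj ip g f"
proof -
  let ?a = "complex_of_real \<alpha>"
  define k where "k = (1 / (?a - \<zeta>\<^sub>0)) *\<^sub>C (f - g x)"
  have kV: "k \<in> V"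
    using f by (simp add: k_def)
  have fk: "f = g x + (?a - \<zeta>\<^sub>0) *\<^sub>C k"
    using real_ne[of \<alpha>] by (simp add: k_def scaleC_scaleC scaleC_one)
  \<comment> \<open>The common value, found by eliminating \<open>hval Q \<mu>\<close> with
    \<open>Q_expansion\<close>.\<close>
  define Y where "Y u = (cinner u y - cinner (blinfun_apply B0 u) x) / (?a - cnj \<zeta>\<^sub>0)" for u
  have const: "(?a - \<nu>) * ip (\<gamma> \<nu> u) k + ip (\<gamma> \<nu> u) (g x) = Y u" if nu: "\<nu> \<in> \<rho>" for \<nu> u
  proof -
    define \<phi> where "\<phi> \<nu> = (?a - \<nu>) * (ip (g u) k + (\<nu> - \<zeta>\<^sub>0) * ip (R \<nu> (g u)) k)
        + (ip (g u) (g x) + (\<nu> - \<zeta>\<^sub>0) * ip (R \<nu> (g u)) (g x)) - Y u" for \<nu>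
    have eq: "\<phi> \<nu> = (?a - \<nu>) * ip (\<gamma> \<nu> u) k + ip (\<gamma> \<nu> u) (g x) - Y u" if "\<nu> \<in> \<rho>" for \<nu>
      using that kV by (simp add: \<phi>_def defect_family_def)
    have "\<phi> \<nu> = 0"
    proof (rule window_continuation[OF _ _ _ nu])
      show "\<phi> holomorphic_on \<rho> - \<real>"
        unfolding \<phi>_def by (intro holomorphic_intros resolvent_pairing_holomorphic[OF \<zeta>\<^sub>0(1)] g_mem kV)
      show "continuous_on \<rho> \<phi>"
        unfolding \<phi>_def by (intro continuous_intros resolvent_pairing_continuous g_mem kV)
      show "\<phi> \<mu> = 0" if mu: "\<mu> \<in> \<Lambda>" for \<mu>
      proof -
        have mr: "\<mu> \<in> \<rho>" "\<mu> \<in> hdom Q"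
          using window[OF mu] by auto
        let ?K = "ip (\<gamma> \<mu> u) k" and ?G = "ip (\<gamma> \<mu> u) (g x)"
        have 1: "ip (\<gamma> \<mu> u) f = ?G + (?a - cnj \<zeta>\<^sub>0) * ?K"
          using mr kV by (simp add: fk)
        have "(?a - \<mu>) * ip (\<gamma> \<mu> u) f = cinner u y - cinner (blinfun_apply (hval Q \<mu>) u) x"
          using bv mu unfolding boundary_values_def by blast
        then have "(?a - \<mu>) * (?G + (?a - cnj \<zeta>\<^sub>0) * ?K) =
            cinner u y - cinner (blinfun_apply B0 u) x - (\<mu> - cnj \<zeta>\<^sub>0) * ?G"
          unfolding 1 Q_expansion[OF mr] by simp
        then have "(?a - cnj \<zeta>\<^sub>0) * ((?a - \<mu>) * ?K + ?G) = cinner u y - cinner (blinfun_apply B0 u) x"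
          by (simp add: algebra_simps)
        then have "(?a - \<mu>) * ?K + ?G = Y u"
          using real_ne[of \<alpha>] by (simp add: Y_def eq_divide_eq mult.commute)
        then show ?thesis
          unfolding eq[OF mr(1)] by simp
      qed
    qed
    then show ?thesis
      unfolding eq[OF nu] by simp
  qed
  \<comment> \<open>An auxiliary resolvent point. Its conjugate lies outside the window, so \<nu> -
    cnj c is nonzero for every \<nu> of the window.\<close>
  obtain c where c: "c \<in> U'"
    using U'(2) by blast
  then have cr: "c \<in> \<rho>" "cnj c \<in> \<rho>" "cnj c \<notin> \<Lambda>"
    using window[of c] not_conjugate[of c] by auto
  \<comment> \<open>If \<open>k\<close> is as claimed, then \<open>w\<close> is the value of
    \<open>A - c\<close> at \<open>k\<close>; so the claim becomes k = R c w, which totality can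
    test.\<close>
  define w where "w = g x + (?a - c) *\<^sub>C k"
  have w: "w \<in> V"
    using kV by (simp add: w_def)
  have "k - R c w = 0"
  proof (rule window_total)
    fix \<nu> u assume nu: "\<nu> \<in> \<Lambda>"
    have nr: "\<nu> \<in> \<rho>"
      using window[OF nu] by auto
    define K G K0 G0 where "K = ip (\<gamma> \<nu> u) k" and "G = ip (\<gamma> \<nu> u) (g x)"
      and "K0 = ip (\<gamma> (cnj c) u) k" and "G0 = ip (\<gamma> (cnj c) u) (g x)"
    have ne: "\<nu> - cnj c \<noteq> 0"
      using nu cr(3) by auto
    have 1: "(?a - \<nu>) * K + G = Y u" "(?a - cnj c) * K0 + G0 = Y u"
      unfolding K_def G_def K0_def G0_def by (rule const[OF nr], rule const[OF cr(2)])
    have "(\<nu> - cnj c) * ip (\<gamma> \<nu> u) (R c w) = ip (\<gamma> \<nu> u) w - ip (\<gamma> (cnj c) u) w"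
      by (rule defect_resolvent_pairing[OF nr cr(1,2) w])
    also have "\<dots> = G + (?a - cnj c) * K - (G0 + (?a - cnj c) * K0)"
      using nr cr kV by (simp add: w_def K_def G_def K0_def G0_def)
    also have "\<dots> = ((?a - \<nu>) * K + G) + (\<nu> - cnj c) * K - ((?a - cnj c) * K0 + G0)"
      by (simp add: algebra_simps)
    finally have "(\<nu> - cnj c) * ip (\<gamma> \<nu> u) (R c w) = (\<nu> - cnj c) * K"
      unfolding 1 by simp
    then have "ip (\<gamma> \<nu> u) (R c w) = K"
      using ne by simp
    then show "ip (\<gamma> \<nu> u) (k - R c w) = 0"
      using nr cr w kV by (simp add: K_def)
  qed (use kV w cr in simp)
  then have "(k, w + c *\<^sub>C k) \<in> A"
    using resolvent_op_in[OF cr(1) w] by simp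
  moreover have "w + c *\<^sub>C k = g x + ?a *\<^sub>C k"
    by (simp add: w_def complex_vector.scale_left_diff_distrib)
  ultimately have kA: "(k, g x + ?a *\<^sub>C k) \<in> A"
    by simp
  have "y = blinfun_apply B0 x + (?a - cnj \<zeta>\<^sub>0) *\<^sub>C padj ip g f"
  proof (rule cinner_ext)
    fix u
    define p r where "p = ip (g u) (g x)" and "r = ip (g u) k"
    have "(?a - \<zeta>\<^sub>0) * r + p = Y u"
      using const[OF \<zeta>\<^sub>0(1), of u] by (simp add: defect_base p_def r_def)
    then have Y: "cinner u y = cinner (blinfun_apply B0 u) x + (?a - cnj \<zeta>\<^sub>0) * ((?a - \<zeta>\<^sub>0) * r + p)"
      using real_ne[of \<alpha>] by (simp add: Y_def)
    have B: "cinner (blinfun_apply B0 u) x = cinner u (blinfun_apply B0 x) - (\<zeta>\<^sub>0 - cnj \<zeta>\<^sub>0) * p"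
      using B0_commutator[of u x] unfolding p_def by (simp add: algebra_simps)
    have "cinner u (blinfun_apply B0 x + (?a - cnj \<zeta>\<^sub>0) *\<^sub>C padj ip g f) =
        cinner u (blinfun_apply B0 x) + (?a - \<zeta>\<^sub>0) * (p + (?a - cnj \<zeta>\<^sub>0) * r)"
      using f kV by (simp add: cinner.add_right cinner.scale_right cinner_padj_g) (simp add: fk kV p_def r_def)
    then show "cinner u y = cinner u (blinfun_apply B0 x + (?a - cnj \<zeta>\<^sub>0) *\<^sub>C padj ip g f)"
      unfolding Y B by (simp add: algebra_simps)
  qed
  then show thesis
    using that kV kA fk by blast
qed

lemma value_iff_boundary_values:
  "(x, y) \<in> generalised_value Q V ip A \<zeta>\<^sub>0 g \<alpha> \<longleftrightarrow> (\<exists>f\<in>V. boundary_values \<alpha> f x y)"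
proof
  assume "(x, y) \<in> generalised_value Q V ip A \<zeta>\<^sub>0 g \<alpha>"
  then obtain k where k: "(k, g x + of_real \<alpha> *\<^sub>C k) \<in> A"
    "y = blinfun_apply B0 x + (of_real \<alpha> - cnj \<zeta>\<^sub>0) *\<^sub>C padj ip g (g x + (of_real \<alpha> - \<zeta>\<^sub>0) *\<^sub>C k)"
    unfolding value_iff by blast
  then have "boundary_values \<alpha> (g x + (of_real \<alpha> - \<zeta>\<^sub>0) *\<^sub>C k) x y"
    by (intro boundary_valuesI) auto
  moreover have "g x + (of_real \<alpha> - \<zeta>\<^sub>0) *\<^sub>C k \<in> V"
    using A_mem[OF k(1)] by simp
  ultimately show "\<exists>f\<in>V. boundary_values \<alpha> f x y"
    by blast
next
  assume "\<exists>f\<in>V. boundary_values \<alpha> f x y"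
  then obtain f where f: "f \<in> V" "boundary_values \<alpha> f x y"
    by blast
  obtain k where "(k, g x + of_real \<alpha> *\<^sub>C k) \<in> A" "f = g x + (of_real \<alpha> - \<zeta>\<^sub>0) *\<^sub>C k"
    "y = blinfun_apply B0 x + (of_real \<alpha> - cnj \<zeta>\<^sub>0) *\<^sub>C padj ip g f"
    by (rule boundary_valuesD[OF f]) (rule that)
  then show "(x, y) \<in> generalised_value Q V ip A \<zeta>\<^sub>0 g \<alpha>"
    unfolding value_iff by blast
qed

lemma boundary_values_inj:
  assumes "f \<in> V" "f' \<in> V" "boundary_values \<alpha> f x y" "boundary_values \<alpha> f' x y"
  shows "f = f'"
proof -
  have "f - f' = 0"
  proof (rule window_total)
    fix \<mu> u assume mu: "\<mu> \<in> \<Lambda>"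
    have ne: "of_real \<alpha> - \<mu> \<noteq> 0"
      using mu U(3)[of \<mu>] U'(3)[of \<mu>] by (auto simp: complex_eq_iff)
    have "(of_real \<alpha> - \<mu>) * ip (\<gamma> \<mu> u) f = (of_real \<alpha> - \<mu>) * ip (\<gamma> \<mu> u) f'"
      using assms(3,4) mu unfolding boundary_values_def by simp
    then show "ip (\<gamma> \<mu> u) (f - f') = 0"
      using ne assms(1,2) window[OF mu] by simp
  qed (use assms in simp)
  then show ?thesis
    by simp
qed

lemma boundary_values_add:
  assumes "f \<in> V" "f' \<in> V" "boundary_values \<alpha> f x y" "boundary_values \<alpha> f' x' y'"
  shows "boundary_values \<alpha> (f + f') (x + x') (y + y')"
  using assms window unfolding boundary_values_def
  by (simp add: distrib_left cinner.add_right)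

lemma boundary_values_scale:
  assumes "f \<in> V" "boundary_values \<alpha> f x y"
  shows "boundary_values \<alpha> (c *\<^sub>C f) (c *\<^sub>C x) (c *\<^sub>C y)"
  unfolding boundary_values_def
proof (intro ballI allI)
  fix \<mu> u assume mu: "\<mu> \<in> \<Lambda>"
  have "cnj c * ((of_real \<alpha> - \<mu>) * ip (\<gamma> \<mu> u) f) = cnj c * (cinner u y - cinner (blinfun_apply (hval Q \<mu>) u) x)"
    using assms(2) mu unfolding boundary_values_def by simp
  then show "(of_real \<alpha> - \<mu>) * ip (\<gamma> \<mu> u) (c *\<^sub>C f) = cinner u (c *\<^sub>C y) - cinner (blinfun_apply (hval Q \<mu>) u) (c *\<^sub>C x)"
    using assms(1) window[OF mu] by (simp add: cinner.scale_right algebra_simps)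
qed

end

text \<open>The source of the independence of the generalised value from the realisation:
  \<open>defect_kernel\<close> gives the defect vectors of both realisations the same Gram matrix,
  and \<open>isometric_transfer\<close> moves \<open>f\<close>. The two model spaces may have
  different types.\<close>

lemma boundary_values_transfer:
  fixes Q :: "('g::complex_hilbert_space) opfun"
    and V :: "'v::complex_vector set" and W :: "'w::complex_vector set"
  assumes "realisation_window V ip A Q \<zeta> g U U'" "realisation_window W ip' A' Q \<zeta>' g' U U'"
    and f: "f \<in> V" "realisation_window.boundary_values ip A Q \<zeta> g U U' \<alpha> f x y"
  obtains f' where "f' \<in> W" "realisation_window.boundary_values ip' A' Q \<zeta>' g' U U' \<alpha> f' x y"
proof -
  interpret A: realisation_window V ip A Q \<zeta> g U U' by fact
  interpret B: realisation_window W ip' A' Q \<zeta>' g' U U' by fact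
  obtain f' where f': "f' \<in> W" "\<And>i. i \<in> (U \<union> U') \<times> UNIV \<Longrightarrow>
      ip f (case_prod A.\<gamma> i) = ip' f' (case_prod B.\<gamma> i)"
  proof (rule isometric_transfer[OF A.pontryagin_carrier_axioms B.pontryagin_carrier_axioms,
        of "(U \<union> U') \<times> (UNIV :: 'g set)" "case_prod A.\<gamma>" "case_prod B.\<gamma>" f])
    fix i j assume ij: "i \<in> (U \<union> U') \<times> (UNIV :: 'g set)" "j \<in> (U \<union> U') \<times> (UNIV :: 'g set)"
    obtain \<mu> u \<nu> v where eq: "i = (\<mu>, u)" "j = (\<nu>, v)"
      by (cases i, cases j) auto
    then have mem: "\<mu> \<in> U \<union> U'" "\<nu> \<in> U \<union> U'"
      using ij by auto
    have ne: "\<mu> - cnj \<nu> \<noteq> 0"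
      using A.not_conjugate[OF mem(2)] mem(1) by auto
    have "(\<mu> - cnj \<nu>) * ip (A.\<gamma> \<mu> u) (A.\<gamma> \<nu> v) = (\<mu> - cnj \<nu>) * ip' (B.\<gamma> \<mu> u) (B.\<gamma> \<nu> v)"
      using A.defect_kernel B.defect_kernel A.window[OF mem(1)] A.window[OF mem(2)]
        B.window[OF mem(1)] B.window[OF mem(2)] by simp
    then show "ip (case_prod A.\<gamma> i) (case_prod A.\<gamma> j) = ip' (case_prod B.\<gamma> i) (case_prod B.\<gamma> j)"
      using ne by (simp add: eq)
  next
    show "z = 0" if "z \<in> V" "\<And>i. i \<in> (U \<union> U') \<times> UNIV \<Longrightarrow> ip (case_prod A.\<gamma> i) z = 0" for z
      using A.window_total[OF that(1)] that(2) by force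
    show "z = 0" if "z \<in> W" "\<And>i. i \<in> (U \<union> U') \<times> UNIV \<Longrightarrow> ip' (case_prod B.\<gamma> i) z = 0" for z
      using B.window_total[OF that(1)] that(2) by force
  next
    show "case_prod A.\<gamma> i \<in> V" if "i \<in> (U \<union> U') \<times> UNIV" for i
      using that A.window by auto
    show "case_prod B.\<gamma> i \<in> W" if "i \<in> (U \<union> U') \<times> UNIV" for i
      using that B.window by auto
  qed (rule f(1), rule that)
  have pair: "ip (A.\<gamma> \<mu> u) f = ip' (B.\<gamma> \<mu> u) f'" if "\<mu> \<in> U \<union> U'" for \<mu> u
    using f'(2)[of "(\<mu>, u)"] that A.window[OF that] B.window[OF that] f(1) f'(1)
      A.commute[of f "A.\<gamma> \<mu> u"] B.commute[of f' "B.\<gamma> \<mu> u"] by simp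
  have "B.boundary_values \<alpha> f' x y"
    using f(2) unfolding A.boundary_values_def B.boundary_values_def by (simp add: pair)
  then show thesis
    using that f'(1) by blast
qed

section \<open>The coupling of the two realisations\<close>

text \<open>By Krein's formula, the vectors \<open>h\<close> and \<open>(At - \<mu>)\<^sup>-\<^sup>1 h\<close> with \<open>h\<close> in \<open>V\<close> have the same
  Gram matrix as the vectors \<open>a_vec\<close> and \<open>b_vec\<close> in the orthogonal sum of \<open>V\<close> and the model
  space of \<open>\<tau>\<close>.\<close>

locale coupling =
  M: realisation_window V ip A m \<zeta>\<^sub>0 g U U' +
  T: realisation_window V\<^sub>\<tau> ip\<^sub>\<tau> A\<^sub>\<tau> \<tau> \<zeta>\<^sub>\<tau> g\<^sub>\<tau> U U' +
  E: selfadjoint Vt ip At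
  for V :: "'v::complex_vector set" and ip A and m :: "('g::complex_hilbert_space) opfun" and \<zeta>\<^sub>0 g U U'
    and V\<^sub>\<tau> :: "'b::complex_vector set" and ip\<^sub>\<tau> A\<^sub>\<tau> and \<tau> :: "'g opfun"
    and \<zeta>\<^sub>\<tau> g\<^sub>\<tau> and Vt At +
  fixes S :: "('v \<times> 'v) set" and C :: "complex \<Rightarrow> 'g \<Rightarrow>\<^sub>L 'g"
  assumes V_subset: "V \<subseteq> Vt" and S_subset: "S \<subseteq> A"
    and defect_inj: "\<zeta> \<in> M.\<rho> \<Longrightarrow> M.\<gamma> \<zeta> u = 0 \<Longrightarrow> u = 0"
    and defect_range: "\<zeta> \<in> M.\<rho> \<Longrightarrow> range (M.\<gamma> \<zeta>) = rel_ker (rel_adj V ip S) \<zeta>"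
    and At_resolvent: "z \<in> U \<union> U' \<Longrightarrow> z \<in> E.\<rho> \<and> cnj z \<in> E.\<rho>"
    and C: "z \<in> U \<union> U' \<or> cnj z \<in> U \<union> U' \<Longrightarrow>
        blinfun_apply (C z) (blinfun_apply (hval m z) u + blinfun_apply (hval \<tau> z) u) = u"
      "z \<in> U \<union> U' \<or> cnj z \<in> U \<union> U' \<Longrightarrow>
        blinfun_apply (hval m z) (blinfun_apply (C z) u) + blinfun_apply (hval \<tau> z) (blinfun_apply (C z) u) = u"
    and krein: "z \<in> U \<union> U' \<Longrightarrow> h \<in> V \<Longrightarrow> h' \<in> V \<Longrightarrow>
        ip (E.R z h) h' = ip (M.R z h - M.\<gamma> z (blinfun_apply (C z) (padj ip (M.\<gamma> (cnj z)) h))) h'"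
    and E_total: "v \<in> Vt \<Longrightarrow> (\<And>\<zeta> u. \<zeta> \<in> E.\<rho> \<Longrightarrow> ip (defect_family At \<zeta>\<^sub>0 g \<zeta> u) v = 0) \<Longrightarrow> v = 0"
begin

section \<open>The parameters in Krein's formula and the two Gram matrices\<close>

definition P :: "complex \<Rightarrow> 'v \<Rightarrow> 'g" where "P \<mu> h = padj ip (M.\<gamma> (cnj \<mu>)) h"
text \<open>The parameter whose defect vector \<open>M.\<gamma> \<mu> (Z \<mu> h)\<close> Krein's
  formula subtracts from the resolvent of \<open>A\<close>.\<close>

definition Z :: "complex \<Rightarrow> 'v \<Rightarrow> 'g" where "Z \<mu> h = blinfun_apply (C \<mu>) (P \<mu> h)"

lemma P_pairing:
  assumes "\<mu> \<in> M.\<Lambda>" "h \<in> V"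
  shows "cinner (P \<mu> h) u = ip h (M.\<gamma> (cnj \<mu>) u)" "cinner u (P \<mu> h) = ip (M.\<gamma> (cnj \<mu>) u) h"
  unfolding P_def using M.window[OF assms(1)] assms(2) by (intro M.cinner_padj_defect; simp)+

lemma Z_eq: "\<mu> \<in> M.\<Lambda> \<Longrightarrow> blinfun_apply (hval m \<mu>) (Z \<mu> h) + blinfun_apply (hval \<tau> \<mu>) (Z \<mu> h) = P \<mu> h"
  unfolding Z_def by (rule C(2)) simp

lemma window_nonreal: "\<mu> \<in> M.\<Lambda> \<Longrightarrow> \<mu> \<notin> \<real>"
  using M.U(3)[of \<mu>] M.U'(3)[of \<mu>] by (auto simp: complex_is_Real_iff)

text \<open>The adjoint of an inverse: \<open>a\<close> and \<open>b\<close> are written as values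
  of \<open>m + \<tau>\<close> at conjugate points, and \<open>m\<close> and \<tau> are moved across
  the inner product.\<close>

lemma C_adjoint:
  assumes mu: "\<mu> \<in> M.\<Lambda>"
  shows "cinner (blinfun_apply (C \<mu>) a) b = cinner a (blinfun_apply (C (cnj \<mu>)) b)"
proof -
  define x y where "x = blinfun_apply (C \<mu>) a" and "y = blinfun_apply (C (cnj \<mu>)) b"
  have a: "a = blinfun_apply (hval m \<mu>) x + blinfun_apply (hval \<tau> \<mu>) x"
    unfolding x_def by (rule C(2)[symmetric]) (use mu in simp)
  have b: "b = blinfun_apply (hval m (cnj \<mu>)) y + blinfun_apply (hval \<tau> (cnj \<mu>)) y"
    unfolding y_def by (rule C(2)[symmetric]) (use mu in simp)
  have "cinner x b = cinner a y"
    unfolding a b using hval_adjoint[OF M.Q _ window_nonreal[OF mu], of x y]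
      hval_adjoint[OF T.Q _ window_nonreal[OF mu], of x y] M.window[OF mu] T.window[OF mu]
    by (simp add: cinner_add_left cinner.add_right)
  then show ?thesis
    by (simp add: x_def y_def)
qed

text \<open>Density of the parameters, dual to the injectivity of the defect map: \<open>d\<close>
  orthogonal to all of them makes the defect vector of \<open>C (cnj \<mu>) d\<close> orthogonal to
  \<open>V\<close>. Identities for arbitrary parameters are deduced from those for parameters
  \<open>Z \<mu> h\<close>.\<close>

lemma Z_dense:
  assumes mu: "\<mu> \<in> M.\<Lambda>" and d: "\<And>h. h \<in> V \<Longrightarrow> cinner (Z \<mu> h) d = 0"
  shows "d = 0"
proof -
  let ?d = "blinfun_apply (C (cnj \<mu>)) d"
  have cr: "cnj \<mu> \<in> M.\<rho>"
    using M.window[OF mu] by simp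
  have "M.\<gamma> (cnj \<mu>) ?d = 0"
  proof (rule M.nondegenerate)
    fix h assume h: "h \<in> V"
    have "ip h (M.\<gamma> (cnj \<mu>) ?d) = cinner (P \<mu> h) ?d"
      using P_pairing(1)[OF mu h] by simp
    also have "\<dots> = cinner (Z \<mu> h) d"
      unfolding Z_def by (rule C_adjoint[OF mu, symmetric])
    finally show "ip h (M.\<gamma> (cnj \<mu>) ?d) = 0"
      using d[OF h] by simp
  qed (use cr in simp)
  then have "?d = 0"
    by (rule defect_inj[OF cr])
  then show ?thesis
    using C(2)[of "cnj \<mu>" d] mu by simp
qed

abbreviation W :: "('v \<times> 'b) set" where "W \<equiv> V \<times> V\<^sub>\<tau>"
abbreviation ipW :: "('v \<times> 'b) form" where "ipW \<equiv> sum_form ip ip\<^sub>\<tau>"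

definition idx :: "('v + complex \<times> 'v) set" where
  "idx = Inl ` V \<union> Inr ` (M.\<Lambda> \<times> V)"
definition a_vec :: "'v + complex \<times> 'v \<Rightarrow> 'v" where
  "a_vec i = (case i of Inl h \<Rightarrow> h | Inr (\<mu>, h) \<Rightarrow> E.R \<mu> h)"
text \<open>The first component is the compressed resolvent of Krein's formula, the second the
  defect vector of \<tau> with the same parameter. The minus sign lets the two components of an
  eigenvector share the boundary value \<open>x\<close>.\<close>

definition b_vec :: "'v + complex \<times> 'v \<Rightarrow> 'v \<times> 'b" where
  "b_vec i = (case i of Inl h \<Rightarrow> (h, 0)
     | Inr (\<mu>, h) \<Rightarrow> (M.R \<mu> h - M.\<gamma> \<mu> (Z \<mu> h), - T.\<gamma> \<mu> (Z \<mu> h)))"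

lemma a_mem: "i \<in> idx \<Longrightarrow> a_vec i \<in> Vt"
  using V_subset At_resolvent by (auto simp: idx_def a_vec_def)

lemma b_mem: "i \<in> idx \<Longrightarrow> b_vec i \<in> W"
  using M.window T.window by (auto simp: idx_def b_vec_def)

text \<open>Both sides are compared after multiplication by \<mu> - cnj \<nu>, which is nonzero on
  the window. The left side then involves only compressions to \<open>V\<close>, known from
  \<open>krein\<close>.\<close>

lemma gram_resolvents:
  assumes mu: "\<mu> \<in> M.\<Lambda>" and nu: "\<nu> \<in> M.\<Lambda>" and h: "h \<in> V" "h' \<in> V"
  shows "ip (E.R \<mu> h) (E.R \<nu> h') = ipW (b_vec (Inr (\<mu>, h))) (b_vec (Inr (\<nu>, h')))"
proof -
  have hV: "h \<in> Vt" "h' \<in> Vt"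
    using h V_subset by auto
  have mr: "\<mu> \<in> M.\<rho>" "cnj \<mu> \<in> M.\<rho>" "\<mu> \<in> hdom m" "\<mu> \<in> T.\<rho>" "\<mu> \<in> hdom \<tau>" "\<mu> \<in> E.\<rho>"
    using M.window[OF mu] T.window[OF mu] At_resolvent[OF mu] by auto
  have nr: "\<nu> \<in> M.\<rho>" "cnj \<nu> \<in> M.\<rho>" "\<nu> \<in> hdom m" "\<nu> \<in> T.\<rho>" "\<nu> \<in> hdom \<tau>" "\<nu> \<in> E.\<rho>"
    using M.window[OF nu] T.window[OF nu] At_resolvent[OF nu] by auto
  have ne: "\<mu> - cnj \<nu> \<noteq> 0"
    using M.not_conjugate[OF nu] mu by auto
  define z z' where "z = Z \<mu> h" and "z' = Z \<nu> h'"
  have "ip h (E.R \<nu> h') = ip h (M.R \<nu> h' - M.\<gamma> \<nu> z')"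
    using krein[OF nu h(2,1)] E.commute[of "E.R \<nu> h'" h] nr hV h
      M.commute[of "M.R \<nu> h' - M.\<gamma> \<nu> z'" h]
    by (simp add: z'_def Z_def P_def del: M.diff_left M.diff_right E.diff_left E.diff_right)
  then have "(\<mu> - cnj \<nu>) * ip (E.R \<mu> h) (E.R \<nu> h') =
      ip (M.R \<mu> h - M.\<gamma> \<mu> z) h' - ip h (M.R \<nu> h' - M.\<gamma> \<nu> z')"
    using E.resolvent_op_pairing[OF mr(6) nr(6) hV] krein[OF mu h] by (simp add: z_def Z_def P_def)
  also have "\<dots> = (ip (M.R \<mu> h) h' - ip h (M.R \<nu> h')) - ip (M.\<gamma> \<mu> z) h' + ip h (M.\<gamma> \<nu> z')"
    using mr nr h by simp
  finally have lhs: "(\<mu> - cnj \<nu>) * ip (E.R \<mu> h) (E.R \<nu> h') =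
      (ip (M.R \<mu> h) h' - ip h (M.R \<nu> h')) - ip (M.\<gamma> \<mu> z) h' + ip h (M.\<gamma> \<nu> z')" .
  have 1: "(\<mu> - cnj \<nu>) * ip (M.R \<mu> h) (M.R \<nu> h') = ip (M.R \<mu> h) h' - ip h (M.R \<nu> h')"
    by (rule M.resolvent_op_pairing[OF mr(1) nr(1) h])
  have 2: "(\<mu> - cnj \<nu>) * ip (M.\<gamma> \<mu> z) (M.R \<nu> h') = ip (M.\<gamma> \<mu> z) h' - cinner z (P \<nu> h')"
    unfolding P_pairing(2)[OF nu h(2)] by (rule M.defect_resolvent_pairing[OF mr(1) nr(1,2) h(2)])
  have "cnj ((\<nu> - cnj \<mu>) * ip (M.\<gamma> \<nu> z') (M.R \<mu> h)) = cnj (ip (M.\<gamma> \<nu> z') h - ip (M.\<gamma> (cnj \<mu>) z') h)"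
    by (simp only: M.defect_resolvent_pairing[OF nr(1) mr(1,2) h(1)])
  then have 3: "(\<mu> - cnj \<nu>) * ip (M.R \<mu> h) (M.\<gamma> \<nu> z') = cinner (P \<mu> h) z' - ip h (M.\<gamma> \<nu> z')"
    unfolding P_pairing(1)[OF mu h(1)] using M.commute[of "M.\<gamma> \<nu> z'" "M.R \<mu> h"]
      M.commute[of "M.\<gamma> \<nu> z'" h] M.commute[of "M.\<gamma> (cnj \<mu>) z'" h] mr nr h by (simp add: algebra_simps)
  \<comment> \<open>The kernels of \<open>m\<close> and \<tau> add up to that of
    \<open>m + \<tau>\<close>, which sends \<open>Z\<close> to \<open>P\<close>. The resulting terms
    cancel those contributed by 2 and 3.\<close>
  have 4: "(\<mu> - cnj \<nu>) * ip (M.\<gamma> \<mu> z) (M.\<gamma> \<nu> z') + (\<mu> - cnj \<nu>) * ip\<^sub>\<tau> (T.\<gamma> \<mu> z) (T.\<gamma> \<nu> z') =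
      cinner (P \<mu> h) z' - cinner z (P \<nu> h')"
    unfolding M.defect_kernel[OF mr(1,3) nr(1,3)] T.defect_kernel[OF mr(4,5) nr(4,5)]
      Z_eq[OF mu, of h, symmetric] Z_eq[OF nu, of h', symmetric] z_def z'_def
    by (simp add: cinner_add_left cinner.add_right)
  have "(\<mu> - cnj \<nu>) * ipW (b_vec (Inr (\<mu>, h))) (b_vec (Inr (\<nu>, h'))) =
     (\<mu> - cnj \<nu>) * ip (M.R \<mu> h) (M.R \<nu> h') - (\<mu> - cnj \<nu>) * ip (M.\<gamma> \<mu> z) (M.R \<nu> h')
     - (\<mu> - cnj \<nu>) * ip (M.R \<mu> h) (M.\<gamma> \<nu> z')
     + ((\<mu> - cnj \<nu>) * ip (M.\<gamma> \<mu> z) (M.\<gamma> \<nu> z') + (\<mu> - cnj \<nu>) * ip\<^sub>\<tau> (T.\<gamma> \<mu> z) (T.\<gamma> \<nu> z'))"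
    using mr nr h by (simp add: b_vec_def sum_form_def z_def[symmetric] z'_def[symmetric] algebra_simps)
  also have "\<dots> = (\<mu> - cnj \<nu>) * ip (E.R \<mu> h) (E.R \<nu> h')"
    unfolding 1 2 3 4 lhs by simp
  finally show ?thesis
    using ne by simp
qed

lemma gram_mixed:
  assumes mu: "\<mu> \<in> M.\<Lambda>" and h: "h \<in> V" "h' \<in> V"
  shows "ip (E.R \<mu> h) h' = ipW (b_vec (Inr (\<mu>, h))) (b_vec (Inl h'))"
  using krein[OF mu h] T.window[OF mu] by (simp add: b_vec_def sum_form_def Z_def P_def)

lemma W_pontryagin: "pontryagin_carrier W ipW (sum_form (majorant V ip) (majorant V\<^sub>\<tau> ip\<^sub>\<tau>))"
  by (rule pontryagin_carrier_sum[OF M.pontryagin_carrier_axioms T.pontryagin_carrier_axioms])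

sublocale W: pontryagin_carrier W ipW "sum_form (majorant V ip) (majorant V\<^sub>\<tau> ip\<^sub>\<tau>)"
  by (rule W_pontryagin)

lemma gram: "i \<in> idx \<Longrightarrow> j \<in> idx \<Longrightarrow> ip (a_vec i) (a_vec j) = ipW (b_vec i) (b_vec j)"
proof -
  assume i: "i \<in> idx" and j: "j \<in> idx"
  consider h h' where "i = Inl h" "j = Inl h'" "h \<in> V" "h' \<in> V"
    | \<mu> h h' where "i = Inr (\<mu>, h)" "j = Inl h'" "\<mu> \<in> M.\<Lambda>" "h \<in> V" "h' \<in> V"
    | \<nu> h h' where "i = Inl h'" "j = Inr (\<nu>, h)" "\<nu> \<in> M.\<Lambda>" "h \<in> V" "h' \<in> V"
    | \<mu> h \<nu> h' where "i = Inr (\<mu>, h)" "j = Inr (\<nu>, h')" "\<mu> \<in> M.\<Lambda>" "\<nu> \<in> M.\<Lambda>" "h \<in> V" "h' \<in> V"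
    using i j unfolding idx_def by blast
  then show ?thesis
  proof cases
    case 1
    then show ?thesis
      by (simp add: a_vec_def b_vec_def sum_form_def)
  next
    case 2
    then show ?thesis
      using gram_mixed by (simp add: a_vec_def)
  next
    case 3
    have "ip (a_vec j) (a_vec i) = ipW (b_vec j) (b_vec i)"
      using 3 gram_mixed by (simp add: a_vec_def)
    then show ?thesis
      using E.commute[OF a_mem[OF j] a_mem[OF i]] W.commute[OF b_mem[OF j] b_mem[OF i]] by simp
  next
    case 4
    then show ?thesis
      using gram_resolvents by (simp add: a_vec_def)
  qed
qed

lemma E_continuation:
  assumes "\<phi> holomorphic_on (E.\<rho> - \<real>)" "continuous_on E.\<rho> \<phi>" "\<And>z. z \<in> M.\<Lambda> \<Longrightarrow> \<phi> z = 0" "w \<in> E.\<rho>"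
  shows "\<phi> w = 0"
  by (rule E.continuation[OF assms(4,1,2) M.U _ M.U']) (use assms(3,4) in auto)

text \<open>Minimality of \<open>At\<close> concerns all of its resolvent points; continuation
  reduces it to resolvents at window points.\<close>

lemma a_total:
  assumes v: "v \<in> Vt" and orth: "\<And>i. i \<in> idx \<Longrightarrow> ip (a_vec i) v = 0"
  shows "v = 0"
proof (rule E_total[OF v])
  fix \<zeta> u assume z: "\<zeta> \<in> E.\<rho>"
  have gV: "g u \<in> Vt"
    using V_subset M.g_mem by blast
  have "ip (g u) v + (\<zeta> - \<zeta>\<^sub>0) * ip (E.R \<zeta> (g u)) v = 0"
  proof (rule E_continuation[where \<phi> = "\<lambda>\<zeta>. ip (g u) v + (\<zeta> - \<zeta>\<^sub>0) * ip (E.R \<zeta> (g u)) v", OF _ _ _ z])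
    show "(\<lambda>\<zeta>. ip (g u) v + (\<zeta> - \<zeta>\<^sub>0) * ip (E.R \<zeta> (g u)) v) holomorphic_on E.\<rho> - \<real>"
      by (intro holomorphic_intros E.resolvent_pairing_holomorphic[OF z] gV v)
    show "continuous_on E.\<rho> (\<lambda>\<zeta>. ip (g u) v + (\<zeta> - \<zeta>\<^sub>0) * ip (E.R \<zeta> (g u)) v)"
      by (intro continuous_intros E.resolvent_pairing_continuous gV v)
    show "ip (g u) v + (\<mu> - \<zeta>\<^sub>0) * ip (E.R \<mu> (g u)) v = 0" if mu: "\<mu> \<in> M.\<Lambda>" for \<mu>
      using orth[of "Inl (g u)"] orth[of "Inr (\<mu>, g u)"] mu by (simp add: idx_def a_vec_def)
  qed
  then show "ip (defect_family At \<zeta>\<^sub>0 g \<zeta> u) v = 0"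
    using z gV v by (simp add: defect_family_def)
qed

text \<open>The vectors \<open>Inl h\<close> force the first component to vanish. The second is then
  orthogonal to the \<tau>-defect vectors with parameters \<open>Z \<mu> h\<close>, and by
  \<open>Z_dense\<close> to those with any parameter.\<close>

lemma b_total:
  assumes w: "w \<in> W" and orth: "\<And>i. i \<in> idx \<Longrightarrow> ipW (b_vec i) w = 0"
  shows "w = 0"
proof -
  obtain f k where fk: "w = (f, k)" "f \<in> V" "k \<in> V\<^sub>\<tau>"
    using w by auto
  have "f = 0"
  proof (rule M.nondegenerate[OF fk(2)])
    fix h assume "h \<in> V"
    then show "ip h f = 0"
      using orth[of "Inl h"] fk by (simp add: idx_def b_vec_def sum_form_def)
  qed
  moreover have "k = 0"
  proof (rule T.window_total[OF fk(3)])
    fix \<mu> u assume mu: "\<mu> \<in> T.\<Lambda>"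
    have mr: "\<mu> \<in> T.\<rho>" "\<mu> \<in> M.\<rho>"
      using T.window[OF mu] M.window[OF mu] by auto
    let ?d = "padj ip\<^sub>\<tau> (T.\<gamma> \<mu>) k"
    have "?d = 0"
    proof (rule Z_dense[OF mu])
      fix h assume h: "h \<in> V"
      have "ip\<^sub>\<tau> (T.\<gamma> \<mu> (Z \<mu> h)) k = 0"
        using orth[of "Inr (\<mu>, h)"] fk \<open>f = 0\<close> mu h mr by (simp add: idx_def b_vec_def sum_form_def)
      then show "cinner (Z \<mu> h) ?d = 0"
        using T.cinner_padj_defect(2)[OF mr(1) fk(3)] by simp
    qed
    then show "ip\<^sub>\<tau> (T.\<gamma> \<mu> u) k = 0"
      using T.cinner_padj_defect(2)[OF mr(1) fk(3), of u] by simp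
  qed
  ultimately show ?thesis
    using fk by (simp add: zero_prod_def)
qed

text \<open>The graph of the unitary map between the space of \<open>At\<close> and the orthogonal
  sum. Existence in both directions comes from \<open>isometric_transfer\<close>, uniqueness from
  totality.\<close>

definition corresponds :: "'v \<Rightarrow> 'v \<times> 'b \<Rightarrow> bool" where
  "corresponds v w \<longleftrightarrow> v \<in> Vt \<and> w \<in> W \<and> (\<forall>i\<in>idx. ip (a_vec i) v = ipW (b_vec i) w)"

lemma corresponds_ex: "v \<in> Vt \<Longrightarrow> \<exists>w. corresponds v w"
proof -
  assume v: "v \<in> Vt"
  obtain w where w: "w \<in> W" "\<And>i. i \<in> idx \<Longrightarrow> ip v (a_vec i) = ipW w (b_vec i)"
    by (rule isometric_transfer[OF E.pontryagin_carrier_axioms W_pontryagin a_mem b_mem gram a_total b_total v])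
      (use that in auto)
  have "ip (a_vec i) v = ipW (b_vec i) w" if "i \<in> idx" for i
    using w(2)[OF that] E.commute[OF v a_mem[OF that]] W.commute[OF w(1) b_mem[OF that]] by simp
  then show ?thesis
    using v w(1) by (auto simp: corresponds_def)
qed

lemma corresponds_ex': "w \<in> W \<Longrightarrow> \<exists>v. corresponds v w"
proof -
  assume w: "w \<in> W"
  obtain v where v: "v \<in> Vt" "\<And>i. i \<in> idx \<Longrightarrow> ipW w (b_vec i) = ip v (a_vec i)"
    by (rule isometric_transfer[OF W_pontryagin E.pontryagin_carrier_axioms b_mem a_mem gram[symmetric] b_total a_total w])
      (use that in auto)
  have "ip (a_vec i) v = ipW (b_vec i) w" if "i \<in> idx" for i
    using v(2)[OF that] E.commute[OF v(1) a_mem[OF that]] W.commute[OF w b_mem[OF that]] by simp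
  then show ?thesis
    using v(1) w by (auto simp: corresponds_def)
qed

lemma corresponds_unique:
  assumes "corresponds v w" "corresponds v w'"
  shows "w = w'"
proof -
  have "w - w' = 0"
    using assms b_mem by (intro b_total) (auto simp: corresponds_def)
  then show ?thesis
    by simp
qed

lemma corresponds_unique':
  assumes "corresponds v w" "corresponds v' w"
  shows "v = v'"
proof -
  have "v - v' = 0"
    using assms a_mem by (intro a_total) (auto simp: corresponds_def)
  then show ?thesis
    by simp
qed

lemma corresponds_add: "corresponds v w \<Longrightarrow> corresponds v' w' \<Longrightarrow> corresponds (v + v') (w + w')"
  using a_mem b_mem W.add_mem unfolding corresponds_def by simp

lemma corresponds_scale: "corresponds v w \<Longrightarrow> corresponds (c *\<^sub>C v) (c *\<^sub>C w)"
  using a_mem b_mem W.scale_mem unfolding corresponds_def by simp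

subsection \<open>Eigenvectors and boundary values\<close>

text \<open>Eigenvectors are recognised from vectors of \<open>V\<close> and window points alone.
  For the converse the identity is continued to the whole resolvent set of \<open>At\<close>, and
  then \<open>v\<close> is shown to be \<open>(\<alpha> - c) *\<^sub>C E.R c v\<close> by testing
  against the total family \<open>a_vec\<close>.\<close>

lemma eigenvector_iff:
  "v \<in> rel_ker At (of_real \<alpha>) \<longleftrightarrow>
    v \<in> Vt \<and> (\<forall>\<mu>\<in>M.\<Lambda>. \<forall>h\<in>V. (of_real \<alpha> - \<mu>) * ip (E.R \<mu> h) v = ip h v)"
  (is "_ \<longleftrightarrow> v \<in> Vt \<and> ?P")
proof
  assume "v \<in> rel_ker At (of_real \<alpha>)"
  then have v: "(v, of_real \<alpha> *\<^sub>C v) \<in> At"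
    by (simp add: rel_ker_def)
  then have vV: "v \<in> Vt"
    using E.A_mem by blast
  moreover have "(of_real \<alpha> - \<mu>) * ip (E.R \<mu> h) v = ip h v" if "\<mu> \<in> M.\<Lambda>" "h \<in> V" for \<mu> h
  proof -
    have m: "\<mu> \<in> E.\<rho>" "h \<in> Vt"
      using At_resolvent that V_subset by auto
    show ?thesis
      using E.A_symmetric[OF E.resolvent_op_in[OF m] v] m vV by (simp add: algebra_simps)
  qed
  ultimately show "v \<in> Vt \<and> ?P"
    by blast
next
  assume *: "v \<in> Vt \<and> ?P"
  then have v: "v \<in> Vt"
    by blast
  let ?a = "complex_of_real \<alpha>"
  have ext: "(?a - \<nu>) * ip (E.R \<nu> h) v - ip h v = 0" if nu: "\<nu> \<in> E.\<rho>" and h: "h \<in> V" for \<nu> h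
  proof (rule E_continuation[where \<phi> = "\<lambda>\<nu>. (?a - \<nu>) * ip (E.R \<nu> h) v - ip h v", OF _ _ _ nu])
    have hV: "h \<in> Vt"
      using h V_subset by blast
    show "(\<lambda>\<nu>. (?a - \<nu>) * ip (E.R \<nu> h) v - ip h v) holomorphic_on E.\<rho> - \<real>"
      by (intro holomorphic_intros E.resolvent_pairing_holomorphic[OF nu] hV v)
    show "continuous_on E.\<rho> (\<lambda>\<nu>. (?a - \<nu>) * ip (E.R \<nu> h) v - ip h v)"
      by (intro continuous_intros E.resolvent_pairing_continuous hV v)
  qed (use * h in simp)
  obtain c where c: "c \<in> U'"
    using M.U'(2) by blast
  then have cr: "c \<in> E.\<rho>" "cnj c \<in> E.\<rho>" "cnj c \<notin> M.\<Lambda>"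
    using At_resolvent[of c] M.not_conjugate[of c] by auto
  have "v - (?a - c) *\<^sub>C E.R c v = 0"
  proof (rule a_total)
    fix i assume i: "i \<in> idx"
    have pair: "ip x (E.R c v) = ip (E.R (cnj c) x) v" if "x \<in> Vt" for x
      using E.resolvent_op_adjoint[of "cnj c" x v] cr that v by simp
    consider h where "i = Inl h" "h \<in> V" | \<nu> h where "i = Inr (\<nu>, h)" "\<nu> \<in> M.\<Lambda>" "h \<in> V"
      using i unfolding idx_def by blast
    then show "ip (a_vec i) (v - (?a - c) *\<^sub>C E.R c v) = 0"
    proof cases
      case 1
      then have "h \<in> Vt"
        using V_subset by blast
      then show ?thesis
        using 1 cr v ext[OF cr(2) 1(2)] by (simp add: a_vec_def pair)
    next
      case 2
      then have h: "h \<in> Vt" and nr: "\<nu> \<in> E.\<rho>"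
        using V_subset At_resolvent by auto
      define a b where "a = ip (E.R \<nu> h) v" and "b = ip (E.R (cnj c) h) v"
      \<comment> \<open>By the resolvent identity \<open>d\<close> is a divided difference of
        \<open>a\<close> and \<open>b\<close>, so the two instances \<open>ab\<close> of
        \<open>ext\<close> determine it.\<close>
      define d where "d = ip (E.R (cnj c) (E.R \<nu> h)) v"
      have ab: "(?a - \<nu>) * a = ip h v" "(?a - cnj c) * b = ip h v"
        using ext[OF nr 2(3)] ext[OF cr(2) 2(3)] by (simp_all add: a_def b_def)
      have d: "(cnj c - \<nu>) * d = b - a"
        using arg_cong[OF E.resolvent_identity[OF cr(2) nr h], of "\<lambda>x. ip x v"] h nr cr v
        by (simp add: a_def b_def d_def)
      have "(cnj c - \<nu>) * (a - (?a - cnj c) * d) = (cnj c - \<nu>) * a - (?a - cnj c) * ((cnj c - \<nu>) * d)"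
        by (simp add: algebra_simps)
      also have "\<dots> = (cnj c - \<nu>) * a - (?a - cnj c) * (b - a)"
        unfolding d ..
      also have "\<dots> = (?a - \<nu>) * a - (?a - cnj c) * b"
        by (simp add: algebra_simps)
      finally have "(cnj c - \<nu>) * (a - (?a - cnj c) * d) = 0"
        unfolding ab by simp
      then have "a - (?a - cnj c) * d = 0"
        using cr(3) 2(2) by auto
      then show ?thesis
        using 2 h nr cr v by (simp add: a_vec_def pair a_def d_def)
    qed
  qed (use v cr in simp)
  then have v_eq: "(?a - c) *\<^sub>C E.R c v = v"
    by simp
  have "((?a - c) *\<^sub>C E.R c v, (?a - c) *\<^sub>C (v + c *\<^sub>C E.R c v)) \<in> At"
    by (rule E.A_scale[OF E.resolvent_op_in[OF cr(1) v]])
  moreover have "(?a - c) *\<^sub>C (v + c *\<^sub>C E.R c v) = (?a - c) *\<^sub>C v + c *\<^sub>C ((?a - c) *\<^sub>C E.R c v)"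
    by (simp add: scaleC_add_right scaleC_scaleC mult.commute)
  ultimately have "(v, (?a - c) *\<^sub>C v + c *\<^sub>C v) \<in> At"
    by (simp add: v_eq)
  then show "v \<in> rel_ker At ?a"
    by (simp add: rel_ker_def complex_vector.scale_left_diff_distrib)
qed

text \<open>The condition of \<open>eigenvector_iff\<close>, with pairings against
  \<open>a_vec\<close> replaced by pairings against \<open>b_vec\<close>.\<close>

definition coupled_eigenvector :: "real \<Rightarrow> 'v \<Rightarrow> 'b \<Rightarrow> bool" where
  "coupled_eigenvector \<alpha> f k \<longleftrightarrow> (\<forall>\<mu>\<in>M.\<Lambda>. \<forall>h\<in>V.
     (of_real \<alpha> - \<mu>) * (ip (M.R \<mu> h) f - ip (M.\<gamma> \<mu> (Z \<mu> h)) f - ip\<^sub>\<tau> (T.\<gamma> \<mu> (Z \<mu> h)) k) = ip h f)"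

lemma eigenvector_corresponds:
  assumes "corresponds v (f, k)"
  shows "v \<in> rel_ker At (of_real \<alpha>) \<longleftrightarrow> coupled_eigenvector \<alpha> f k"
proof -
  have fk: "v \<in> Vt" "f \<in> V" "k \<in> V\<^sub>\<tau>"
    using assms by (auto simp: corresponds_def)
  have 1: "ip h v = ip h f" if "h \<in> V" for h
  proof -
    have "ip (a_vec (Inl h)) v = ipW (b_vec (Inl h)) (f, k)"
      using assms that unfolding corresponds_def idx_def by blast
    then show ?thesis
      using fk by (simp add: a_vec_def b_vec_def sum_form_def)
  qed
  have 2: "ip (E.R \<mu> h) v = ip (M.R \<mu> h) f - ip (M.\<gamma> \<mu> (Z \<mu> h)) f - ip\<^sub>\<tau> (T.\<gamma> \<mu> (Z \<mu> h)) k"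
    if "\<mu> \<in> M.\<Lambda>" "h \<in> V" for \<mu> h
  proof -
    have "ip (a_vec (Inr (\<mu>, h))) v = ipW (b_vec (Inr (\<mu>, h))) (f, k)"
      using assms that unfolding corresponds_def idx_def by blast
    then show ?thesis
      using fk that(2) M.window[OF that(1)] T.window[OF that(1)] by (simp add: a_vec_def b_vec_def sum_form_def)
  qed
  show ?thesis
    unfolding eigenvector_iff coupled_eigenvector_def using fk(1) 1 2 by simp
qed

text \<open>The counterpart of \<open>boundary_values\<close> with resolvent vectors in place of
  defect vectors. For x = 0 it is the eigenvector equation of \<open>A\<close>; the last term
  measures the deviation from it.\<close>

lemma resolvent_boundary_value:
  assumes k: "k \<in> V" "(k, g x + of_real \<alpha> *\<^sub>C k) \<in> A" and f: "f = g x + (of_real \<alpha> - \<zeta>\<^sub>0) *\<^sub>C k"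
    and mu: "\<mu> \<in> M.\<Lambda>" and h: "h \<in> V"
  shows "(of_real \<alpha> - \<mu>) * ip (M.R \<mu> h) f = ip h f - cinner (P \<mu> h) x"
proof -
  let ?a = "complex_of_real \<alpha>"
  have mr: "\<mu> \<in> M.\<rho>" "cnj \<mu> \<in> M.\<rho>"
    using M.window[OF mu] by auto
  define q r s where "q = ip (M.R \<mu> h) (g x)" and "r = ip h k" and "s = ip (M.R \<mu> h) k"
  have "ip (h + \<mu> *\<^sub>C M.R \<mu> h) k = ip (M.R \<mu> h) (g x + ?a *\<^sub>C k)"
    by (rule M.A_symmetric[OF M.resolvent_op_in[OF mr(1) h] k(2)])
  then have s: "(?a - \<mu>) * s = r - q"
    using mr h k(1) by (simp add: q_def r_def s_def algebra_simps)
  have "ip h (M.R (cnj \<mu>) (g x)) = q"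
    using M.resolvent_op_adjoint[OF mr h M.g_mem] by (simp add: q_def)
  then have Px: "cinner (P \<mu> h) x = ip h (g x) + (\<mu> - cnj \<zeta>\<^sub>0) * q"
    using P_pairing(1)[OF mu h] mr h by (simp add: defect_family_def)
  have "(?a - \<mu>) * ip (M.R \<mu> h) f = (?a - \<mu>) * q + (?a - cnj \<zeta>\<^sub>0) * ((?a - \<mu>) * s)"
    using mr h k(1) by (simp add: f q_def s_def algebra_simps)
  also have "\<dots> = ip h f - cinner (P \<mu> h) x"
    unfolding s Px using h k(1) by (simp add: f r_def algebra_simps)
  finally show ?thesis .
qed

lemma Z_kernel_sum:
  assumes "\<mu> \<in> M.\<Lambda>"
  shows "cinner (blinfun_apply (hval m \<mu>) (Z \<mu> h)) x + cinner (blinfun_apply (hval \<tau> \<mu>) (Z \<mu> h)) x = cinner (P \<mu> h) x"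
  by (simp add: cinner_add_left[symmetric] Z_eq[OF assms])

text \<open>The identities for the three pairings are added: \<open>y\<close> enters with opposite
  signs and cancels, and the terms with \<open>x\<close> cancel by
  \<open>Z_kernel_sum\<close>.\<close>

lemma coupled_if_boundary_values:
  assumes f: "f \<in> V" "M.boundary_values \<alpha> f x y" and k: "T.boundary_values \<alpha> k x (- y)"
  shows "coupled_eigenvector \<alpha> f k"
  unfolding coupled_eigenvector_def
proof (intro ballI)
  fix \<mu> h assume mu: "\<mu> \<in> M.\<Lambda>" and h: "h \<in> V"
  let ?a = "complex_of_real \<alpha>"
  obtain k0 where k0: "k0 \<in> V" "(k0, g x + ?a *\<^sub>C k0) \<in> A" "f = g x + (?a - \<zeta>\<^sub>0) *\<^sub>C k0"
    by (rule M.boundary_valuesD[OF f]) (rule that)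
  have 1: "(?a - \<mu>) * ip (M.R \<mu> h) f = ip h f - cinner (P \<mu> h) x"
    by (rule resolvent_boundary_value[OF k0 mu h])
  have 2: "(?a - \<mu>) * ip (M.\<gamma> \<mu> (Z \<mu> h)) f = cinner (Z \<mu> h) y - cinner (blinfun_apply (hval m \<mu>) (Z \<mu> h)) x"
    using f(2) mu unfolding M.boundary_values_def by blast
  have 3: "(?a - \<mu>) * ip\<^sub>\<tau> (T.\<gamma> \<mu> (Z \<mu> h)) k = - cinner (Z \<mu> h) y - cinner (blinfun_apply (hval \<tau> \<mu>) (Z \<mu> h)) x"
    using k mu unfolding T.boundary_values_def by (simp add: cinner.minus_right)
  have eq: "(?a - \<mu>) * (ip (M.R \<mu> h) f - ip (M.\<gamma> \<mu> (Z \<mu> h)) f - ip\<^sub>\<tau> (T.\<gamma> \<mu> (Z \<mu> h)) k) =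
      (?a - \<mu>) * ip (M.R \<mu> h) f - (?a - \<mu>) * ip (M.\<gamma> \<mu> (Z \<mu> h)) f - (?a - \<mu>) * ip\<^sub>\<tau> (T.\<gamma> \<mu> (Z \<mu> h)) k"
    by (simp add: algebra_simps)
  show "(?a - \<mu>) * (ip (M.R \<mu> h) f - ip (M.\<gamma> \<mu> (Z \<mu> h)) f - ip\<^sub>\<tau> (T.\<gamma> \<mu> (Z \<mu> h)) k) = ip h f"
    unfolding eq 1 2 3 using Z_kernel_sum[OF mu, of h x] by (simp add: algebra_simps)
qed

text \<open>The vector \<open>x\<close> is found in a defect space: for \<open>h\<close> in the
  range of \<open>S - c\<close> the parameter \<open>Z c h\<close> vanishes and the equation
  involves \<open>A\<close> only, which places \<open>w\<close> in the range of
  \<open>M.\<gamma> (cnj c)\<close>. Then \<open>y\<close> is forced by the representation of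
  \<open>m\<close>, and the condition on \<open>k\<close> follows from density of the
  parameters.\<close>

lemma boundary_values_if_coupled:
  assumes f: "f \<in> V" and k: "k \<in> V\<^sub>\<tau>" and ce: "coupled_eigenvector \<alpha> f k"
  obtains x y where "M.boundary_values \<alpha> f x y" "T.boundary_values \<alpha> k x (- y)"
proof -
  let ?a = "complex_of_real \<alpha>"
  obtain c where c: "c \<in> U'"
    using M.U'(2) by blast
  then have cL: "c \<in> M.\<Lambda>"
    by simp
  then have cr: "c \<in> M.\<rho>" "cnj c \<in> M.\<rho>"
    using M.window by auto
  \<comment> \<open>If \<open>f\<close> were the defect vector of some \<open>x\<close> at \<alpha>,
    then by the formula of \<open>defect_shift\<close> this would be
    \<open>M.\<gamma> (cnj c) x\<close>.\<close>
  define w where "w = f - (?a - cnj c) *\<^sub>C M.R (cnj c) f"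
  have wV: "w \<in> V"
    using f cr by (simp add: w_def)
  have "w \<in> rel_ker (rel_adj V ip S) (cnj c)"
    unfolding rel_ker_def rel_adj_def
  proof (clarsimp simp: wV)
    fix s s' assume ss: "(s, s') \<in> S"
    then have sV: "s \<in> V" "s' \<in> V"
      using S_subset M.A_mem by blast+
    \<comment> \<open>These \<open>h\<close> fill the range of \<open>S - c\<close>. Defect vectors
      at \<open>cnj c\<close> are orthogonal to it, hence \<open>P c h\<close> and
      \<open>Z c h\<close> vanish.\<close>
    define h where "h = s' - c *\<^sub>C s"
    have h: "h \<in> V"
      using sV by (simp add: h_def)
    have "cinner (P c h) u = 0" for u
    proof -
      have "M.\<gamma> (cnj c) u \<in> rel_ker (rel_adj V ip S) (cnj c)"
        using defect_range[OF cr(2)] by blast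
      then have "ip s' (M.\<gamma> (cnj c) u) = ip s (cnj c *\<^sub>C M.\<gamma> (cnj c) u)"
        using ss unfolding rel_ker_def rel_adj_def by blast
      then show ?thesis
        using P_pairing(1)[OF cL h] sV cr by (simp add: h_def)
    qed
    then have "P c h = 0"
      using cinner_self[of "P c h"] by simp
    then have "Z c h = 0"
      by (simp add: Z_def blinfun.zero_right)
    have "M.\<gamma> c 0 = 0" "T.\<gamma> c 0 = 0"
      using M.defect_clinear[OF cr(1)] T.defect_clinear[of c] T.window[OF cL] unfolding clinear_on_def
      by (metis UNIV_I add_cancel_right_right)+
    moreover have "(?a - c) * (ip (M.R c h) f - ip (M.\<gamma> c (Z c h)) f - ip\<^sub>\<tau> (T.\<gamma> c (Z c h)) k) = ip h f"
      using ce cL h unfolding coupled_eigenvector_def by blast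
    ultimately have "(?a - c) * ip (M.R c h) f = ip h f"
      using f k by (simp add: \<open>Z c h = 0\<close>)
    moreover have "ip h (M.R (cnj c) f) = ip (M.R c h) f"
      using M.resolvent_op_adjoint[OF cr h f] by simp
    ultimately have "ip h w = 0"
      using f h cr by (simp add: w_def)
    then show "ip s' w = ip s (cnj c *\<^sub>C w)"
      using sV wV by (simp add: h_def)
  qed
  then obtain x where x: "w = M.\<gamma> (cnj c) x"
    using defect_range[OF cr(2)] by blast
  \<comment> \<open>The value of \<open>A - cnj c\<close> at \<open>f - g x\<close> that is forced
    by the intended relation between \<open>f\<close>, \<open>g x\<close> and
    \<open>k0\<close>.\<close>
  define q where "q = (?a - cnj c) *\<^sub>C f + (cnj c - \<zeta>\<^sub>0) *\<^sub>C g x"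
  have q: "q \<in> V"
    using f by (simp add: q_def)
  have Rq: "M.R (cnj c) q = f - g x"
  proof -
    have "M.R (cnj c) q = (?a - cnj c) *\<^sub>C M.R (cnj c) f + (cnj c - \<zeta>\<^sub>0) *\<^sub>C M.R (cnj c) (g x)"
      unfolding q_def using f cr by (simp add: M.resolvent_op_add M.resolvent_op_scale)
    also have "\<dots> = f - g x"
      using x by (simp add: w_def defect_family_def algebra_simps)
    finally show ?thesis .
  qed
  define k0 where "k0 = (1 / (?a - \<zeta>\<^sub>0)) *\<^sub>C (f - g x)"
  have fk0: "f = g x + (?a - \<zeta>\<^sub>0) *\<^sub>C k0"
    using M.real_ne[of \<alpha>] by (simp add: k0_def scaleC_scaleC scaleC_one)
  have "(f - g x, q + cnj c *\<^sub>C (f - g x)) \<in> A"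
    using M.resolvent_op_in[OF cr(2) q] by (simp add: Rq)
  moreover have "q + cnj c *\<^sub>C (f - g x) = (?a - \<zeta>\<^sub>0) *\<^sub>C (g x + ?a *\<^sub>C k0)"
  proof -
    have "q + cnj c *\<^sub>C (f - g x) = ?a *\<^sub>C f - \<zeta>\<^sub>0 *\<^sub>C g x"
      by (simp add: q_def complex_vector.scale_left_diff_distrib complex_vector.scale_right_diff_distrib)
    also have "\<dots> = (?a - \<zeta>\<^sub>0) *\<^sub>C (g x + ?a *\<^sub>C k0)"
      by (subst fk0) (simp add: complex_vector.scale_left_diff_distrib complex_vector.scale_right_diff_distrib
          scaleC_add_right scaleC_scaleC right_diff_distrib mult.commute)
    finally show ?thesis .
  qed
  ultimately have "(f - g x, (?a - \<zeta>\<^sub>0) *\<^sub>C (g x + ?a *\<^sub>C k0)) \<in> A"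
    by simp
  then have "((1 / (?a - \<zeta>\<^sub>0)) *\<^sub>C (f - g x), (1 / (?a - \<zeta>\<^sub>0)) *\<^sub>C (?a - \<zeta>\<^sub>0) *\<^sub>C (g x + ?a *\<^sub>C k0)) \<in> A"
    by (rule M.A_scale)
  moreover have "(1 / (?a - \<zeta>\<^sub>0)) *\<^sub>C (?a - \<zeta>\<^sub>0) *\<^sub>C v = v" for v :: 'v
    using M.real_ne[of \<alpha>] by (simp add: scaleC_scaleC scaleC_one)
  ultimately have k0A: "(k0, g x + ?a *\<^sub>C k0) \<in> A"
    by (simp add: k0_def)
  have k0V: "k0 \<in> V"
    using M.A_mem[OF k0A] by simp
  define y where "y = blinfun_apply M.B0 x + (?a - cnj \<zeta>\<^sub>0) *\<^sub>C padj ip g f"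
  have bv: "M.boundary_values \<alpha> f x y"
    by (rule M.boundary_valuesI[OF k0A fk0 y_def])
  moreover have "T.boundary_values \<alpha> k x (- y)"
    unfolding T.boundary_values_def
  proof (intro ballI allI)
    fix \<mu> u assume mu: "\<mu> \<in> T.\<Lambda>"
    have mr: "\<mu> \<in> T.\<rho>" "\<mu> \<in> hdom \<tau>"
      using T.window[OF mu] by auto
    \<comment> \<open>The failure of the wanted identity, collected in one vector, so that it can be
      tested against the dense parameters \<open>Z \<mu> h\<close>.\<close>
    define d where "d = (?a - cnj \<mu>) *\<^sub>C padj ip\<^sub>\<tau> (T.\<gamma> \<mu>) k + y + blinfun_apply (hval \<tau> (cnj \<mu>)) x"
    have d: "cinner u d = (?a - \<mu>) * ip\<^sub>\<tau> (T.\<gamma> \<mu> u) k + cinner u y + cinner (blinfun_apply (hval \<tau> \<mu>) u) x" for u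
      using hval_adjoint[OF T.Q mr(2) window_nonreal[OF mu], of u x] T.cinner_padj_defect(2)[OF mr(1) k, of u]
      by (simp add: d_def cinner.add_right cinner.scale_right)
    have "d = 0"
    proof (rule Z_dense[OF mu])
      fix h assume h: "h \<in> V"
      have 1: "(?a - \<mu>) * (ip (M.R \<mu> h) f - ip (M.\<gamma> \<mu> (Z \<mu> h)) f - ip\<^sub>\<tau> (T.\<gamma> \<mu> (Z \<mu> h)) k) = ip h f"
        using ce mu h unfolding coupled_eigenvector_def by blast
      have 2: "(?a - \<mu>) * ip (M.R \<mu> h) f = ip h f - cinner (P \<mu> h) x"
        by (rule resolvent_boundary_value[OF k0V k0A fk0 mu h])
      have 3: "(?a - \<mu>) * ip (M.\<gamma> \<mu> (Z \<mu> h)) f = cinner (Z \<mu> h) y - cinner (blinfun_apply (hval m \<mu>) (Z \<mu> h)) x"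
        using bv mu unfolding M.boundary_values_def by blast
      have "(?a - \<mu>) * ip (M.R \<mu> h) f - (?a - \<mu>) * ip (M.\<gamma> \<mu> (Z \<mu> h)) f
          - (?a - \<mu>) * ip\<^sub>\<tau> (T.\<gamma> \<mu> (Z \<mu> h)) k = ip h f"
        unfolding 1[symmetric] by (simp add: algebra_simps)
      then have "(?a - \<mu>) * ip\<^sub>\<tau> (T.\<gamma> \<mu> (Z \<mu> h)) k = - cinner (Z \<mu> h) y
          + cinner (blinfun_apply (hval m \<mu>) (Z \<mu> h)) x - cinner (P \<mu> h) x"
        unfolding 2 3 by (simp add: algebra_simps)
      then show "cinner (Z \<mu> h) d = 0"
        unfolding d Z_kernel_sum[OF mu, of h x, symmetric] by (simp add: algebra_simps)
    qed
    then show "(?a - \<mu>) * ip\<^sub>\<tau> (T.\<gamma> \<mu> u) k = cinner u (- y) - cinner (blinfun_apply (hval \<tau> \<mu>) u) x"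
      using d[of u] by (simp add: cinner.minus_right add_eq_0_iff algebra_simps)
  qed
  ultimately show thesis
    by (rule that)
qed

text \<open>Two pairs for the same \<open>f\<close> yield a vector \<open>v\<close> with
  \<open>(v, \<zeta>\<^sub>0 *\<^sub>C v)\<close> in \<open>A\<close>, which vanishes because
  \<open>\<zeta>\<^sub>0\<close> is a resolvent point; injectivity of \<open>g\<close> then gives
  equal \<open>x\<close>. Hence an eigenvector determines its pair.\<close>

lemma boundary_values_unique:
  assumes f: "f \<in> V" and "M.boundary_values \<alpha> f x y" "M.boundary_values \<alpha> f x' y'"
  shows "x = x' \<and> y = y'"
proof -
  let ?a = "complex_of_real \<alpha>"
  obtain k where k: "k \<in> V" "(k, g x + ?a *\<^sub>C k) \<in> A" "f = g x + (?a - \<zeta>\<^sub>0) *\<^sub>C k"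
    "y = blinfun_apply M.B0 x + (?a - cnj \<zeta>\<^sub>0) *\<^sub>C padj ip g f"
    by (rule M.boundary_valuesD[OF f assms(2)]) (rule that)
  obtain k' where k': "k' \<in> V" "(k', g x' + ?a *\<^sub>C k') \<in> A" "f = g x' + (?a - \<zeta>\<^sub>0) *\<^sub>C k'"
    "y' = blinfun_apply M.B0 x' + (?a - cnj \<zeta>\<^sub>0) *\<^sub>C padj ip g f"
    by (rule M.boundary_valuesD[OF f assms(3)]) (rule that)
  define v where "v = k - k'"
  have gv: "g x - g x' = - ((?a - \<zeta>\<^sub>0) *\<^sub>C v)"
    using k(3) k'(3) by (simp add: v_def complex_vector.scale_right_diff_distrib algebra_simps)
  have "(v, (g x - g x') + ?a *\<^sub>C v) \<in> A"
    using M.A_diff[OF k(2) k'(2)] by (simp add: v_def complex_vector.scale_right_diff_distrib algebra_simps)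
  moreover have "(g x - g x') + ?a *\<^sub>C v = \<zeta>\<^sub>0 *\<^sub>C v"
    unfolding gv by (simp add: complex_vector.scale_left_diff_distrib)
  ultimately have "v = 0"
    using M.eigenvalue_not_resolvent[OF _ M.\<zeta>\<^sub>0(1)] by simp
  then have "g x = g x'"
    using gv by simp
  moreover have "g (x - x') = g x - g x'"
    using M.g_add[of "x - x'" x'] by simp
  ultimately have "M.\<gamma> \<zeta>\<^sub>0 (x - x') = 0"
    by (simp add: M.defect_base)
  then have "x - x' = 0"
    by (rule defect_inj[OF M.\<zeta>\<^sub>0(1)])
  then show ?thesis
    using k(4) k'(4) by simp
qed

text \<open>The graph of the bijection; linearity, injectivity and surjectivity are proved for the
  graph before a function is extracted from it.\<close>

definition eigen_data :: "real \<Rightarrow> 'v \<Rightarrow> 'g \<times> 'g \<Rightarrow> bool" where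
  "eigen_data \<alpha> v p \<longleftrightarrow> (\<exists>f k. corresponds v (f, k) \<and>
     M.boundary_values \<alpha> f (fst p) (snd p) \<and> T.boundary_values \<alpha> k (fst p) (- snd p))"

lemma eigen_data_ex:
  assumes "v \<in> rel_ker At (of_real \<alpha>)"
  shows "\<exists>p. eigen_data \<alpha> v p"
proof -
  have v: "v \<in> Vt"
    using assms eigenvector_iff by blast
  obtain f k where fk: "corresponds v (f, k)"
    using corresponds_ex[OF v] by auto
  then have "coupled_eigenvector \<alpha> f k" "f \<in> V" "k \<in> V\<^sub>\<tau>"
    using eigenvector_corresponds[OF fk] assms by (auto simp: corresponds_def)
  then obtain x y where "M.boundary_values \<alpha> f x y" "T.boundary_values \<alpha> k x (- y)"
    using boundary_values_if_coupled by blast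
  then show ?thesis
    using fk unfolding eigen_data_def by (intro exI[of _ "(x, y)"]) auto
qed

lemma eigen_data_unique:
  assumes "eigen_data \<alpha> v p" "eigen_data \<alpha> v p'"
  shows "p = p'"
proof -
  obtain f k where 1: "corresponds v (f, k)" "M.boundary_values \<alpha> f (fst p) (snd p)"
    using assms(1) by (auto simp: eigen_data_def)
  obtain f' k' where 2: "corresponds v (f', k')" "M.boundary_values \<alpha> f' (fst p') (snd p')"
    using assms(2) by (auto simp: eigen_data_def)
  have "f' = f" "f \<in> V"
    using corresponds_unique[OF 1(1) 2(1)] 1(1) by (auto simp: corresponds_def)
  then show ?thesis
    using boundary_values_unique[of f \<alpha>] 1(2) 2(2) by (auto simp: prod_eq_iff)
qed

lemma eigen_data_inj:
  assumes "eigen_data \<alpha> v p" "eigen_data \<alpha> v' p"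
  shows "v = v'"
proof -
  obtain f k where 1: "corresponds v (f, k)" "M.boundary_values \<alpha> f (fst p) (snd p)"
    "T.boundary_values \<alpha> k (fst p) (- snd p)"
    using assms(1) by (auto simp: eigen_data_def)
  obtain f' k' where 2: "corresponds v' (f', k')" "M.boundary_values \<alpha> f' (fst p) (snd p)"
    "T.boundary_values \<alpha> k' (fst p) (- snd p)"
    using assms(2) by (auto simp: eigen_data_def)
  have mem: "f \<in> V" "k \<in> V\<^sub>\<tau>" "f' \<in> V" "k' \<in> V\<^sub>\<tau>"
    using 1(1) 2(1) by (auto simp: corresponds_def)
  have "f = f'" "k = k'"
    using M.boundary_values_inj[OF mem(1,3) 1(2) 2(2)] T.boundary_values_inj[OF mem(2,4) 1(3) 2(3)] by auto
  then show ?thesis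
    using corresponds_unique'[OF 1(1)] 2(1) by simp
qed

lemma eigen_data_surj:
  assumes "f \<in> V" "M.boundary_values \<alpha> f x y" "k \<in> V\<^sub>\<tau>" "T.boundary_values \<alpha> k x (- y)"
  shows "\<exists>v\<in>rel_ker At (of_real \<alpha>). eigen_data \<alpha> v (x, y)"
proof -
  obtain v where v: "corresponds v (f, k)"
    using corresponds_ex'[of "(f, k)"] assms by auto
  have "v \<in> rel_ker At (of_real \<alpha>)"
    using eigenvector_corresponds[OF v] coupled_if_boundary_values[OF assms(1,2,4)] by blast
  then show ?thesis
    using v assms unfolding eigen_data_def by auto
qed

lemma eigen_data_add:
  assumes "eigen_data \<alpha> v p" "eigen_data \<alpha> v' p'"
  shows "eigen_data \<alpha> (v + v') (p + p')"
proof -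
  obtain f k where 1: "corresponds v (f, k)" "M.boundary_values \<alpha> f (fst p) (snd p)"
    "T.boundary_values \<alpha> k (fst p) (- snd p)"
    using assms(1) by (auto simp: eigen_data_def)
  obtain f' k' where 2: "corresponds v' (f', k')" "M.boundary_values \<alpha> f' (fst p') (snd p')"
    "T.boundary_values \<alpha> k' (fst p') (- snd p')"
    using assms(2) by (auto simp: eigen_data_def)
  have mem: "f \<in> V" "k \<in> V\<^sub>\<tau>" "f' \<in> V" "k' \<in> V\<^sub>\<tau>"
    using 1(1) 2(1) by (auto simp: corresponds_def)
  show ?thesis
    unfolding eigen_data_def
    using corresponds_add[OF 1(1) 2(1)] M.boundary_values_add[OF mem(1,3) 1(2) 2(2)]
      T.boundary_values_add[OF mem(2,4) 1(3) 2(3)]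
    by (intro exI[of _ "f + f'"] exI[of _ "k + k'"]) simp
qed

lemma eigen_data_scale:
  assumes "eigen_data \<alpha> v p"
  shows "eigen_data \<alpha> (c *\<^sub>C v) (c *\<^sub>C p)"
proof -
  obtain f k where 1: "corresponds v (f, k)" "M.boundary_values \<alpha> f (fst p) (snd p)"
    "T.boundary_values \<alpha> k (fst p) (- snd p)"
    using assms(1) by (auto simp: eigen_data_def)
  have mem: "f \<in> V" "k \<in> V\<^sub>\<tau>"
    using 1(1) by (auto simp: corresponds_def)
  show ?thesis
    unfolding eigen_data_def
    using corresponds_scale[OF 1(1), of c] M.boundary_values_scale[OF mem(1) 1(2), of c]
      T.boundary_values_scale[OF mem(2) 1(3), of c]
    by (intro exI[of _ "c *\<^sub>C f"] exI[of _ "c *\<^sub>C k"]) (simp add: scaleC_prod_def)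
qed

lemma eigenvector_bijection:
  "\<exists>F. clinear_on (rel_ker At (of_real \<alpha>)) F \<and> bij_betw F (rel_ker At (of_real \<alpha>))
    {(x, y). (\<exists>f\<in>V. M.boundary_values \<alpha> f x y) \<and> (\<exists>k\<in>V\<^sub>\<tau>. T.boundary_values \<alpha> k x (- y))}"
proof -
  define F where "F v = (THE p. eigen_data \<alpha> v p)" for v
  have F_eq: "F v = p" if "eigen_data \<alpha> v p" for v p
    unfolding F_def by (rule the_equality[where P = "eigen_data \<alpha> v", OF that]) (rule eigen_data_unique[OF _ that])
  have F: "eigen_data \<alpha> v (F v)" if "v \<in> rel_ker At (of_real \<alpha>)" for v
    using eigen_data_ex[OF that] F_eq by metis
  have "clinear_on (rel_ker At (of_real \<alpha>)) F"
    unfolding clinear_on_def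
    by (intro conjI ballI allI F_eq eigen_data_add eigen_data_scale F)
  moreover have "inj_on F (rel_ker At (of_real \<alpha>))"
    using F eigen_data_inj by (metis inj_onI)
  moreover have "F ` rel_ker At (of_real \<alpha>) =
      {(x, y). (\<exists>f\<in>V. M.boundary_values \<alpha> f x y) \<and> (\<exists>k\<in>V\<^sub>\<tau>. T.boundary_values \<alpha> k x (- y))}"
  proof (rule equalityI; rule subsetI)
    fix p assume "p \<in> F ` rel_ker At (of_real \<alpha>)"
    then obtain v where "eigen_data \<alpha> v p"
      using F by blast
    then show "p \<in> {(x, y). (\<exists>f\<in>V. M.boundary_values \<alpha> f x y) \<and> (\<exists>k\<in>V\<^sub>\<tau>. T.boundary_values \<alpha> k x (- y))}"
      unfolding eigen_data_def corresponds_def by (cases p) auto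
  next
    fix p assume "p \<in> {(x, y). (\<exists>f\<in>V. M.boundary_values \<alpha> f x y) \<and> (\<exists>k\<in>V\<^sub>\<tau>. T.boundary_values \<alpha> k x (- y))}"
    then obtain x y f k where p: "p = (x, y)" "f \<in> V" "M.boundary_values \<alpha> f x y"
      "k \<in> V\<^sub>\<tau>" "T.boundary_values \<alpha> k x (- y)"
      by blast
    then obtain v where "v \<in> rel_ker At (of_real \<alpha>)" "eigen_data \<alpha> v p"
      using eigen_data_surj by blast
    then show "p \<in> F ` rel_ker At (of_real \<alpha>)"
      using F_eq by blast
  qed
  ultimately show ?thesis
    unfolding bij_betw_def by blast
qed

end

section \<open>Eigenvalues of the extension\<close>

context selfadjoint
begin

text \<open>\<open>S \<subseteq> A\<close> and the symmetry of \<open>A\<close> keep the shifted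
  vector in the defect space, and by the resolvent identity exchanging the two points inverts the
  shift. Range and injectivity of the defect family follow.\<close>

lemma adjoint_ker_shift:
  assumes S: "S \<subseteq> A" and "\<zeta> \<in> \<rho>" "\<zeta>' \<in> \<rho>" and v: "v \<in> rel_ker (rel_adj V ip S) \<zeta>"
  shows "v + (\<zeta>' - \<zeta>) *\<^sub>C R \<zeta>' v \<in> rel_ker (rel_adj V ip S) \<zeta>'"
    and "(v + (\<zeta>' - \<zeta>) *\<^sub>C R \<zeta>' v) + (\<zeta> - \<zeta>') *\<^sub>C R \<zeta> (v + (\<zeta>' - \<zeta>) *\<^sub>C R \<zeta>' v) = v"
proof -
  have vV: "v \<in> V" and orth: "\<And>s s'. (s, s') \<in> S \<Longrightarrow> ip s' v = ip s (\<zeta> *\<^sub>C v)"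
    using v unfolding rel_ker_def rel_adj_def by auto
  let ?w = "v + (\<zeta>' - \<zeta>) *\<^sub>C R \<zeta>' v"
  have wV: "?w \<in> V"
    using vV assms by simp
  have "ip s' ?w = ip s (\<zeta>' *\<^sub>C ?w)" if ss: "(s, s') \<in> S" for s s'
  proof -
    have sA: "(s, s') \<in> A"
      using ss S by blast
    have "ip s' (R \<zeta>' v) = ip s (v + \<zeta>' *\<^sub>C R \<zeta>' v)"
      by (rule A_symmetric[OF sA resolvent_op_in[OF assms(3) vV]])
    then show ?thesis
      using orth[OF ss] A_mem[OF sA] vV assms(3) by (simp add: algebra_simps)
  qed
  then show "?w \<in> rel_ker (rel_adj V ip S) \<zeta>'"
    using wV unfolding rel_ker_def rel_adj_def by auto
  have "R \<zeta> ?w = R \<zeta> v + (\<zeta>' - \<zeta>) *\<^sub>C R \<zeta> (R \<zeta>' v)"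
    using vV assms by (simp only: resolvent_op_add resolvent_op_scale resolvent_op_mem scale_mem)
  then have "(\<zeta> - \<zeta>') *\<^sub>C R \<zeta> ?w =
      (\<zeta> - \<zeta>') *\<^sub>C R \<zeta> v + (\<zeta>' - \<zeta>) *\<^sub>C ((\<zeta> - \<zeta>') *\<^sub>C R \<zeta> (R \<zeta>' v))"
    by (simp only: scaleC_add_right scaleC_scaleC mult.commute)
  also have "(\<zeta> - \<zeta>') *\<^sub>C R \<zeta> (R \<zeta>' v) = R \<zeta> v - R \<zeta>' v"
    by (rule resolvent_identity[OF assms(2,3) vV, symmetric])
  finally show "?w + (\<zeta> - \<zeta>') *\<^sub>C R \<zeta> ?w = v"
    by (simp add: complex_vector.scale_right_diff_distrib complex_vector.scale_left_diff_distrib)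
qed

lemma defect_family_range:
  assumes S: "S \<subseteq> A" and z: "\<zeta>\<^sub>0 \<in> \<rho>" "\<zeta> \<in> \<rho>"
    and g: "range g = rel_ker (rel_adj V ip S) \<zeta>\<^sub>0"
  shows "range (defect_family A \<zeta>\<^sub>0 g \<zeta>) = rel_ker (rel_adj V ip S) \<zeta>"
proof (rule equalityI; rule subsetI)
  fix v assume "v \<in> range (defect_family A \<zeta>\<^sub>0 g \<zeta>)"
  then obtain x where "v = g x + (\<zeta> - \<zeta>\<^sub>0) *\<^sub>C R \<zeta> (g x)"
    by (auto simp: defect_family_def)
  moreover have "g x \<in> rel_ker (rel_adj V ip S) \<zeta>\<^sub>0"
    using g by blast
  ultimately show "v \<in> rel_ker (rel_adj V ip S) \<zeta>"
    using adjoint_ker_shift(1)[OF S z] by simp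
next
  fix v assume v: "v \<in> rel_ker (rel_adj V ip S) \<zeta>"
  have "v + (\<zeta>\<^sub>0 - \<zeta>) *\<^sub>C R \<zeta>\<^sub>0 v \<in> range g"
    unfolding g by (rule adjoint_ker_shift(1)[OF S z(2,1) v])
  then obtain x where "g x = v + (\<zeta>\<^sub>0 - \<zeta>) *\<^sub>C R \<zeta>\<^sub>0 v"
    by (metis imageE)
  then have "v = defect_family A \<zeta>\<^sub>0 g \<zeta> x"
    using adjoint_ker_shift(2)[OF S z(2,1) v] by (simp add: defect_family_def)
  then show "v \<in> range (defect_family A \<zeta>\<^sub>0 g \<zeta>)"
    by blast
qed

lemma defect_family_inj:
  assumes S: "S \<subseteq> A" and z: "\<zeta>\<^sub>0 \<in> \<rho>" "\<zeta> \<in> \<rho>"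
    and g: "range g = rel_ker (rel_adj V ip S) \<zeta>\<^sub>0" and x: "defect_family A \<zeta>\<^sub>0 g \<zeta> x = 0"
  shows "g x = 0"
proof -
  have "g x \<in> rel_ker (rel_adj V ip S) \<zeta>\<^sub>0"
    using g by blast
  from adjoint_ker_shift(2)[OF S z this] show ?thesis
    unfolding x[unfolded defect_family_def] using z(1) by (simp add: resolvent_op_zero)
qed

text \<open>Makes \<open>V\<close> itself a model space of \<open>m\<close>: fixing the second
  kernel argument at \<open>\<zeta>\<^sub>0\<close> turns the kernel identity into the
  representation, and simplicity of \<open>S\<close> becomes minimality because the ranges of the
  defect family are the defect spaces.\<close>

lemma Q_function_realisation:
  assumes S: "S \<subseteq> A" and z: "\<zeta>\<^sub>0 \<in> \<rho>" "Im \<zeta>\<^sub>0 > 0"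
    and bounded: "bounded_map_into V ip g" and g: "range g = rel_ker (rel_adj V ip S) \<zeta>\<^sub>0"
    and simple: "simple_symmetric V ip S A" and Q: "is_Q_function V ip A \<zeta>\<^sub>0 g m"
  shows "minimal_realisation m V ip A \<zeta>\<^sub>0 g"
proof -
  have m: "m \<in> gen_nevanlinna" "\<rho> \<subseteq> hdom m"
    using Q by (auto simp: is_Q_function_def)
  have base: "defect_family A \<zeta>\<^sub>0 g \<zeta>\<^sub>0 = g"
    by (simp add: fun_eq_iff defect_family_def)
  have nr: "\<zeta>\<^sub>0 \<notin> \<real>"
    using z(2) by (auto simp: complex_is_Real_iff)
  have "blinfun_apply (hval m \<zeta>) x = blinfun_apply (op_adj (hval m \<zeta>\<^sub>0)) x
      + (\<zeta> - cnj \<zeta>\<^sub>0) *\<^sub>C padj ip g (defect_family A \<zeta>\<^sub>0 g \<zeta> x)" if zz: "\<zeta> \<in> \<rho>" for \<zeta> x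
  proof (cases "\<zeta> = cnj \<zeta>\<^sub>0")
    \<comment> \<open>The kernel identity excludes this point, where the representation reduces to
      the symmetry of \<open>m\<close>.\<close>
    case True
    then show ?thesis
      using gen_nevanlinnaD(3)[OF m(1) _ nr] m(2) z(1) by auto
  next
    case False
    then have ker: "blinfun_apply (nev_kernel m \<zeta> \<zeta>\<^sub>0) x = padj ip g (defect_family A \<zeta>\<^sub>0 g \<zeta> x)"
      using Q zz z(1) base unfolding is_Q_function_def by metis
    have "(\<zeta> - cnj \<zeta>\<^sub>0) *\<^sub>C padj ip g (defect_family A \<zeta>\<^sub>0 g \<zeta> x) =
        blinfun_apply (hval m \<zeta>) x - blinfun_apply (op_adj (hval m \<zeta>\<^sub>0)) x"
      unfolding ker[symmetric] using False
      by (simp add: nev_kernel_def scaleC_scaleC scaleC_one blinfun.diff_left)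
    then show ?thesis
      by simp
  qed
  moreover have "minimal_relation V ip A \<zeta>\<^sub>0 g"
  proof -
    have "{defect_family A \<zeta>\<^sub>0 g \<zeta> x |\<zeta> x. \<zeta> \<in> \<rho>} = (\<Union>\<zeta>\<in>\<rho>. range (defect_family A \<zeta>\<^sub>0 g \<zeta>))"
      by auto
    also have "\<dots> = (\<Union>\<zeta>\<in>\<rho>. rel_ker (rel_adj V ip S) \<zeta>)"
      using defect_family_range[OF S z(1) _ g] by simp
    finally show ?thesis
      using simple unfolding minimal_relation_def simple_symmetric_def by simp
  qed
  ultimately show ?thesis
    unfolding minimal_realisation_def using pontryagin selfadjoint bounded z m(2) by auto
qed

text \<open>Provides the resolvent point of \<open>At\<close> that finiteness of its nonreal
  spectrum requires. With empty \<rho> the span in the minimality condition would be {0}, so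
  \<open>V\<close> would be trivial; but there the zero operator is a resolvent.\<close>

lemma resolvent_set_nonempty:
  assumes "minimal_relation V ip A \<zeta>\<^sub>0 g"
  shows "\<rho> \<noteq> {}"
proof
  assume empty: "\<rho> = {}"
  have "V = pclosure V ip {0}"
    using assms by (simp add: minimal_relation_def empty)
  then have small: "nrm v < e" if "v \<in> V" "e > 0" for v e
    using that unfolding pclosure_def pnorm_def by auto
  have V0: "v = 0" if "v \<in> V" for v
  proof (rule ccontr)
    assume "v \<noteq> 0"
    then have "nrm v > 0"
      using H.nrm_eq_0_iff[OF that] H.nrm_nonneg[OF that] by linarith
    then show False
      using small[OF that] by blast
  qed
  have "A = {(0, 0)}"
    using A_mem V0 A_zero by fast
  moreover have "V = {0}"
    using V0 by auto
  ultimately have "resolvent_rel A 0 = rel_graph V (\<lambda>_. 0)"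
    by (auto simp: resolvent_rel_def rel_shift_def rel_graph_def)
  moreover have "bounded_op_on V ip (\<lambda>_. 0)"
    unfolding bounded_op_on_def clinear_on_def pnorm_def by (auto intro!: exI[of _ 0])
  ultimately have "0 \<in> \<rho>"
    unfolding resolvent_set_def by blast
  then show False
    using empty by simp
qed

end

theorem theorem4p1:
  fixes V Vt :: "'v::complex_vector set" and ip :: "'v form"
    and S A At :: "('v \<times> 'v) set"
    and n :: "'n set"
    and \<zeta>\<^sub>0 :: complex and \<gamma> :: "'g::complex_hilbert_space \<Rightarrow> 'v"
    and m \<tau> :: "'g opfun"
    and V\<^sub>m :: "'a::complex_vector set" and ip\<^sub>m :: "'a form" and A\<^sub>m :: "('a \<times> 'a) set"
    and \<zeta>\<^sub>m :: complex and \<gamma>\<^sub>m :: "'g \<Rightarrow> 'a"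
    and V\<^sub>\<tau> :: "'b::complex_vector set" and ip\<^sub>\<tau> :: "'b form" and A\<^sub>\<tau> :: "('b \<times> 'b) set"
    and \<zeta>\<^sub>\<tau> :: complex and \<gamma>\<^sub>\<tau> :: "'g \<Rightarrow> 'b"
    and \<alpha> :: real
  defines "m\<^sub>\<alpha> \<equiv> generalised_value m V\<^sub>m ip\<^sub>m A\<^sub>m \<zeta>\<^sub>m \<gamma>\<^sub>m \<alpha>"
    and "\<tau>\<^sub>\<alpha> \<equiv> generalised_value \<tau> V\<^sub>\<tau> ip\<^sub>\<tau> A\<^sub>\<tau> \<zeta>\<^sub>\<tau> \<gamma>\<^sub>\<tau> \<alpha>"
  assumes "pontryagin_space V ip"
    and "closed_symmetric_operator V ip S"
    and "has_defect_numbers V ip S n n"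
    and "selfadjoint_relation V ip A" and "S \<subseteq> A"
    and "\<zeta>\<^sub>0 \<in> resolvent_set V ip A" and "Im \<zeta>\<^sub>0 > 0"
    and "has_hilbert_dim (UNIV :: 'g set) cinner n"
    and "bounded_map_into V ip \<gamma>" and "bij_betw \<gamma> UNIV (rel_ker (rel_adj V ip S) \<zeta>\<^sub>0)"
    and "simple_symmetric V ip S A"
    and "is_Q_function V ip A \<zeta>\<^sub>0 \<gamma> m"
    and "\<tau> \<in> gen_nevanlinna"
    and "regular_opfun (\<lambda>z. m z + \<tau> z)"
    and "pontryagin_space Vt ip" and "pontryagin_subspace V Vt ip"
    and "selfadjoint_relation Vt ip At" and "S \<subseteq> At"
    and "minimal_relation Vt ip At \<zeta>\<^sub>0 \<gamma>"
    and "krein_formula V ip A \<zeta>\<^sub>0 \<gamma> m \<tau> At"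
    and "minimal_realisation m V\<^sub>m ip\<^sub>m A\<^sub>m \<zeta>\<^sub>m \<gamma>\<^sub>m"
    and "minimal_realisation \<tau> V\<^sub>\<tau> ip\<^sub>\<tau> A\<^sub>\<tau> \<zeta>\<^sub>\<tau> \<gamma>\<^sub>\<tau>"
  shows "(is_eigenvalue At (of_real \<alpha>) \<longleftrightarrow>
           (\<exists>x\<^sub>0 y\<^sub>0. (x\<^sub>0, y\<^sub>0) \<noteq> (0, 0) \<and> (x\<^sub>0, y\<^sub>0) \<in> m\<^sub>\<alpha> \<and> (x\<^sub>0, - y\<^sub>0) \<in> \<tau>\<^sub>\<alpha>)) \<and>
         (\<exists>f. clinear_on (rel_ker At (of_real \<alpha>)) f \<and>
           bij_betw f (rel_ker At (of_real \<alpha>))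
             {(x\<^sub>0, y\<^sub>0). (x\<^sub>0, y\<^sub>0) \<in> m\<^sub>\<alpha> \<and> (x\<^sub>0, - y\<^sub>0) \<in> \<tau>\<^sub>\<alpha>})"
proof -
  note pV = assms(3) and sA = assms(6) and SA = assms(7) and \<zeta>\<^sub>0 = assms(8,9)
    and g = assms(11,12) and simple = assms(13) and Qfun = assms(14) and \<tau> = assms(15)
    and regular = assms(16) and pVt = assms(17) and sub = assms(18) and sAt = assms(19)
    and min = assms(21) and krein = assms(22) and real_m = assms(23) and real_\<tau> = assms(24)
  have m: "m \<in> gen_nevanlinna"
    using Qfun by (simp add: is_Q_function_def)
  have range: "range \<gamma> = rel_ker (rel_adj V ip S) \<zeta>\<^sub>0"
    using g(2) by (simp add: bij_betw_def)
  have inj: "inj \<gamma>"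
    using g(2) by (simp add: bij_betw_def)
  interpret SA: selfadjoint V ip A
    using pV sA by unfold_locales
  interpret E: selfadjoint Vt ip At
    using pVt sAt by unfold_locales
  have real: "minimal_realisation m V ip A \<zeta>\<^sub>0 \<gamma>"
    by (rule SA.Q_function_realisation[OF SA \<zeta>\<^sub>0 g(1) range simple Qfun])
  interpret R: realisation V ip A m \<zeta>\<^sub>0 \<gamma>
    using real m by unfold_locales
  interpret Rm: realisation V\<^sub>m ip\<^sub>m A\<^sub>m m \<zeta>\<^sub>m \<gamma>\<^sub>m
    using real_m m by unfold_locales (auto simp: minimal_realisation_def)
  interpret R\<tau>: realisation V\<^sub>\<tau> ip\<^sub>\<tau> A\<^sub>\<tau> \<tau> \<zeta>\<^sub>\<tau> \<gamma>\<^sub>\<tau>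
    using real_\<tau> \<tau> by unfold_locales (auto simp: minimal_realisation_def)
  \<comment> \<open>The points to be avoided: the nonreal spectra of the four self-adjoint
    relations.\<close>
  define X where "X = (- \<real> - SA.\<rho>) \<union> (- \<real> - E.\<rho>) \<union> (- \<real> - Rm.\<rho>) \<union> (- \<real> - R\<tau>.\<rho>)"
  have "finite X"
    using SA.finite_nonreal_spectrum[OF \<zeta>\<^sub>0(1)] E.finite_nonreal_spectrum
      E.resolvent_set_nonempty[OF min] Rm.finite_nonreal_spectrum[OF Rm.\<zeta>\<^sub>0(1)]
      R\<tau>.finite_nonreal_spectrum[OF R\<tau>.\<zeta>\<^sub>0(1)] by (auto simp: X_def)
  define W where "W = (\<lambda>z. op_inv (m z + \<tau> z))"
  obtain w r where r: "r > 0" and upper: "\<And>z. z \<in> ball w r \<Longrightarrow> Im z > 0"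
    and good: "\<And>z. z \<in> ball w r \<or> cnj z \<in> ball w r \<Longrightarrow> z \<notin> X \<and> z \<in> hdom m \<and> z \<in> hdom \<tau> \<and> z \<in> hdom W \<and>
      (\<forall>x. blinfun_apply (hval W z) (blinfun_apply (hval m z) x + blinfun_apply (hval \<tau> z) x) = x) \<and>
      (\<forall>x. blinfun_apply (hval m z) (blinfun_apply (hval W z) x) + blinfun_apply (hval \<tau> z) (blinfun_apply (hval W z) x) = x)"
    by (rule regular_good_ball[OF m \<tau> regular \<open>finite X\<close>, folded W_def]) (rule that)
  have nonreal: "z \<notin> \<real>" if "z \<in> ball w r \<or> cnj z \<in> ball w r" for z
    using that upper[of z] upper[of "cnj z"] by (auto simp: complex_is_Real_iff)
  \<comment> \<open>Balls of radius r / 4 about these centres lie inside the good ball and are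
    disjoint, their centres being at distance r. Taking one of them and the conjugate of the other
    gives sets in both half-planes without conjugate pairs.\<close>
  define c d where "c = w - of_real (r / 2)" and "d = w + of_real (r / 2)"
  define U U' where "U = ball c (r / 4)" and "U' = ball (cnj d) (r / 4)"
  have dist: "dist c w = r / 2" "dist d w = r / 2" "dist c d = r"
    using r by (simp_all add: c_def d_def dist_norm flip: of_real_add of_real_minus)
  have disjoint: "z \<notin> ball d (r / 4)" if "z \<in> ball c (r / 4)" for z
    using that dist(3) dist_triangle_less_add[of c z "r / 4" d "r / 4"] r by (auto simp: dist_commute)
  have U_ball: "z \<in> ball w r" if "z \<in> U" for z
    using that dist(1) dist_triangle[of w z c] r by (auto simp: U_def dist_commute)
  have U'_ball: "cnj z \<in> ball w r" if "z \<in> U'" for z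
  proof -
    have "cnj z \<in> ball d (r / 4)"
      using that by (simp only: U'_def cnj_ball)
    then show ?thesis
      using dist(2) dist_triangle[of w "cnj z" d] r by (auto simp: dist_commute)
  qed
  interpret window U U'
  proof
    show "open U" "open U'" "U \<noteq> {}" "U' \<noteq> {}"
      using r by (auto simp: U_def U'_def)
    show upperU: "Im z > 0" if "z \<in> U" for z
      by (rule upper[OF U_ball[OF that]])
    show lowerU': "Im z < 0" if "z \<in> U'" for z
      using upper[OF U'_ball[OF that]] by simp
    show "cnj z \<notin> U \<union> U'" if z: "z \<in> U \<union> U'" for z
    proof
      assume "cnj z \<in> U \<union> U'"
      then consider "z \<in> U" "cnj z \<in> U'" | "z \<in> U'" "cnj z \<in> U"
        using z upperU[of z] upperU[of "cnj z"] lowerU'[of z] lowerU'[of "cnj z"] by auto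
      then show False
      proof cases
        case 1
        then show ?thesis
          using disjoint[of z] cnj_ball[of "cnj z" d "r / 4"] by (simp add: U_def U'_def)
      next
        case 2
        then show ?thesis
          using disjoint[of "cnj z"] cnj_ball[of z d "r / 4"] by (simp add: U_def U'_def)
      qed
    qed
  qed
  have N: "z \<in> ball w r \<or> cnj z \<in> ball w r" if "z \<in> U \<union> U' \<or> cnj z \<in> U \<union> U'" for z
    using that U_ball[of z] U'_ball[of z] U_ball[of "cnj z"] U'_ball[of "cnj z"] by auto
  have resolvents: "z \<in> SA.\<rho>" "z \<in> E.\<rho>" "z \<in> Rm.\<rho>" "z \<in> R\<tau>.\<rho>"
    if "z \<in> U \<union> U' \<or> cnj z \<in> U \<union> U'" for z
    using good[OF N[OF that]] nonreal[OF N[OF that]] by (auto simp: X_def)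
  have hdoms: "z \<in> hdom m" "z \<in> hdom \<tau>" "z \<in> hdom W" if "z \<in> U \<union> U' \<or> cnj z \<in> U \<union> U'" for z
    using good[OF N[OF that]] by auto
  interpret Mw: realisation_window V ip A m \<zeta>\<^sub>0 \<gamma> U U'
    by unfold_locales (use resolvents hdoms in auto)
  interpret Vm: realisation_window V\<^sub>m ip\<^sub>m A\<^sub>m m \<zeta>\<^sub>m \<gamma>\<^sub>m U U'
    by unfold_locales (use resolvents hdoms in auto)
  interpret Tw: realisation_window V\<^sub>\<tau> ip\<^sub>\<tau> A\<^sub>\<tau> \<tau> \<zeta>\<^sub>\<tau> \<gamma>\<^sub>\<tau> U U'
    by unfold_locales (use resolvents hdoms in auto)
  interpret C: coupling V ip A m \<zeta>\<^sub>0 \<gamma> U U' V\<^sub>\<tau> ip\<^sub>\<tau> A\<^sub>\<tau> \<tau> \<zeta>\<^sub>\<tau> \<gamma>\<^sub>\<tau> Vt At S "hval W"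
  proof
    show VVt: "V \<subseteq> Vt"
      using sub by (simp add: pontryagin_subspace_def)
    show "S \<subseteq> A"
      by (rule SA)
    show "u = 0" if "\<zeta> \<in> SA.\<rho>" "R.\<gamma> \<zeta> u = 0" for \<zeta> u
    proof -
      have "\<gamma> u = \<gamma> 0"
        using SA.defect_family_inj[OF SA \<zeta>\<^sub>0(1) that(1) range that(2)] R.g_scale[of 0 0] by simp
      then show ?thesis
        using inj by (simp add: inj_eq)
    qed
    show "range (R.\<gamma> \<zeta>) = rel_ker (rel_adj V ip S) \<zeta>" if "\<zeta> \<in> SA.\<rho>" for \<zeta>
      by (rule SA.defect_family_range[OF SA \<zeta>\<^sub>0(1) that range])
    show "z \<in> E.\<rho> \<and> cnj z \<in> E.\<rho>" if "z \<in> U \<union> U'" for z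
      using resolvents(2)[of z] resolvents(2)[of "cnj z"] that by auto
    show "blinfun_apply (hval W z) (blinfun_apply (hval m z) u + blinfun_apply (hval \<tau> z) u) = u"
      "blinfun_apply (hval m z) (blinfun_apply (hval W z) u) + blinfun_apply (hval \<tau> z) (blinfun_apply (hval W z) u) = u"
      if "z \<in> U \<union> U' \<or> cnj z \<in> U \<union> U'" for z u
      using good[OF N[OF that]] by auto
    show "ip (E.R z h) h' = ip (SA.R z h - R.\<gamma> z (blinfun_apply (hval W z) (padj ip (R.\<gamma> (cnj z)) h))) h'"
      if z: "z \<in> U \<union> U'" and h: "h \<in> V" "h' \<in> V" for z h h'
    proof -
      let ?p = "SA.R z h - R.\<gamma> z (blinfun_apply (hval W z) (padj ip (R.\<gamma> (cnj z)) h))"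
      have zr: "z \<in> SA.\<rho>" "z \<in> E.\<rho>" "z \<in> hdom W"
        using resolvents[of z] hdoms[of z] z by auto
      have hVt: "h \<in> Vt"
        using h VVt by blast
      have "(h, ?p) \<in> Id_on V O resolvent_rel At z O rel_graph UNIV (orth_proj V ip)"
        using krein zr h unfolding krein_formula_def Let_def W_def[symmetric] by (auto simp: rel_graph_def)
      then obtain k where k: "(h, k) \<in> resolvent_rel At z" "?p = orth_proj V ip k"
        by (auto simp: rel_graph_def)
      have "(k, h + z *\<^sub>C k) \<in> At"
        using k(1) by (auto simp: resolvent_rel_def rel_shift_def)
      then have kE: "k = E.R z h"
        using E.resolvent_op_iff[OF zr(2) hVt] by blast
      then have kVt: "k \<in> Vt"
        using zr hVt by simp
      then obtain p where p: "p \<in> V" "\<And>u. u \<in> V \<Longrightarrow> ip (k - p) u = 0"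
        using sub unfolding pontryagin_subspace_def by blast
      \<comment> \<open>Uniqueness of the projection comes from nondegeneracy of \<open>ip\<close>
        on \<open>V\<close>.\<close>
      have "orth_proj V ip k = p"
        unfolding orth_proj_def
      proof (rule the_equality)
        fix q assume q: "q \<in> V \<and> (\<forall>u\<in>V. ip (k - q) u = 0)"
        have "q - p = 0"
        proof (rule SA.nondegenerate)
          fix x assume x: "x \<in> V"
          have mem: "q \<in> Vt" "p \<in> Vt" "x \<in> Vt"
            using q p x VVt by auto
          have "ip (q - p) x = ip (k - p) x - ip (k - q) x"
            using mem kVt by simp
          then have "ip (q - p) x = 0"
            using p(2) q x by simp
          then show "ip x (q - p) = 0"
            using E.commute[of "q - p" x] mem by simp
        qed (use p q in simp)
        then show "q = p"
          by simp
      qed (use p in auto)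
      moreover have "ip k h' = ip p h'"
        using p(2)[OF h(2)] kVt subsetD[OF VVt p(1)] subsetD[OF VVt h(2)] by simp
      ultimately show ?thesis
        using k(2) kE by simp
    qed
    show "v = 0" if "v \<in> Vt" "\<And>\<zeta> u. \<zeta> \<in> E.\<rho> \<Longrightarrow> ip (defect_family At \<zeta>\<^sub>0 \<gamma> \<zeta> u) v = 0" for v
      by (rule E.minimal_relation_total[OF min _ that]) (use R.g_range VVt in auto)
  qed
  \<comment> \<open>The value is given through an arbitrary minimal realisation of \<open>m\<close>,
    while the coupling uses the one on \<open>V\<close>.\<close>
  have m_iff: "(x, y) \<in> m\<^sub>\<alpha> \<longleftrightarrow> (\<exists>f\<in>V. Mw.boundary_values \<alpha> f x y)" for x y
  proof -
    have "(\<exists>f\<in>V\<^sub>m. Vm.boundary_values \<alpha> f x y) \<longleftrightarrow> (\<exists>f\<in>V. Mw.boundary_values \<alpha> f x y)"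
      using boundary_values_transfer[OF Vm.realisation_window_axioms Mw.realisation_window_axioms]
        boundary_values_transfer[OF Mw.realisation_window_axioms Vm.realisation_window_axioms] by metis
    then show ?thesis
      unfolding m\<^sub>\<alpha>_def Vm.value_iff_boundary_values .
  qed
  have \<tau>_iff: "(x, - y) \<in> \<tau>\<^sub>\<alpha> \<longleftrightarrow> (\<exists>k\<in>V\<^sub>\<tau>. Tw.boundary_values \<alpha> k x (- y))" for x y
    unfolding \<tau>\<^sub>\<alpha>_def by (rule Tw.value_iff_boundary_values)
  let ?K = "rel_ker At (of_real \<alpha>)"
  let ?Z = "{(x\<^sub>0, y\<^sub>0). (x\<^sub>0, y\<^sub>0) \<in> m\<^sub>\<alpha> \<and> (x\<^sub>0, - y\<^sub>0) \<in> \<tau>\<^sub>\<alpha>}"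
  obtain F where F: "clinear_on ?K F" "bij_betw F ?K ?Z"
    using C.eigenvector_bijection[of \<alpha>] unfolding m_iff \<tau>_iff by blast
  have K0: "0 \<in> ?K"
    using E.A_zero by (simp add: rel_ker_def)
  have F0: "F 0 = 0"
    using F(1) K0 unfolding clinear_on_def by (metis complex_vector.scale_zero_left)
  have "is_eigenvalue At (of_real \<alpha>) \<longleftrightarrow> (\<exists>v\<in>?K. v \<noteq> 0)"
    using K0 by (auto simp: is_eigenvalue_def)
  also have "\<dots> \<longleftrightarrow> (\<exists>p\<in>?Z. p \<noteq> 0)"
  proof -
    have "F v \<noteq> 0 \<longleftrightarrow> v \<noteq> 0" if "v \<in> ?K" for v
      using inj_on_eq_iff[OF bij_betw_imp_inj_on[OF F(2)] that K0] F0 by simp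
    then show ?thesis
      unfolding bij_betw_imp_surj_on[OF F(2), symmetric] bex_simps by blast
  qed
  finally show ?thesis
    using F by (auto simp: zero_prod_def)
qed

end
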